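(* Let $V\subset\mathbb P^3$ be a smooth cubic surface and $\Pi\subset\mathbb P^3$ a plane, both defined over a number field, such that the intersection $V\cap\Pi$ contains a line. Let $X^o:=\mathbb P^3\setminus(V\cup\Pi)$. Then the integral points on $X^o$ are potentially dense.
   Context: Let $X\subset\mathbb P^n$ be a projective variety over a number field $\mathbb K$, let $D\subset X$ be a proper closed algebraic subset and let $X^o=X\setminus D$. For a finite set $S$ of places of $\mathbb K$ containing the archimedean ones, a point $P\in X^o(\mathbb K)$ is $S$-integral with respect to $D$ if for no place $\nu\notin S$ does $P$ reduce modulo $\nu$ to a point of $D$. The integral points of $X^o$ are potentially dense if, after replacing $\mathbb K$ by a suitable finite extension and enlarging the finite set $S$ suitably, the set of $S$-integral points of $X^o$ is Zariski-dense. *)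

theory Defs
  imports "HOL-Analysis.Analysis" "HOL-Library.Poly_Mapping"
begin

(* Number fields are taken inside the complex numbers, so that finite extensions are inclusions
   and the complex numbers serve as the algebraically closed field of geometric points. *)
definition number_field :: "complex set \<Rightarrow> bool" where
  "number_field K \<longleftrightarrow>
     0 \<in> K \<and> 1 \<in> K \<and>
     (\<forall>x\<in>K. \<forall>y\<in>K. x + y \<in> K \<and> x * y \<in> K) \<and>
     (\<forall>x\<in>K. - x \<in> K \<and> inverse x \<in> K) \<and>
     (\<exists>B. finite B \<and> (\<forall>x\<in>K. \<exists>c :: complex \<Rightarrow> rat. x = (\<Sum>b\<in>B. of_rat (c b) * b)))"

definition absolute_value_on :: "complex set \<Rightarrow> (complex \<Rightarrow> real) \<Rightarrow> bool" where
  "absolute_value_on K v \<longleftrightarrow>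
     (\<forall>x\<in>K. 0 \<le> v x \<and> (v x = 0 \<longleftrightarrow> x = 0)) \<and>
     (\<forall>x\<in>K. \<forall>y\<in>K. v (x * y) = v x * v y \<and> v (x + y) \<le> v x + v y)"

definition nontrivial_on :: "complex set \<Rightarrow> (complex \<Rightarrow> real) \<Rightarrow> bool" where
  "nontrivial_on K v \<longleftrightarrow> (\<exists>x\<in>K. x \<noteq> 0 \<and> v x \<noteq> 1)"

definition ultrametric_on :: "complex set \<Rightarrow> (complex \<Rightarrow> real) \<Rightarrow> bool" where
  "ultrametric_on K v \<longleftrightarrow> (\<forall>x\<in>K. \<forall>y\<in>K. v (x + y) \<le> max (v x) (v y))"

(* Only the values on K are compared, so the junk values of v outside K do not affect the class. *)
definition place_of :: "complex set \<Rightarrow> (complex \<Rightarrow> real) \<Rightarrow> (complex \<Rightarrow> real) set" where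
  "place_of K v =
     {w. absolute_value_on K w \<and> (\<exists>s>0. \<forall>x\<in>K. w x = v x powr s)}"

definition places :: "complex set \<Rightarrow> (complex \<Rightarrow> real) set set" where
  "places K = {place_of K v | v. absolute_value_on K v \<and> nontrivial_on K v}"

definition archimedean_places :: "complex set \<Rightarrow> (complex \<Rightarrow> real) set set" where
  "archimedean_places K = {\<nu> \<in> places K. \<exists>v\<in>\<nu>. \<not> ultrametric_on K v}"

definition valuation_ring :: "complex set \<Rightarrow> (complex \<Rightarrow> real) set \<Rightarrow> complex set" where
  "valuation_ring K \<nu> = {x \<in> K. \<forall>v\<in>\<nu>. v x \<le> 1}"

definition valuation_ideal :: "complex set \<Rightarrow> (complex \<Rightarrow> real) set \<Rightarrow> complex set" where
  "valuation_ideal K \<nu> = {x \<in> K. \<forall>v\<in>\<nu>. v x < 1}"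

type_synonym 'n mpoly = "('n \<Rightarrow>\<^sub>0 nat) \<Rightarrow>\<^sub>0 complex"

definition coeffs_in :: "complex set \<Rightarrow> 'n mpoly \<Rightarrow> bool" where
  "coeffs_in A p \<longleftrightarrow> (\<forall>m\<in>Poly_Mapping.keys p. Poly_Mapping.lookup p m \<in> A)"

definition peval :: "('n::finite) mpoly \<Rightarrow> complex ^ 'n \<Rightarrow> complex" where
  "peval p x =
     (\<Sum>m\<in>Poly_Mapping.keys p.
        Poly_Mapping.lookup p m * (\<Prod>i\<in>UNIV. (x $ i) ^ Poly_Mapping.lookup m i))"

(* The zero polynomial is homogeneous of every degree. *)
definition homogeneous :: "nat \<Rightarrow> ('n::finite) mpoly \<Rightarrow> bool" where
  "homogeneous d p \<longleftrightarrow>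
     (\<forall>m\<in>Poly_Mapping.keys p. (\<Sum>i\<in>UNIV. Poly_Mapping.lookup m i) = d)"

(* Formal partial derivative. For a variable i not occurring in m the truncated exponent
   m - single i 1 is harmless, because the coefficient is 0. *)
definition partial_deriv :: "'n \<Rightarrow> 'n mpoly \<Rightarrow> 'n mpoly" where
  "partial_deriv i p =
     (\<Sum>m\<in>Poly_Mapping.keys p.
        Poly_Mapping.single (m - Poly_Mapping.single i 1)
          (of_nat (Poly_Mapping.lookup m i) * Poly_Mapping.lookup p m))"

(* A point of projective space is the set of all its homogeneous coordinate vectors;
   the dimension of the space is CARD('n) - 1. *)
definition proj_point :: "complex ^ 'n \<Rightarrow> (complex ^ 'n) set" where
  "proj_point x = {c *s x | c. c \<noteq> 0}"

definition proj_space :: "(complex ^ 'n) set set" where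
  "proj_space = {proj_point x | x. x \<noteq> 0}"

definition rational_points :: "complex set \<Rightarrow> (complex ^ 'n) set set" where
  "rational_points K = {proj_point x | x. x \<noteq> 0 \<and> (\<forall>i. x $ i \<in> K)}"

definition zero_locus :: "('n::finite) mpoly set \<Rightarrow> (complex ^ 'n) set set" where
  "zero_locus G = {P \<in> proj_space. \<forall>g\<in>G. \<forall>x\<in>P. peval g x = 0}"

definition zariski_closed :: "(complex ^ 'n::finite) set set \<Rightarrow> bool" where
  "zariski_closed Z \<longleftrightarrow> (\<exists>G. (\<forall>g\<in>G. \<exists>d. homogeneous d g) \<and> Z = zero_locus G)"

definition zariski_dense_in ::
    "(complex ^ 'n::finite) set set \<Rightarrow> (complex ^ 'n) set set \<Rightarrow> bool" where
  "zariski_dense_in \<Sigma> U \<longleftrightarrow>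
     \<Sigma> \<subseteq> U \<and> (\<forall>Z. zariski_closed Z \<and> \<Sigma> \<subseteq> Z \<longrightarrow> U \<subseteq> Z)"

definition proj_line :: "(complex ^ 'n::finite) set set \<Rightarrow> bool" where
  "proj_line l \<longleftrightarrow>
     (\<exists>W. vec.subspace W \<and> vec.dim W = 2 \<and> l = {proj_point x | x. x \<in> W \<and> x \<noteq> 0})"

definition plane_over :: "complex set \<Rightarrow> (complex ^ 4) set set \<Rightarrow> bool" where
  "plane_over K E \<longleftrightarrow>
     (\<exists>h. h \<noteq> 0 \<and> homogeneous 1 h \<and> coeffs_in K h \<and> E = zero_locus {h})"

(* Jacobian criterion at every geometric point; it forces f to be nonzero and squarefree. *)
definition smooth_cubic_surface_over :: "complex set \<Rightarrow> (complex ^ 4) set set \<Rightarrow> bool" where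
  "smooth_cubic_surface_over K V \<longleftrightarrow>
     (\<exists>f. homogeneous 3 f \<and> coeffs_in K f \<and> V = zero_locus {f} \<and>
        (\<forall>P\<in>V. \<forall>x\<in>P. \<exists>i. peval (partial_deriv i f) x \<noteq> 0))"

(* The reduction of D modulo nu is the special fibre of the closure of D in projective space
   over the valuation ring: its equations are the reductions of all forms with coefficients in
   the valuation ring that vanish on D. The reduction of P is computed from a coordinate vector
   with entries in the valuation ring, not all of them in the maximal ideal. *)
definition reduces_into ::
    "complex set \<Rightarrow> (complex \<Rightarrow> real) set \<Rightarrow> (complex ^ 'n::finite) set \<Rightarrow>
     (complex ^ 'n) set set \<Rightarrow> bool" where
  "reduces_into K \<nu> P D \<longleftrightarrow>
     (\<exists>x\<in>P. (\<forall>i. x $ i \<in> valuation_ring K \<nu>) \<and> (\<exists>i. x $ i \<notin> valuation_ideal K \<nu>) \<and>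
        (\<forall>g d. homogeneous d g \<and> coeffs_in (valuation_ring K \<nu>) g \<and> D \<subseteq> zero_locus {g} \<longrightarrow>
           peval g x \<in> valuation_ideal K \<nu>))"

definition integral_points ::
    "complex set \<Rightarrow> (complex \<Rightarrow> real) set set \<Rightarrow> (complex ^ 'n::finite) set set \<Rightarrow>
     (complex ^ 'n) set set \<Rightarrow> (complex ^ 'n) set set" where
  "integral_points K S X D =
     {P \<in> rational_points K \<inter> (X - D). \<forall>\<nu>\<in>places K - S. \<not> reduces_into K \<nu> P D}"

definition integral_points_potentially_dense ::
    "complex set \<Rightarrow> (complex ^ 'n::finite) set set \<Rightarrow> (complex ^ 'n) set set \<Rightarrow> bool" where
  "integral_points_potentially_dense K X D \<longleftrightarrow>
     (\<exists>L S. number_field L \<and> K \<subseteq> L \<and>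
        finite S \<and> archimedean_places L \<subseteq> S \<and> S \<subseteq> places L \<and>
        zariski_dense_in (integral_points L S X D) (X - D))"

end

theory Submission
  imports Defs "HOL-Computational_Algebra.Primes"
begin

text \<open>Put the plane at infinity and let \<open>l\<close> be the line in \<open>V \<inter> \<Pi>\<close>; an integral point is an integral
  point of affine space at which the equation \<open>F\<close> of \<open>V\<close> takes a unit value. The planes through
  \<open>l\<close> cut \<open>V\<close> in \<open>l\<close> and a residual conic, and the conic in the plane \<open>y = c\<close> meets \<open>l\<close> in rational
  points \<open>d, d'\<close> whenever \<open>c\<close> is the value at a rational point of the degree 2 map which sends a point of \<open>l\<close> to its
  tangent plane; infinitely many integral \<open>c\<close> arise from powers of 2. On the affine lines in the plane
  \<open>y = c\<close> with direction \<open>d\<close> or \<open>d'\<close>, \<open>F\<close> is affine linear, so a single integral point of the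
  complement in that plane spreads, since powers of 2 are periodic modulo every nonzero integer of
  odd norm, first along one line in direction \<open>d\<close> and then along infinitely many parallel lines in
  direction \<open>d'\<close>, and these are dense in the plane.

  To have such a point in every one of the planes, one uses a line which meets \<open>V \<union> \<Pi>\<close> in a single
  point: an inflectional tangent of \<open>V\<close> at a point \<open>p\<close> of the residual conic of \<open>V \<inter> \<Pi>\<close>, along which \<open>F\<close> is a nonzero
  constant. That the tangent does not lie on \<open>V\<close> follows from its asymptotic position when \<open>p\<close> moves
  to \<open>l\<close>.\<close>

section \<open>Number fields inside the complex numbers\<close>

text \<open>The field and the finite set \<open>S\<close> must be fixed before infinitely many
  planes \<open>y = c\<close> are treated. The constant line makes this possible: it meets each of
  these planes in a point at which \<open>F\<close> has the same value \<kappa>, so inverting the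
  single number \<kappa> provides a starting point in all of them. The numbers \<open>c\<close> are
  integral for all \<open>n\<close> at once because the quadratic form \<open>a\<close>, whose zeros
  are the points where the residual conic at infinity meets \<open>l\<close>, is brought to the
  shape \<open>x z\<close> or \<open>x^2\<close>. The tangent plane at the point
  \<open>(1 : 2^n)\<close> of \<open>l\<close> is \<open>y = - b / a\<close>, and there
  \<open>a\<close> is a power of 2, a unit once 1/2 is integral.

  Two preparations take up much of the proof. Places are classes of absolute values, and the
  finiteness of the places to be put into \<open>S\<close> is derived from this description:
  approximation bounds the number of places whose absolute values order the natural numbers alike.
  Moreover, the line is given over the complex numbers only and has to be shown to be defined over a
  number field.\<close>

interpretation rat_vs: vector_space "\<lambda>q (x::complex). of_rat q * x"
  by standard (simp_all add: algebra_simps of_rat_add of_rat_mult)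

lemma clear_denominators:
  fixes u :: "nat \<Rightarrow> rat"
  shows "\<exists>D a. D \<noteq> 0 \<and> (\<forall>i\<le>n. rat_of_int (a i) = of_int D * u i)"
proof (induction n)
  case 0
  obtain r s where rs: "quotient_of (u 0) = (r, s)" by fastforce
  have "s > 0" "u 0 = of_int r / of_int s" using quotient_of_denom_pos[OF rs] quotient_of_div[OF rs] by auto
  then show ?case by (intro exI[of _ s] exI[of _ "\<lambda>_. r"]) auto
next
  case (Suc n)
  then obtain D a where D: "D \<noteq> 0" "\<And>i. i \<le> n \<Longrightarrow> rat_of_int (a i) = of_int D * u i" by blast
  obtain r s where rs: "quotient_of (u (Suc n)) = (r, s)" by fastforce
  have s: "s > 0" "u (Suc n) = of_int r / of_int s"
    using quotient_of_denom_pos[OF rs] quotient_of_div[OF rs] by auto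
  show ?case
    using D s by (intro exI[of _ "D * s"] exI[of _ "\<lambda>i. if i \<le> n then s * a i else D * r"])
      (auto simp: le_Suc_eq)
qed

text \<open>Finite dimension makes the powers of \<open>x\<close> dependent over the rationals. A
  relation of least length has a nonzero top coefficient, and a nonzero constant one since otherwise
  \<open>x\<close> could be cancelled. The constant term yields inverses and integer multiples of
  \<open>x\<close>, the top one bounds denominators.\<close>

lemma integral_relation:
  fixes x :: complex
  assumes B: "finite B" and pw: "\<And>i. x ^ i \<in> rat_vs.span B" and x0: "x \<noteq> 0"
  shows "\<exists>(a :: nat \<Rightarrow> int) n. a 0 \<noteq> 0 \<and> a n \<noteq> 0 \<and> (\<Sum>i\<le>n. of_int (a i) * x ^ i) = 0"
proof -
  define rel where "rel n \<longleftrightarrow> (\<exists>a :: nat \<Rightarrow> int. (\<exists>i\<le>n. a i \<noteq> 0) \<and> (\<Sum>i\<le>n. of_int (a i) * x ^ i) = 0)" for n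
  have "\<exists>n. rel n"
  \<comment> \<open>Dependence concerns the set of powers, so coinciding powers are treated apart;
    they give the relation \<open>x ^ j - x ^ i = 0\<close>.\<close>
  proof (cases "inj_on (\<lambda>i. x ^ i) {..card B}")
    case True
    let ?S = "(\<lambda>i. x ^ i) ` {..card B}"
    have "card ?S = card B + 1" using True by (simp add: card_image)
    have "rat_vs.dependent ?S"
    proof (rule ccontr)
      assume "rat_vs.independent ?S"
      from rat_vs.independent_span_bound[OF B this] pw have "card ?S \<le> card B" by auto
      then show False using \<open>card ?S = card B + 1\<close> by simp
    qed
    then have "\<exists>u. (\<exists>v\<in>?S. u v \<noteq> 0) \<and> (\<Sum>v\<in>?S. of_rat (u v) * v) = 0"
      by (rule iffD1[OF rat_vs.dependent_finite[OF finite_imageI[OF finite_atMost]]])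
    then obtain u where u: "\<exists>v\<in>?S. u v \<noteq> 0" "(\<Sum>v\<in>?S. of_rat (u v) * v) = 0"
      by (elim exE conjE)
    obtain D a where D: "D \<noteq> 0" "\<And>i. i \<le> card B \<Longrightarrow> rat_of_int (a i) = of_int D * u (x ^ i)"
      using clear_denominators[of "card B" "\<lambda>i. u (x ^ i)"] by blast
    have "(\<Sum>i\<le>card B. of_int (a i) * x ^ i) = (\<Sum>i\<le>card B. of_int D * (of_rat (u (x ^ i)) * x ^ i))"
    proof (intro sum.cong refl)
      fix i assume "i \<in> {..card B}"
      then have "of_rat (rat_of_int (a i)) = (of_rat (of_int D * u (x ^ i)) :: complex)" using D by simp
      then show "of_int (a i) * x ^ i = of_int D * (of_rat (u (x ^ i)) * x ^ i)"
        by (simp add: of_rat_mult)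
    qed
    also have "\<dots> = of_int D * (\<Sum>v\<in>?S. of_rat (u v) * v)"
      by (subst sum.reindex[OF True]) (simp add: sum_distrib_left)
    finally have "(\<Sum>i\<le>card B. of_int (a i) * x ^ i) = 0" using u by simp
    moreover have "\<exists>i\<le>card B. a i \<noteq> 0"
    proof -
      obtain i where i: "i \<le> card B" "u (x ^ i) \<noteq> 0" using u by auto
      have "rat_of_int (a i) \<noteq> 0" using D i by simp
      then have "a i \<noteq> 0" by (metis of_int_0)
      then show ?thesis using i by blast
    qed
    ultimately show ?thesis unfolding rel_def by blast
  next
    case False
    then have "\<exists>i j. x ^ i = x ^ j \<and> i \<noteq> j" by (auto simp: inj_on_def)
    then obtain i j where "x ^ i = x ^ j" "i \<noteq> j" by (elim exE conjE)
    then obtain i j where ij: "x ^ i = x ^ j" "i < j" by (metis linorder_neqE_nat)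
    define a where "a k = (if k = j then 1 else if k = i then - 1 else 0 :: int)" for k
    have "(\<Sum>k\<le>j. of_int (a k) * x ^ k) = (\<Sum>k\<in>{i, j}. of_int (a k) * x ^ k)"
      using ij(2) by (intro sum.mono_neutral_right) (auto simp: a_def)
    also have "\<dots> = 0" using ij by (simp add: a_def)
    finally have "(\<Sum>k\<le>j. of_int (a k) * x ^ k) = 0" .
    moreover have "\<exists>k\<le>j. a k \<noteq> 0" by (rule exI[of _ j]) (simp add: a_def)
    ultimately have "rel j" unfolding rel_def by (intro exI[of _ a] conjI)
    then show ?thesis ..
  qed
  then obtain n where L: "rel n" and min: "\<And>m. m < n \<Longrightarrow> \<not> rel m"
    using exists_least_iff[of rel] by blast
  from L obtain a where a: "\<exists>i\<le>n. a i \<noteq> (0::int)" "(\<Sum>i\<le>n. of_int (a i) * x ^ i) = 0"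
    unfolding rel_def by blast
  have an: "a n \<noteq> 0"
  proof
    assume z: "a n = 0"
    obtain i where i: "i \<le> n" "a i \<noteq> 0" using a(1) by blast
    with z have "i < n" by (metis le_neq_implies_less)
    then obtain m where m: "n = Suc m" "i \<le> m" by (metis less_Suc_eq_le not0_implies_Suc not_less_zero)
    have "rel m" unfolding rel_def
      using a(2) z i m by (intro exI[of _ a]) auto
    then show False using min[of m] m by simp
  qed
  have a0: "a 0 \<noteq> 0"
  proof
    assume z: "a 0 = 0"
    then obtain m where m: "n = Suc m" using an by (metis not0_implies_Suc)
    have "(\<Sum>i\<le>n. of_int (a i) * x ^ i) = x * (\<Sum>i\<le>m. of_int (a (Suc i)) * x ^ i)"
      unfolding m sum.atMost_Suc_shift sum_distrib_left using z by (simp add: ac_simps)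
    then have "(\<Sum>i\<le>m. of_int (a (Suc i)) * x ^ i) = 0" using a x0 by simp
    moreover have "\<exists>i\<le>m. a (Suc i) \<noteq> 0" using an m by blast
    ultimately have "rel m" unfolding rel_def by (intro exI[of _ "\<lambda>i. a (Suc i)"] conjI)
    then show False using min[of m] m by simp
  qed
  show ?thesis by (rule exI[of _ a], rule exI[of _ n]) (use an a0 a(2) in simp)
qed

lemma number_field_span:
  assumes "number_field K"
  obtains B where "finite B" "K \<subseteq> rat_vs.span B"
proof -
  obtain B where B: "finite B" "\<And>x. x \<in> K \<Longrightarrow> \<exists>c :: complex \<Rightarrow> rat. x = (\<Sum>b\<in>B. of_rat (c b) * b)"
    using assms unfolding number_field_def by blast
  have "K \<subseteq> rat_vs.span B"
  proof
    fix x assume "x \<in> K"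
    then obtain c where x: "x = (\<Sum>b\<in>B. of_rat (c b) * b)" using B by blast
    show "x \<in> rat_vs.span B" unfolding x
      by (intro rat_vs.span_sum rat_vs.span_scale rat_vs.span_base)
  qed
  then show ?thesis using that B by blast
qed

context
  fixes K :: "complex set"
  assumes K: "number_field K"
begin

lemma nf_zero: "0 \<in> K" and nf_one: "1 \<in> K"
  and nf_add: "x \<in> K \<Longrightarrow> y \<in> K \<Longrightarrow> x + y \<in> K"
  and nf_mult: "x \<in> K \<Longrightarrow> y \<in> K \<Longrightarrow> x * y \<in> K"
  and nf_minus: "x \<in> K \<Longrightarrow> - x \<in> K"
  and nf_inverse: "x \<in> K \<Longrightarrow> inverse x \<in> K"
  using K unfolding number_field_def by auto

lemma nf_diff: "x \<in> K \<Longrightarrow> y \<in> K \<Longrightarrow> x - y \<in> K"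
  using nf_add[of x "- y"] nf_minus by simp

lemma nf_divide: "x \<in> K \<Longrightarrow> y \<in> K \<Longrightarrow> x / y \<in> K"
  by (simp add: divide_inverse nf_mult nf_inverse)

lemma nf_power: "x \<in> K \<Longrightarrow> x ^ n \<in> K"
  by (induction n) (auto simp: nf_one nf_mult)

lemma nf_of_nat: "of_nat n \<in> K"
  by (induction n) (auto simp: nf_zero nf_one nf_add)

lemma nf_numeral: "numeral n \<in> K"
  using nf_of_nat[of "numeral n"] by simp

lemma nf_of_int: "of_int n \<in> K"
  by (cases n) (auto simp: nf_of_nat nf_minus nf_add nf_one nf_diff)

lemma nf_of_rat: "of_rat q \<in> K"
  by (cases q) (auto simp: of_rat_rat intro!: nf_divide nf_of_int)

lemma nf_sum: "(\<And>i. i \<in> A \<Longrightarrow> g i \<in> K) \<Longrightarrow> sum g A \<in> K"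
  by (induction A rule: infinite_finite_induct) (auto simp: nf_zero nf_add)

lemma nf_integral_relation:
  assumes "x \<in> K" "x \<noteq> 0"
  shows "\<exists>(a :: nat \<Rightarrow> int) n. a 0 \<noteq> 0 \<and> a n \<noteq> 0 \<and> (\<Sum>i\<le>n. of_int (a i) * x ^ i) = 0"
  using number_field_span[OF K] integral_relation[of _ x] nf_power assms by (metis subsetD)

end

text \<open>Inverses come for free in finite dimension: an integral relation with nonzero constant
  term reads \<open>x * y = - a 0\<close>, where \<open>y\<close> is a polynomial in
  \<open>x\<close> and so lies in the ring.\<close>

lemma number_fieldI:
  assumes ring: "0 \<in> A" "1 \<in> A" "\<And>x y. x \<in> A \<Longrightarrow> y \<in> A \<Longrightarrow> x + y \<in> A"
      "\<And>x y. x \<in> A \<Longrightarrow> y \<in> A \<Longrightarrow> x * y \<in> A"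
    and rat: "\<And>q. of_rat q \<in> A"
    and B: "finite B" "A \<subseteq> rat_vs.span B"
  shows "number_field A"
proof -
  have neg: "- x \<in> A" if "x \<in> A" for x using ring(4)[OF rat[of "-1"] that] by simp
  have pw: "x ^ i \<in> A" if "x \<in> A" for x i using that by (induction i) (auto intro: ring)
  have sm: "sum g I \<in> A" if "\<And>i. i \<in> I \<Longrightarrow> g i \<in> A" for g :: "nat \<Rightarrow> complex" and I
    using that by (induction I rule: infinite_finite_induct) (auto intro: ring)
  have inv: "inverse x \<in> A" if x: "x \<in> A" for x
  proof (cases "x = 0")
    case False
    have pB: "x ^ i \<in> rat_vs.span B" for i using pw[OF x] B by blast
    obtain a :: "nat \<Rightarrow> int" and n where a: "a 0 \<noteq> 0" "a n \<noteq> 0" "(\<Sum>i\<le>n. of_int (a i) * x ^ i) = 0"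
      using integral_relation[OF B(1) pB False] by blast
    have "n \<noteq> 0" using a by (cases n) auto
    then obtain m where m: "n = Suc m" using not0_implies_Suc by blast
    define y where "y = (\<Sum>i\<le>m. of_int (a (Suc i)) * x ^ i)"
    have "of_int (a 0) + x * y = 0" using a(3) unfolding m y_def sum.atMost_Suc_shift sum_distrib_left
      by (simp add: ac_simps)
    then have "x * y = of_int (- a 0)" by (simp add: add_eq_0_iff)
    then have "inverse x = of_rat (inverse (of_int (- a 0))) * y"
      using False a(1) by (simp add: field_simps of_rat_inverse of_rat_minus of_rat_divide)
    moreover have "of_int k \<in> A" for k using rat[of "of_int k"] by simp
    then have "y \<in> A" unfolding y_def by (intro sm ring(4) pw x)
    ultimately show ?thesis using ring(4) rat by metis
  qed (use ring in simp)
  have "\<exists>c :: complex \<Rightarrow> rat. x = (\<Sum>b\<in>B. of_rat (c b) * b)" if "x \<in> A" for x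
    using that B rat_vs.span_finite[OF B(1)] by auto
  then have "\<exists>B. finite B \<and> (\<forall>x\<in>A. \<exists>c :: complex \<Rightarrow> rat. x = (\<Sum>b\<in>B. of_rat (c b) * b))"
    using B(1) by (intro exI[of _ B] conjI ballI)
  then show ?thesis unfolding number_field_def using ring neg inv by simp
qed

text \<open>The nonzero leading coefficient is enough to reduce all powers of \<alpha> to exponents
  below \<open>n\<close>, irreducible polynomial or not. Thus the polynomial expressions in \<alpha>
  over \<open>K\<close> form a ring of finite rational dimension, which \<open>number_fieldI\<close>
  turns into a field.\<close>

lemma adjoin_root:
  assumes K: "number_field K"
    and cK: "\<And>i. c i \<in> K" and nz: "c n \<noteq> 0" and root: "(\<Sum>i\<le>n. c i * \<alpha> ^ i) = 0"
  shows "\<exists>L. number_field L \<and> K \<subseteq> L \<and> \<alpha> \<in> L"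
proof -
  define A where "A = {\<Sum>i<m. d i * \<alpha> ^ i | (m::nat) d. \<forall>i. d i \<in> K}"
  have AI: "poly q \<alpha> \<in> A" if "\<And>i. coeff q i \<in> K" for q
    unfolding A_def using that
    by (auto simp: poly_altdef intro!: exI[of _ "Suc (degree q)"] exI[of _ "coeff q"] sum.cong)
  have AE: "\<exists>q. x = poly q \<alpha> \<and> (\<forall>i. coeff q i \<in> K)" if "x \<in> A" for x
  proof -
    obtain m d where d: "x = (\<Sum>i<m. d i * \<alpha> ^ i)" "\<And>i. d i \<in> K" using \<open>x \<in> A\<close> unfolding A_def by blast
    have "x = poly (\<Sum>i<m. monom (d i) i) \<alpha>" unfolding d by (simp add: poly_sum poly_monom)
    moreover have "coeff (\<Sum>i<m. monom (d i) i) j \<in> K" for j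
      by (auto simp: coeff_sum d nf_zero[OF K] intro!: nf_sum[OF K])
    ultimately show ?thesis by blast
  qed
  obtain B where B: "finite B" "K \<subseteq> rat_vs.span B" using number_field_span[OF K] .
  define B' where "B' = (\<lambda>(b, i). b * \<alpha> ^ i) ` (B \<times> {..<n})"
  have KS: "k * \<alpha> ^ i \<in> rat_vs.span B'" if k: "k \<in> K" "i < n" for k i
  proof -
    obtain u where u: "k = (\<Sum>b\<in>B. of_rat (u b) * b)" using subsetD[OF B(2) k(1)] unfolding rat_vs.span_finite[OF B(1)] by (rule imageE)
    have "k * \<alpha> ^ i = (\<Sum>b\<in>B. of_rat (u b) * (b * \<alpha> ^ i))" unfolding u sum_distrib_right by (simp add: mult_ac)
    also have "\<dots> \<in> rat_vs.span B'"
      using k by (intro rat_vs.span_sum rat_vs.span_scale rat_vs.span_base) (auto simp: B'_def)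
    finally show ?thesis .
  qed
  have red: "\<exists>d. (\<forall>i. d i \<in> K) \<and> \<alpha> ^ m = (\<Sum>i<n. d i * \<alpha> ^ i)" for m
  proof (induction m)
    case 0
    show ?case
    proof (cases n)
      case 0 then show ?thesis using nz root by simp
    next
      case (Suc n')
      have "(\<Sum>i<n. (if i = 0 then 1 else 0) * \<alpha> ^ i) = (\<Sum>i<n. if i = 0 then 1 else 0)"
        by (intro sum.cong) auto
      also have "\<dots> = 1" using Suc by simp
      finally show ?thesis by (intro exI[of _ "\<lambda>i. if i = 0 then 1 else 0"]) (auto simp: nf_zero[OF K] nf_one[OF K])
    qed
  next
    case (Suc m)
    then obtain d where d: "\<And>i. d i \<in> K" "\<alpha> ^ m = (\<Sum>i<n. d i * \<alpha> ^ i)" by blast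
    obtain n' where n': "n = Suc n'" using nz root by (cases n) auto
    have an: "\<alpha> ^ n = (\<Sum>i<n. (- c i / c n) * \<alpha> ^ i)"
    proof -
      have "(\<Sum>i<n. c i * \<alpha> ^ i) + c n * \<alpha> ^ n = 0"
        using root by (simp add: lessThan_Suc_atMost[symmetric])
      then have "\<alpha> ^ n = - (\<Sum>i<n. c i * \<alpha> ^ i) / c n" using nz
        by (simp add: field_simps add_eq_0_iff)
      also have "\<dots> = (\<Sum>i<n. (- c i / c n) * \<alpha> ^ i)"
        by (simp add: sum_divide_distrib sum_negf[symmetric])
      finally show ?thesis .
    qed
    have "\<alpha> ^ Suc m = (\<Sum>i<n. d i * \<alpha> ^ Suc i)" by (simp add: d(2) sum_distrib_left mult_ac)
    also have "\<dots> = (\<Sum>i<n'. d i * \<alpha> ^ Suc i) + d n' * \<alpha> ^ n" unfolding n' by simp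
    also have "(\<Sum>i<n'. d i * \<alpha> ^ Suc i) = (\<Sum>i<n. (if i = 0 then 0 else d (i - 1)) * \<alpha> ^ i)"
      unfolding n' by (subst sum.lessThan_Suc_shift) simp
    also have "\<dots> + d n' * \<alpha> ^ n
       = (\<Sum>i<n. ((if i = 0 then 0 else d (i - 1)) + d n' * (- c i / c n)) * \<alpha> ^ i)"
      unfolding an sum_distrib_left sum.distrib[symmetric] by (intro sum.cong) (simp_all add: algebra_simps)
    finally show ?case
      using d cK by (intro exI[of _ "\<lambda>i. (if i = 0 then 0 else d (i - 1)) + d n' * (- c i / c n)"])
        (auto intro!: nf_add[OF K] nf_mult[OF K] nf_divide[OF K] nf_minus[OF K] nf_diff[OF K] simp: nf_zero[OF K])
  qed
  have KP: "k * \<alpha> ^ m \<in> rat_vs.span B'" if "k \<in> K" for k m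
  proof -
    obtain d where d: "\<And>i. d i \<in> K" "\<alpha> ^ m = (\<Sum>i<n. d i * \<alpha> ^ i)" using red by blast
    have "k * \<alpha> ^ m = (\<Sum>i<n. (k * d i) * \<alpha> ^ i)" by (simp add: d(2) sum_distrib_left mult_ac)
    also have "\<dots> \<in> rat_vs.span B'" using that d by (intro rat_vs.span_sum KS) (auto intro: nf_mult[OF K])
    finally show ?thesis .
  qed
  have KA: "K \<subseteq> A"
  proof
    fix k assume "k \<in> K"
    then have "poly [:k:] \<alpha> \<in> A" by (intro AI) (auto simp: coeff_pCons nf_zero[OF K] split: nat.splits)
    then show "k \<in> A" by simp
  qed
  have "number_field A"
  proof (rule number_fieldI)
    show "0 \<in> A" "1 \<in> A" using KA nf_zero[OF K] nf_one[OF K] by blast+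
    show "x + y \<in> A" if "x \<in> A" "y \<in> A" for x y
    proof -
      obtain p q where "x = poly p \<alpha>" "\<forall>i. coeff p i \<in> K" "y = poly q \<alpha>" "\<forall>i. coeff q i \<in> K"
        using AE \<open>x \<in> A\<close> \<open>y \<in> A\<close> by meson
      then show ?thesis using AI[of "p + q"] by (auto intro: nf_add[OF K])
    qed
    show "x * y \<in> A" if "x \<in> A" "y \<in> A" for x y
    proof -
      obtain p q where "x = poly p \<alpha>" "\<forall>i. coeff p i \<in> K" "y = poly q \<alpha>" "\<forall>i. coeff q i \<in> K"
        using AE \<open>x \<in> A\<close> \<open>y \<in> A\<close> by meson
      then show ?thesis using AI[of "p * q"] by (auto simp: coeff_mult intro!: nf_sum[OF K] nf_mult[OF K])
    qed
    show "of_rat q \<in> A" for q using KA nf_of_rat[OF K] by blast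
    show "finite B'" unfolding B'_def using B by simp
    show "A \<subseteq> rat_vs.span B'" unfolding A_def by (auto intro!: rat_vs.span_sum KP)
  qed
  moreover have "poly [:0, 1:] \<alpha> \<in> A"
    by (intro AI) (auto simp: coeff_pCons nf_zero[OF K] nf_one[OF K] split: nat.splits)
  then have "\<alpha> \<in> A" by simp
  ultimately show ?thesis using KA by blast
qed

section \<open>Absolute values and approximation\<close>

locale abs_field =
  fixes K :: "complex set" and v :: "complex \<Rightarrow> real"
  assumes K: "number_field K" and av: "absolute_value_on K v"
begin

lemma nonneg: "x \<in> K \<Longrightarrow> 0 \<le> v x"
  and eq_0: "x \<in> K \<Longrightarrow> v x = 0 \<longleftrightarrow> x = 0"
  and mult: "x \<in> K \<Longrightarrow> y \<in> K \<Longrightarrow> v (x * y) = v x * v y"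
  and triangle: "x \<in> K \<Longrightarrow> y \<in> K \<Longrightarrow> v (x + y) \<le> v x + v y"
  using av unfolding absolute_value_on_def by auto

lemma zero: "v 0 = 0" using eq_0[OF nf_zero[OF K]] by simp

lemma one: "v 1 = 1"
  using mult[OF nf_one[OF K] nf_one[OF K]] eq_0[OF nf_one[OF K]] by simp

lemma pos: "x \<in> K \<Longrightarrow> x \<noteq> 0 \<Longrightarrow> 0 < v x"
  using nonneg[of x] eq_0[of x] by linarith

lemma power: "x \<in> K \<Longrightarrow> v (x ^ n) = v x ^ n"
  by (induction n) (auto simp: one mult nf_power[OF K])

lemma inverse: "x \<in> K \<Longrightarrow> v (inverse x) = inverse (v x)"
proof (cases "x = 0")
  case False
  assume x: "x \<in> K"
  have "v x * v (inverse x) = 1" using mult[OF x nf_inverse[OF K x]] False one by simp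
  then show ?thesis by (metis inverse_unique)
qed (simp add: zero)

lemma minus: "x \<in> K \<Longrightarrow> v (- x) = v x"
proof -
  have m: "- 1 \<in> K" using nf_minus[OF K nf_one[OF K]] .
  have "v (- 1) ^ 2 = 1" using power[OF m, of 2] one by simp
  then have "v (- 1) = 1" using nonneg[OF m] by (simp add: power2_eq_1_iff)
  then show "x \<in> K \<Longrightarrow> v (- x) = v x" using mult[OF m, of x] by simp
qed

lemma diff_le: "x \<in> K \<Longrightarrow> y \<in> K \<Longrightarrow> v x - v y \<le> v (x + y)"
  using triangle[OF nf_add[OF K], of x y "- y"] nf_minus[OF K, of y] minus[of y] by simp

lemma of_nat_le: "v (of_nat n) \<le> of_nat n"
proof (induction n)
  case (Suc n)
  show ?case using triangle[OF nf_of_nat[OF K, of n] nf_one[OF K]] Suc one by (simp add: add.commute)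
qed (simp add: zero)

lemma sum_le: "finite I \<Longrightarrow> (\<And>i. i \<in> I \<Longrightarrow> g i \<in> K) \<Longrightarrow> v (sum g I) \<le> (\<Sum>i\<in>I. v (g i))"
proof (induction I rule: finite_induct)
  case (insert i I)
  have "v (g i + sum g I) \<le> v (g i) + v (sum g I)"
    using insert by (intro triangle nf_sum[OF K]) auto
  then show ?case using insert by auto
qed (simp add: zero)

end

lemma placesE:
  assumes "number_field K" "\<nu> \<in> places K" "v \<in> \<nu>"
  shows "abs_field K v" "nontrivial_on K v" "\<nu> = place_of K v"
proof -
  obtain v0 where v0: "\<nu> = place_of K v0" "absolute_value_on K v0" "nontrivial_on K v0"
    using assms(2) unfolding places_def by blast
  obtain s where s: "s > 0" "\<And>x. x \<in> K \<Longrightarrow> v x = v0 x powr s" and av: "absolute_value_on K v"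
    using assms(3) v0(1) unfolding place_of_def by blast
  interpret v0: abs_field K v0 using assms v0 by unfold_locales
  show "abs_field K v" using assms av by unfold_locales
  obtain x where x: "x \<in> K" "x \<noteq> 0" "v0 x \<noteq> 1" using v0(3) unfolding nontrivial_on_def by blast
  have "v x \<noteq> 1" using x s v0.pos[of x] by (simp add: powr_def)
  then show "nontrivial_on K v" using x unfolding nontrivial_on_def by blast
  have "(\<exists>t>0. \<forall>x\<in>K. w x = v0 x powr t) \<longleftrightarrow> (\<exists>t>0. \<forall>x\<in>K. w x = v x powr t)" for w
  proof safe
    fix t :: real assume t: "t > 0" "\<forall>x\<in>K. w x = v0 x powr t"
    then show "\<exists>t>0. \<forall>x\<in>K. w x = v x powr t"
      using s by (intro exI[of _ "t / s"]) (auto simp: powr_powr)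
  next
    fix t :: real assume t: "t > 0" "\<forall>x\<in>K. w x = v x powr t"
    then show "\<exists>t>0. \<forall>x\<in>K. w x = v0 x powr t"
      using s by (intro exI[of _ "s * t"]) (auto simp: powr_powr)
  qed
  then show "\<nu> = place_of K v" unfolding v0(1) place_of_def by simp
qed

lemma place_of_eqI:
  assumes "number_field K" "absolute_value_on K v" "absolute_value_on K w" "nontrivial_on K v"
    "s > 0" "\<And>x. x \<in> K \<Longrightarrow> w x = v x powr s"
  shows "place_of K v = place_of K w"
proof -
  have "place_of K v \<in> places K" using assms unfolding places_def by blast
  moreover have "w \<in> place_of K v" using assms unfolding place_of_def by blast
  ultimately show ?thesis by (rule placesE(3)[OF assms(1)])
qed

lemma (in abs_field) nontrivial_gt_1:
  assumes "nontrivial_on K v" shows "\<exists>y\<in>K. v y > 1"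
proof -
  obtain x where x: "x \<in> K" "x \<noteq> 0" "v x \<noteq> 1" using assms unfolding nontrivial_on_def by blast
  show ?thesis
  proof (cases "v x > 1")
    case False
    then have "v (inverse x) > 1" using x pos[of x] inverse[of x] by (simp add: one_less_inverse_iff)
    then show ?thesis using nf_inverse[OF K x(1)] by blast
  qed (use x in blast)
qed

text \<open>The exponent is the ratio of logarithms at a fixed \<open>y\<close> with
  \<open>v y > 1\<close>. If \<open>ln (w x) / ln (w y)\<close> exceeded
  \<open>ln (v x) / ln (v y)\<close>, a rational \<open>m / n\<close> between them would make the
  quotient of \<open>x ^ n\<close> by \<open>y ^ m\<close> small for \<open>v\<close> but not for
  \<open>w\<close>. The opposite inequality is the same one for \<open>inverse x\<close>.\<close>

lemma place_eq_of_small_imp_small: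
  assumes "abs_field K v" "abs_field K w" and nv: "nontrivial_on K v"
    and imp: "\<And>x. x \<in> K \<Longrightarrow> v x < 1 \<Longrightarrow> w x < 1"
  shows "place_of K v = place_of K w"
proof -
  interpret v: abs_field K v by fact
  interpret w: abs_field K w by fact
  note K = v.K
  obtain y where y: "y \<in> K" "v y > 1" using v.nontrivial_gt_1[OF nv] by blast
  have y0: "y \<noteq> 0" using y v.zero by auto
  have "v (inverse y) < 1" using y v.inverse[OF y(1)] by (simp add: inverse_less_1_iff)
  from imp[OF nf_inverse[OF K y(1)] this] have "inverse (w y) < 1" using w.inverse[OF y(1)] by simp
  then have wy: "w y > 1" using w.pos[OF y(1) y0] by (simp add: inverse_less_1_iff)
  have le: "ln (w x) / ln (w y) \<le> ln (v x) / ln (v y)" if x: "x \<in> K" "x \<noteq> 0" for x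
  proof (rule ccontr)
    assume "\<not> ?thesis"
    then obtain r where r: "ln (v x) / ln (v y) < of_rat r" "of_rat r < ln (w x) / ln (w y)"
      using of_rat_dense[of "ln (v x) / ln (v y)" "ln (w x) / ln (w y)"] by auto
    obtain m n where mn: "quotient_of r = (m, n)" by fastforce
    have n: "n > 0" "r = of_int m / of_int n" using quotient_of_denom_pos[OF mn] quotient_of_div[OF mn] by auto
    have rr: "real_of_rat r = real_of_int m / real_of_int n" unfolding n by (simp add: of_rat_divide)
    \<comment> \<open>Exponents are natural numbers, so the possibly negative \<open>m\<close> is
      split as \<open>p - q\<close>.\<close>
    define a p q where "a = nat n" and "p = nat m" and "q = nat (- m)"
    have a: "real a = of_int n" "real p - real q = of_int m" using n by (auto simp: a_def p_def q_def)
    define z where "z = x ^ a * y ^ q * inverse (y ^ p)"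
    have zK: "z \<in> K" and z0: "z \<noteq> 0"
      unfolding z_def using x y y0 by (auto intro!: nf_mult[OF K] nf_power[OF K] nf_inverse[OF K])
    have lnv: "ln (v z) = real_of_int n * ln (v x) - real_of_int m * ln (v y)"
    proof -
      have "v z = v x ^ a * v y ^ q * inverse (v y ^ p)" unfolding z_def using x y
        by (simp add: v.mult v.power v.inverse nf_mult[OF K] nf_power[OF K] nf_inverse[OF K])
      then have "ln (v z) = real a * ln (v x) + real q * ln (v y) - real p * ln (v y)"
        using v.pos[OF x] v.pos[OF y(1) y0] by (simp add: ln_mult ln_inverse ln_realpow)
      also have "\<dots> = real a * ln (v x) - (real p - real q) * ln (v y)" by (simp add: algebra_simps)
      finally show ?thesis unfolding a .
    qed
    have lnw: "ln (w z) = real_of_int n * ln (w x) - real_of_int m * ln (w y)"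
    proof -
      have "w z = w x ^ a * w y ^ q * inverse (w y ^ p)" unfolding z_def using x y
        by (simp add: w.mult w.power w.inverse nf_mult[OF K] nf_power[OF K] nf_inverse[OF K])
      then have "ln (w z) = real a * ln (w x) + real q * ln (w y) - real p * ln (w y)"
        using w.pos[OF x] w.pos[OF y(1) y0] by (simp add: ln_mult ln_inverse ln_realpow)
      also have "\<dots> = real a * ln (w x) - (real p - real q) * ln (w y)" by (simp add: algebra_simps)
      finally show ?thesis unfolding a .
    qed
    have "ln (v z) < 0" unfolding lnv using r(1) n y(2) unfolding rr by (simp add: field_simps)
    then have "v z < 1" using v.pos[OF zK z0] by simp
    then have "w z < 1" using imp zK by blast
    then have "ln (w z) < 0" using w.pos[OF zK z0] by simp
    then show False unfolding lnw using r(2) n wy unfolding rr by (simp add: field_simps)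
  qed
  have eq: "ln (w x) / ln (w y) = ln (v x) / ln (v y)" if x: "x \<in> K" "x \<noteq> 0" for x
  proof -
    have "ln (w (inverse x)) / ln (w y) \<le> ln (v (inverse x)) / ln (v y)"
      using x nf_inverse[OF K] by (intro le) auto
    then show ?thesis using le[OF x] v.pos[OF x] w.pos[OF x]
      by (simp add: v.inverse w.inverse x ln_inverse)
  qed
  define s where "s = ln (w y) / ln (v y)"
  have s: "s > 0" unfolding s_def using y wy by simp
  have "w x = v x powr s" if x: "x \<in> K" for x
  proof (cases "x = 0")
    case False
    have "ln (w x) = s * ln (v x)" using eq[OF x False] wy y(2) by (simp add: s_def field_simps)
    then have "w x = exp (s * ln (v x))" using w.pos[OF x False] by (metis exp_ln)
    then show ?thesis using v.pos[OF x False] by (simp add: powr_def)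
  qed (simp add: v.zero w.zero)
  then show ?thesis using place_of_eqI[OF K v.av w.av nv s] by blast
qed

text \<open>The quotient \<open>y / x\<close>, where \<open>x\<close> is small for \<open>v\<close>
  only and \<open>y\<close> is small for \<open>w\<close> only.\<close>

lemma separate_two_places:
  assumes "abs_field K v" "abs_field K w" and nt: "nontrivial_on K v" "nontrivial_on K w"
    and ne: "place_of K v \<noteq> place_of K w"
  shows "\<exists>z\<in>K. v z > 1 \<and> w z < 1"
proof -
  interpret v: abs_field K v by fact
  interpret w: abs_field K w by fact
  obtain x where x: "x \<in> K" "v x < 1" "w x \<ge> 1"
    using place_eq_of_small_imp_small[OF assms(1,2) nt(1)] ne by force
  obtain y where y: "y \<in> K" "w y < 1" "v y \<ge> 1"
    using place_eq_of_small_imp_small[OF assms(2,1) nt(2)] ne by force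
  have x0: "x \<noteq> 0" using x w.zero by auto
  have iK: "inverse x \<in> K" using nf_inverse[OF v.K x(1)] .
  have "v (y * inverse x) = v y / v x" "w (y * inverse x) = w y / w x"
    using v.mult[OF y(1) iK] w.mult[OF y(1) iK] v.inverse[OF x(1)] w.inverse[OF x(1)]
    by (simp_all add: divide_inverse)
  moreover have "v y / v x > 1" using x y v.pos[OF x(1) x0] by (simp add: less_divide_eq_1)
  moreover have "w y / w x < 1" using x y by (simp add: divide_less_eq_1)
  ultimately show ?thesis using nf_mult[OF v.K y(1) iK] by (metis)
qed

text \<open>The induction of Artin and Whaples: an \<open>x\<close> that works for \<open>A\<close>
  is corrected at the new \<open>u\<close> by an element \<open>y\<close> separating
  \<open>v\<close> from \<open>u\<close>, in a way that depends on the size of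
  \<open>u x\<close>.\<close>

lemma approximation:
  assumes "finite A" "abs_field K v" "nontrivial_on K v"
    and A: "\<And>w. w \<in> A \<Longrightarrow> abs_field K w \<and> nontrivial_on K w \<and> place_of K w \<noteq> place_of K v"
  shows "\<exists>x\<in>K. v x > 1 \<and> (\<forall>w\<in>A. w x < 1)"
  using assms(1) A
proof (induction A rule: finite_induct)
  case empty
  then show ?case using abs_field.nontrivial_gt_1 assms by blast
next
  case (insert u A)
  interpret v: abs_field K v by fact
  interpret u: abs_field K u using insert.prems by blast
  note K = v.K
  obtain x where x: "x \<in> K" "v x > 1" "\<And>w. w \<in> A \<Longrightarrow> w x < 1" using insert by blast
  obtain y where y: "y \<in> K" "v y > 1" "u y < 1"
    using separate_two_places[of K v u] insert.prems assms by blast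
  have x0: "x \<noteq> 0" using x v.zero by auto
  consider "u x < 1" | "u x = 1" | "u x > 1" by linarith
  then show ?case
  proof cases
    case 1 then show ?thesis using x by blast
  next
    \<comment> \<open>High powers of \<open>x\<close> do not change the size of \<open>y\<close> at
      \<open>u\<close>, and they suppress it at the members of \<open>A\<close>.\<close>
    case 2
    have "\<forall>\<^sub>F n in sequentially. \<forall>w\<in>A. w x ^ n * w y < 1"
    proof (intro eventually_ball_finite ballI insert.hyps)
      fix w assume w: "w \<in> A"
      interpret w: abs_field K w using insert.prems w by blast
      have "(\<lambda>n. w x ^ n * w y) \<longlonglongrightarrow> 0 * w y"
        using x(1) x(3)[OF w] w.nonneg by (intro tendsto_intros LIMSEQ_power_zero) auto
      then show "\<forall>\<^sub>F n in sequentially. w x ^ n * w y < 1" by (rule order_tendstoD) simp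
    qed
    then obtain n where n: "\<And>w. w \<in> A \<Longrightarrow> w x ^ n * w y < 1"
      by (auto simp: eventually_sequentially)
    have zK: "x ^ n * y \<in> K" using x y by (intro nf_mult[OF K] nf_power[OF K])
    have val: "w (x ^ n * y) = w x ^ n * w y" if "abs_field K w" for w
      using abs_field.mult[OF that nf_power[OF K x(1)] y(1)] abs_field.power[OF that x(1)] by simp
    have "1 * v y \<le> v x ^ n * v y" using x y by (intro mult_right_mono one_le_power) auto
    then have "v (x ^ n * y) > 1" unfolding val[OF assms(2)] using y by linarith
    moreover have "u (x ^ n * y) < 1" using val[OF u.abs_field_axioms] y 2 by simp
    moreover have "w (x ^ n * y) < 1" if "w \<in> A" for w using val n that insert.prems by auto
    ultimately show ?thesis using zK by blast
  next
    case 3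
    \<comment> \<open>The quotient \<open>1 / (1 + t n)\<close> tends to 1 where \<open>x\<close> is
      large, at \<open>v\<close> and \<open>u\<close>, and to 0 where \<open>x\<close> is small, at
      the members of \<open>A\<close>. Multiplied by \<open>y\<close> it has the required
      sizes.\<close>
    define t where "t n = inverse x ^ n" for n
    have iK: "inverse x \<in> K" using nf_inverse[OF K x(1)] .
    have tK: "t n \<in> K" for n unfolding t_def by (intro nf_power[OF K] iK)
    have val: "w (t n) = inverse (w x) ^ n" if "abs_field K w" for w n
      using abs_field.power[OF that iK] abs_field.inverse[OF that x(1)] unfolding t_def by simp
    have "(\<lambda>n. v (t n)) \<longlonglongrightarrow> 0" unfolding val[OF assms(2)]
      using x by (intro LIMSEQ_power_zero) (auto simp: inverse_less_1_iff abs_if)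
    then have ev: "\<forall>\<^sub>F n in sequentially. v (t n) < v y - 1" using y by (intro order_tendstoD(2)) auto
    have "(\<lambda>n. u (t n)) \<longlonglongrightarrow> 0" unfolding val[OF u.abs_field_axioms]
      using 3 by (intro LIMSEQ_power_zero) (auto simp: inverse_less_1_iff abs_if)
    then have eu: "\<forall>\<^sub>F n in sequentially. u (t n) < 1 - u y" using y by (intro order_tendstoD(2)) auto
    have ew: "\<forall>\<^sub>F n in sequentially. \<forall>w\<in>A. w (t n) > 1 + w y"
    proof (intro eventually_ball_finite ballI insert.hyps)
      fix w assume w: "w \<in> A"
      interpret w: abs_field K w using insert.prems w by blast
      have "inverse (w x) > 1" using x(3)[OF w] w.pos[OF x(1) x0] by (simp add: one_less_inverse_iff)
      then obtain n0 where n0: "1 + w y < inverse (w x) ^ n0" using real_arch_pow by blast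
      have "w (t n) > 1 + w y" if "n \<ge> n0" for n
        unfolding val[OF w.abs_field_axioms]
        using n0 power_increasing[OF that, of "inverse (w x)"] \<open>inverse (w x) > 1\<close> by linarith
      then show "\<forall>\<^sub>F n in sequentially. w (t n) > 1 + w y"
        unfolding eventually_sequentially by blast
    qed
    obtain n where n: "v (t n) < v y - 1" "u (t n) < 1 - u y" "\<And>w. w \<in> A \<Longrightarrow> w (t n) > 1 + w y"
      using eventually_happens'[OF _ eventually_conj[OF ev eventually_conj[OF eu ew]]] by auto
    define z where "z = y * inverse (1 + t n)"
    have tK1: "1 + t n \<in> K" using nf_add[OF K nf_one[OF K] tK] .
    have zK: "z \<in> K" unfolding z_def using y tK1 by (intro nf_mult[OF K] nf_inverse[OF K])
    have uy: "u y < u (1 + t n)" using u.diff_le[OF nf_one[OF K] tK, of n] u.one n by linarith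
    then have t0: "1 + t n \<noteq> 0" using u.nonneg[OF y(1)] u.zero by auto
    have vz: "w z = w y / w (1 + t n)" if "abs_field K w" for w
      using abs_field.mult[OF that y(1) nf_inverse[OF K tK1]] abs_field.inverse[OF that tK1]
      unfolding z_def by (simp add: divide_inverse)
    have "v (1 + t n) < v y" using v.triangle[OF nf_one[OF K] tK, of n] v.one n by linarith
    then have "v z > 1" using v.pos[OF tK1 t0] unfolding vz[OF assms(2)] by (simp add: less_divide_eq_1)
    moreover have "u z < 1" using uy u.pos[OF tK1 t0] unfolding vz[OF u.abs_field_axioms] by simp
    moreover have "w z < 1" if w: "w \<in> A" for w
    proof -
      interpret w: abs_field K w using insert.prems w by blast
      have "w y < w (t n + 1)" using w.diff_le[OF tK nf_one[OF K], of n] w.one n(3)[OF w] by linarith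
      then show ?thesis using w.pos[OF tK1 t0] unfolding vz[OF w.abs_field_axioms] by (simp add: add.commute)
    qed
    ultimately show ?thesis using zK by blast
  qed
qed

text \<open>A substitute for lying over one place of the rationals: the members need not agree on
  natural numbers, only rank them in a common order. All archimedean absolute values do so together,
  and so do all ultrametric ones with \<open>v p < 1\<close> for a given prime
  \<open>p\<close>.\<close>

definition comparable_on_nat :: "(complex \<Rightarrow> real) set \<Rightarrow> bool" where
  "comparable_on_nat A \<longleftrightarrow>
     (\<forall>m n :: nat. (\<forall>v\<in>A. v (of_nat m) \<le> v (of_nat n)) \<or> (\<forall>v\<in>A. v (of_nat n) \<le> v (of_nat m)))"

lemma (in abs_field) of_rat_le_iff:
  assumes "b > 0" "d > 0"
  shows "v (of_rat (of_int a / of_int b)) \<le> v (of_rat (of_int c / of_int d)) \<longleftrightarrow>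
    v (of_nat (nat (\<bar>a\<bar> * d))) \<le> v (of_nat (nat (\<bar>c\<bar> * b)))"
proof -
  note I = nf_of_int[OF K] nf_inverse[OF K]
  have ab: "v (of_int \<bar>k\<bar>) = v (of_int k)" for k using minus[OF I(1), of k] by (simp add: abs_if)
  have q: "v (of_rat (of_int k / of_int l)) = v (of_int k) / v (of_int l)" for k l
    using mult[OF I(1) I(2)[OF I(1)], of k l] inverse[OF I(1), of l]
    by (simp add: of_rat_divide) (simp add: divide_inverse)
  have p: "v (of_int b) > 0" "v (of_int d) > 0" using assms by (auto intro!: pos I)
  have n: "v (of_nat (nat (\<bar>k\<bar> * l))) = v (of_int k) * v (of_int l)" if "l > 0" for k l
  proof -
    have "(of_nat (nat (\<bar>k\<bar> * l)) :: complex) = of_int \<bar>k\<bar> * of_int l"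
      using that by (metis of_int_mult of_nat_nat zero_le_mult_iff abs_ge_zero less_imp_le)
    then show ?thesis using mult[OF I(1) I(1), of "\<bar>k\<bar>" l] ab by simp
  qed
  show ?thesis unfolding q n[OF assms(1)] n[OF assms(2)] using p by (simp add: field_simps)
qed

lemma comparable_on_rat:
  assumes A: "\<And>v. v \<in> A \<Longrightarrow> abs_field K v" and cmp: "comparable_on_nat A"
  shows "(\<forall>v\<in>A. v (of_rat p) \<le> v (of_rat q)) \<or> (\<forall>v\<in>A. v (of_rat q) \<le> v (of_rat p))"
proof -
  obtain a b c d where ab: "quotient_of p = (a, b)" and cd: "quotient_of q = (c, d)" by fastforce
  have p: "b > 0" "p = of_int a / of_int b" using quotient_of_denom_pos[OF ab] quotient_of_div[OF ab] by auto
  have q: "d > 0" "q = of_int c / of_int d" using quotient_of_denom_pos[OF cd] quotient_of_div[OF cd] by auto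
  have "v (of_rat p) \<le> v (of_rat q) \<longleftrightarrow> v (of_nat (nat (\<bar>a\<bar> * d))) \<le> v (of_nat (nat (\<bar>c\<bar> * b)))"
    "v (of_rat q) \<le> v (of_rat p) \<longleftrightarrow> v (of_nat (nat (\<bar>c\<bar> * b))) \<le> v (of_nat (nat (\<bar>a\<bar> * d)))"
    if "v \<in> A" for v
    unfolding p(2) q(2) using abs_field.of_rat_le_iff[OF A[OF that]] p q by blast+
  then show ?thesis using cmp unfolding comparable_on_nat_def by meson
qed

lemma comparable_max:
  fixes q :: "'b \<Rightarrow> rat"
  assumes A: "\<And>v. v \<in> A \<Longrightarrow> abs_field K v" and cmp: "comparable_on_nat A"
    and "finite I" "I \<noteq> {}"
  shows "\<exists>k\<in>I. \<forall>j\<in>I. \<forall>v\<in>A. v (of_rat (q j)) \<le> v (of_rat (q k))"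
  using assms(3,4)
proof (induction I rule: finite_ne_induct)
  case (insert i I)
  then obtain k where k: "k \<in> I" "\<And>j v. j \<in> I \<Longrightarrow> v \<in> A \<Longrightarrow> v (of_rat (q j)) \<le> v (of_rat (q k))" by blast
  consider "\<forall>v\<in>A. v (of_rat (q i)) \<le> v (of_rat (q k))" | "\<forall>v\<in>A. v (of_rat (q k)) \<le> v (of_rat (q i))"
    using comparable_on_rat[OF A cmp] by blast
  then show ?case
  proof cases
    case 1 then show ?thesis using k by (intro bexI[of _ k]) auto
  next
    case 2
    then show ?thesis using k by (intro bexI[of _ i]) (auto intro: order_trans)
  qed
qed auto

text \<open>Powers of the elements provided by the approximation lemma are linearly independent over the
  rationals: a relation would be dominated, at the place of the largest coefficient, by one term.\<close>

lemma card_places_le: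
  assumes K: "number_field K" and B: "finite B" "K \<subseteq> rat_vs.span B"
    and fin: "finite A"
    and A: "\<And>v. v \<in> A \<Longrightarrow> abs_field K v \<and> nontrivial_on K v"
    and inj: "inj_on (place_of K) A"
    and cmp: "comparable_on_nat A"
  shows "card A \<le> card B"
proof (cases "A = {}")
  case False
  have "\<forall>v\<in>A. \<exists>x. x \<in> K \<and> v x > 1 \<and> (\<forall>w\<in>A - {v}. w x < 1)"
  proof
    fix v assume v: "v \<in> A"
    have "\<exists>x\<in>K. v x > 1 \<and> (\<forall>w\<in>A - {v}. w x < 1)"
    proof (rule approximation)
      show "finite (A - {v})" using fin by simp
      show "abs_field K v" "nontrivial_on K v" using A v by auto
      show "abs_field K w \<and> nontrivial_on K w \<and> place_of K w \<noteq> place_of K v" if "w \<in> A - {v}" for w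
        using that A v inj unfolding inj_on_def by blast
    qed
    then show "\<exists>x. x \<in> K \<and> v x > 1 \<and> (\<forall>w\<in>A - {v}. w x < 1)" by blast
  qed
  from bchoice[OF this] obtain x where "\<forall>v\<in>A. x v \<in> K \<and> v (x v) > 1 \<and> (\<forall>w\<in>A - {v}. w (x v) < 1)"
    by blast
  then have x: "\<And>v. v \<in> A \<Longrightarrow> x v \<in> K" "\<And>v. v \<in> A \<Longrightarrow> v (x v) > 1"
    "\<And>v w. v \<in> A \<Longrightarrow> w \<in> A \<Longrightarrow> w \<noteq> v \<Longrightarrow> w (x v) < 1"
    by blast+
  \<comment> \<open>Each of the \<open>m - 1\<close> terms other than the dominant one will be less
    than \<open>1 / m\<close> of it, so their sum stays below it.\<close>
  define m where "m = real (card A)"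
  have m: "m \<ge> 1" using False fin by (simp add: m_def Suc_le_eq card_gt_0_iff)
  have "\<forall>\<^sub>F n in sequentially. \<forall>v\<in>A. \<forall>w\<in>A - {v}. w (x v) ^ n < 1 / m"
  proof (intro eventually_ball_finite fin ballI)
    fix v w assume vw: "v \<in> A" "w \<in> A - {v}"
    have "(\<lambda>n. w (x v) ^ n) \<longlonglongrightarrow> 0"
      using vw x abs_field.nonneg[of K w] A by (intro LIMSEQ_power_zero) auto
    then show "\<forall>\<^sub>F n in sequentially. w (x v) ^ n < 1 / m" by (rule order_tendstoD) (use m in simp)
  qed (use fin in auto)
  then obtain N where N: "\<And>v w. v \<in> A \<Longrightarrow> w \<in> A \<Longrightarrow> w \<noteq> v \<Longrightarrow> w (x v) ^ N < 1 / m"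
    unfolding eventually_sequentially by blast
  define X where "X v = x v ^ N" for v
  have XK: "X v \<in> K" if "v \<in> A" for v unfolding X_def using x that by (intro nf_power[OF K]) auto
  have X1: "v (X v) \<ge> 1" if "v \<in> A" for v
    unfolding X_def using abs_field.power[of K v, OF _ x(1)[OF that]] A[OF that] x(2)[OF that] by simp
  have X2: "w (X v) < 1 / m" if "v \<in> A" "w \<in> A" "w \<noteq> v" for v w
    unfolding X_def using abs_field.power[of K w, OF _ x(1)[OF that(1)]] A[OF that(2)] N[OF that] by simp
  have injX: "inj_on X A"
  proof (rule inj_onI, rule ccontr)
    fix v w assume vw: "v \<in> A" "w \<in> A" "X v = X w" "v \<noteq> w"
    have "w (X v) < 1 / m" using X2[OF vw(1,2)] vw(4) by blast
    also have "\<dots> \<le> 1" using m by simp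
    finally show False using X1[OF vw(2)] vw by simp
  qed
  have "rat_vs.independent (X ` A)"
  proof
    assume "rat_vs.dependent (X ` A)"
    then have "\<exists>u. (\<exists>z\<in>X ` A. u z \<noteq> 0) \<and> (\<Sum>z\<in>X ` A. of_rat (u z) * z) = 0"
      by (rule iffD1[OF rat_vs.dependent_finite[OF finite_imageI[OF fin]]])
    then obtain u where u: "\<exists>z\<in>X ` A. u z \<noteq> 0" "(\<Sum>z\<in>X ` A. of_rat (u z) * z) = 0"
      by (elim exE conjE)
    define q where "q v = u (X v)" for v
    have q: "\<exists>v\<in>A. q v \<noteq> 0" using u(1) unfolding q_def by blast
    have rel: "(\<Sum>v\<in>A. of_rat (q v) * X v) = 0"
      using u(2) unfolding sum.reindex[OF injX] by (simp add: q_def)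
    have A': "\<And>v. v \<in> A \<Longrightarrow> abs_field K v" using A by blast
    \<comment> \<open>The indices are themselves absolute values. By comparability one coefficient
      \<open>q k\<close> is largest for all members of \<open>A\<close>, in particular for
      \<open>k\<close> itself, at which \<open>X k\<close> is the only power not below
      \<open>1 / m\<close>.\<close>
    obtain k where k: "k \<in> A" "\<And>j v. j \<in> A \<Longrightarrow> v \<in> A \<Longrightarrow> v (of_rat (q j)) \<le> v (of_rat (q k))"
      using comparable_max[of A K A q, OF A' cmp fin False] by blast
    interpret k: abs_field K k using A k by blast
    have RK: "of_rat r \<in> K" for r :: rat using nf_of_rat[OF K] .
    have qk: "q k \<noteq> 0"
    proof
      assume 0: "q k = 0"
      obtain j where j: "j \<in> A" "q j \<noteq> 0" using q by blast
      have "k (of_rat (q j)) \<le> 0" using k(2)[OF j(1) k(1)] 0 k.zero by simp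
      then show False using k.pos[OF RK, of "q j"] j by simp
    qed
    have qpos: "k (of_rat (q k)) > 0" using qk by (intro k.pos RK) simp
    have "of_rat (q k) * X k = - (\<Sum>j\<in>A - {k}. of_rat (q j) * X j)"
      using rel sum.remove[OF fin k(1), of "\<lambda>v. of_rat (q v) * X v"] by (simp add: add_eq_0_iff)
    then have "k (of_rat (q k) * X k) = k (\<Sum>j\<in>A - {k}. of_rat (q j) * X j)"
      using k.minus[of "\<Sum>j\<in>A - {k}. of_rat (q j) * X j"] XK
      by (metis (no_types, lifting) DiffD1 RK nf_mult[OF K] nf_sum[OF K])
    also have "\<dots> \<le> (\<Sum>j\<in>A - {k}. k (of_rat (q j) * X j))"
      using fin XK by (intro k.sum_le nf_mult[OF K] RK) auto
    also have "\<dots> \<le> (\<Sum>j\<in>A - {k}. k (of_rat (q k)) * (1 / m))"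
    proof (intro sum_mono)
      fix j assume j: "j \<in> A - {k}"
      have "k (of_rat (q j) * X j) = k (of_rat (q j)) * k (X j)" using j XK by (intro k.mult RK) auto
      also have "\<dots> \<le> k (of_rat (q k)) * (1 / m)"
        using j k X2[of j k] XK k.nonneg RK by (intro mult_mono) auto
      finally show "k (of_rat (q j) * X j) \<le> k (of_rat (q k)) * (1 / m)" .
    qed
    also have "\<dots> = k (of_rat (q k)) * ((m - 1) / m)"
      using k(1) fin m by (simp add: m_def card_Diff_singleton of_nat_diff Suc_le_eq card_gt_0_iff)
    also have "\<dots> < k (of_rat (q k)) * 1" using qpos m by (intro mult_strict_left_mono) auto
    also have "\<dots> \<le> k (of_rat (q k)) * k (X k)" using X1[OF k(1)] qpos by (intro mult_left_mono) auto
    also have "\<dots> = k (of_rat (q k) * X k)" using k XK by (simp add: k.mult RK)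
    finally show False by simp
  qed
  moreover have "X ` A \<subseteq> rat_vs.span B" using XK B by blast
  ultimately have "card (X ` A) \<le> card B" using rat_vs.independent_span_bound[OF B(1)] by blast
  then show ?thesis by (simp add: card_image injX)
qed simp

text \<open>One representative with property \<open>R\<close> is chosen in each place;
  \<open>card_places_le\<close> then bounds all finite subfamilies by the same
  \<open>card B\<close>.\<close>

lemma finite_places:
  assumes K: "number_field K" and P: "P \<subseteq> places K"
    and R: "\<And>\<nu>. \<nu> \<in> P \<Longrightarrow> \<exists>v\<in>\<nu>. R v"
    and cmp: "comparable_on_nat {v. abs_field K v \<and> R v}"
  shows "finite P"
proof -
  obtain B where B: "finite B" "K \<subseteq> rat_vs.span B" using number_field_span[OF K] .
  obtain r where r: "\<And>\<nu>. \<nu> \<in> P \<Longrightarrow> r \<nu> \<in> \<nu> \<and> R (r \<nu>)" using R by metis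
  have "card F \<le> card B" if F: "finite F" "F \<subseteq> P" for F
  proof -
    have rep: "abs_field K (r \<nu>)" "nontrivial_on K (r \<nu>)" "\<nu> = place_of K (r \<nu>)" if "\<nu> \<in> F" for \<nu>
      using placesE[OF K, of \<nu> "r \<nu>"] that F P r by blast+
    have inj: "inj_on r F" using rep(3) by (metis inj_onI)
    have "card (r ` F) \<le> card B"
    proof (rule card_places_le[OF K B])
      show "inj_on (place_of K) (r ` F)" using rep(3) by (intro inj_onI) force
      show "comparable_on_nat (r ` F)"
      proof -
        have "r ` F \<subseteq> {v. abs_field K v \<and> R v}" using rep(1) r F by auto
        then show ?thesis using cmp unfolding comparable_on_nat_def by (meson subsetD)
      qed
    qed (use F rep in auto)
    then show ?thesis by (simp add: card_image inj)
  qed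
  then show ?thesis using finite_if_finite_subsets_card_bdd[of P "card B"] by simp
qed

section \<open>Finiteness of the relevant places\<close>

text \<open>Under \<open>k\<close>-th roots the factor \<open>C * (k + 1)\<close> tends to 1. In
  this way crude bounds for sums of about \<open>k\<close> terms yield sharp inequalities.\<close>

lemma le_of_powers_le:
  fixes a M C :: real
  assumes "0 \<le> a" "0 \<le> M" and le: "\<And>k. a ^ k \<le> C * real (Suc k) * M ^ k"
  shows "a \<le> M"
proof (rule ccontr)
  assume "\<not> a \<le> M"
  then have a: "a > M" "a > 0" using assms by auto
  have x: "norm (M / a) < 1" using a assms by simp
  have "(\<lambda>k. C * (real k * (M / a) ^ k + (M / a) ^ k)) \<longlonglongrightarrow> C * (0 + 0)"
    using powser_times_n_limit_0[OF x] x by (intro tendsto_intros LIMSEQ_power_zero) auto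
  then have "\<forall>\<^sub>F k in sequentially. C * (real k * (M / a) ^ k + (M / a) ^ k) < 1"
    by (intro order_tendstoD(2)) auto
  then obtain k where k: "C * (real k * (M / a) ^ k + (M / a) ^ k) < 1"
    by (auto simp: eventually_sequentially)
  have "C * (real k * (M / a) ^ k + (M / a) ^ k) = C * real (Suc k) * M ^ k / a ^ k"
    by (simp add: power_divide add_divide_distrib[symmetric] algebra_simps)
  then have "C * real (Suc k) * M ^ k < a ^ k" using k a by (simp add: divide_less_eq)
  then show False using le[of k] by simp
qed

context abs_field begin

text \<open>The binomial expansion of \<open>(x + y) ^ k\<close> has \<open>k + 1\<close> terms,
  each bounded by the \<open>k\<close>-th power of the maximum.\<close>

lemma ultrametric_if_bounded:
  assumes "\<And>n :: nat. v (of_nat n) \<le> 1"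
  shows "ultrametric_on K v"
  unfolding ultrametric_on_def
proof (intro ballI)
  fix x y assume x: "x \<in> K" and y: "y \<in> K"
  let ?M = "max (v x) (v y)"
  show "v (x + y) \<le> ?M"
  proof (rule le_of_powers_le[where C = 1])
    show "0 \<le> v (x + y)" "0 \<le> ?M" using x y nonneg by (auto intro: nf_add[OF K] simp: le_max_iff_disj)
    fix k
    have "v (x + y) ^ k = v ((x + y) ^ k)" using power[OF nf_add[OF K x y]] by simp
    also have "\<dots> \<le> (\<Sum>i\<le>k. v (of_nat (k choose i) * x ^ i * y ^ (k - i)))"
      unfolding binomial_ring using x y
      by (intro sum_le nf_mult[OF K] nf_power[OF K] nf_of_nat[OF K]) auto
    also have "\<dots> \<le> (\<Sum>i\<le>k. ?M ^ k)"
    proof (intro sum_mono)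
      fix i assume i: "i \<in> {..k}"
      have "v (of_nat (k choose i) * x ^ i * y ^ (k - i)) = v (of_nat (k choose i)) * v x ^ i * v y ^ (k - i)"
        using x y by (simp add: mult power nf_mult[OF K] nf_power[OF K] nf_of_nat[OF K])
      also have "\<dots> \<le> 1 * ?M ^ i * ?M ^ (k - i)"
        using nonneg[OF x] nonneg[OF y] nonneg[OF nf_of_nat[OF K]] assms
        by (intro mult_mono power_mono) auto
      also have "\<dots> = ?M ^ k" using i by (simp add: power_add[symmetric])
      finally show "v (of_nat (k choose i) * x ^ i * y ^ (k - i)) \<le> ?M ^ k" .
    qed
    finally show "v (x + y) ^ k \<le> 1 * real (Suc k) * ?M ^ k" by simp
  qed
qed

text \<open>This is the expansion of \<open>M\<close> in base \<open>n\<close>: \<open>k\<close>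
  digits of absolute value at most \<open>n\<close>, times powers of \<open>n\<close>.\<close>

lemma of_nat_le_base_power:
  assumes n: "n \<ge> 1"
  shows "M < n ^ k \<Longrightarrow> v (of_nat M) \<le> real k * real n * max 1 (v (of_nat n)) ^ k"
proof (induction k arbitrary: M)
  case 0
  then show ?case by (simp add: zero)
next
  case (Suc k)
  let ?X = "max 1 (v (of_nat n))"
  note N = nf_of_nat[OF K]
  have "M div n < n ^ k" using Suc.prems n by (intro less_mult_imp_div_less) (simp add: mult.commute)
  then have IH: "v (of_nat (M div n)) \<le> real k * real n * ?X ^ k" by (rule Suc.IH)
  have "v (of_nat M) = v (of_nat (M div n) * of_nat n + of_nat (M mod n))"
    by (metis div_mult_mod_eq of_nat_add of_nat_mult)
  also have "\<dots> \<le> v (of_nat (M div n)) * v (of_nat n) + v (of_nat (M mod n))"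
    using triangle[OF nf_mult[OF K N N] N] mult[OF N N] by simp
  also have "\<dots> \<le> (real k * real n * ?X ^ k) * ?X + real n * ?X ^ Suc k"
  proof (intro add_mono mult_mono)
    have "v (of_nat (M mod n)) \<le> real (M mod n)" by (rule of_nat_le)
    also have "\<dots> \<le> real n" using n by (simp add: less_imp_le)
    also have "\<dots> \<le> real n * ?X ^ Suc k" using mult_left_mono[OF one_le_power[of ?X "Suc k"], of "real n"] by simp
    finally show "v (of_nat (M mod n)) \<le> real n * ?X ^ Suc k" .
  qed (use IH nonneg[OF N] in auto)
  also have "\<dots> = real (Suc k) * real n * ?X ^ Suc k" by (simp add: algebra_simps)
  finally show ?case .
qed

lemma of_nat_le_max:
  assumes "m \<le> n" shows "v (of_nat m) \<le> max 1 (v (of_nat n))"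
proof (cases "m = n")
  case False
  then have mn: "m < n" "n \<ge> 1" using assms by auto
  show ?thesis
  proof (rule le_of_powers_le[where C = "real n"])
    fix k
    let ?X = "max 1 (v (of_nat n))"
    have "v (of_nat m) ^ k = v (of_nat (m ^ k))" using power[OF nf_of_nat[OF K]] by simp
    also have "\<dots> \<le> real (Suc k) * real n * ?X ^ k"
    proof (cases "k = 0")
      case True
      then show ?thesis using one mn by simp
    next
      case False
      then have "m ^ k < n ^ k" using mn by (simp add: power_strict_mono)
      then have "v (of_nat (m ^ k)) \<le> real k * real n * ?X ^ k" by (rule of_nat_le_base_power[OF mn(2)])
      also have "\<dots> \<le> real (Suc k) * real n * ?X ^ k" by (intro mult_right_mono) auto
      finally show ?thesis .
    qed
    finally show "v (of_nat m) ^ k \<le> real n * real (Suc k) * ?X ^ k" by (simp add: mult_ac)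
  qed (use nonneg[OF nf_of_nat[OF K]] in auto)
qed simp

text \<open>Some \<open>N\<close> has \<open>v N > 1\<close>, and comparing \<open>N\<close> with
  \<open>n ^ N\<close> forces \<open>v n > 1\<close> for all \<open>n \<ge> 2\<close>. The 1 in the
  maximum of \<open>of_nat_le_max\<close> can then be dropped.\<close>

lemma archimedean_mono:
  assumes "\<not> ultrametric_on K v" "m \<le> n"
  shows "v (of_nat m) \<le> v (of_nat n)"
proof -
  obtain N where N: "v (of_nat N) > 1" using ultrametric_if_bounded assms(1) by (meson not_le)
  consider "m = n" | "m = 0" | "n \<ge> 2" using assms(2) by linarith
  then show ?thesis
  proof cases
    case 2 then show ?thesis using nonneg[OF nf_of_nat[OF K]] zero by simp
  next
    case 3
    have "N \<le> n ^ N" using 3 less_exp[of N] power_mono[of 2 n N] by linarith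
    then have "v (of_nat N) \<le> max 1 (v (of_nat n) ^ N)"
      using of_nat_le_max[of N "n ^ N"] power[OF nf_of_nat[OF K], of n N] by simp
    then have "v (of_nat n) ^ N > 1" using N by linarith
    then have "v (of_nat n) > 1"
      using power_le_one[OF nonneg[OF nf_of_nat[OF K]], of n N] by (meson not_le)
    then show ?thesis using of_nat_le_max[OF assms(2)] by simp
  qed simp
qed

lemma ultrametric_of_nat:
  assumes "ultrametric_on K v" shows "v (of_nat n) \<le> 1"
proof (induction n)
  case (Suc n)
  have "v (of_nat n + 1) \<le> max (v (of_nat n)) (v 1)"
    using assms nf_of_nat[OF K] nf_one[OF K] unfolding ultrametric_on_def by blast
  then show ?case using Suc one by (simp add: add.commute)
qed (simp add: zero)

lemma ultrametric_of_int:
  assumes "ultrametric_on K v" shows "v (of_int n) \<le> 1"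
  using ultrametric_of_nat[OF assms, of "nat \<bar>n\<bar>"] minus[OF nf_of_int[OF K], of n]
  by (cases "n \<ge> 0") (auto simp: )

lemma ultrametric_sum:
  assumes u: "ultrametric_on K v" and "finite I" "\<And>i. i \<in> I \<Longrightarrow> g i \<in> K" "\<And>i. i \<in> I \<Longrightarrow> v (g i) \<le> b" "b \<ge> 0"
  shows "v (sum g I) \<le> b"
  using assms(2-4)
proof (induction I rule: finite_induct)
  case (insert i I)
  have "v (g i + sum g I) \<le> max (v (g i)) (v (sum g I))"
    using u insert.prems nf_sum[OF K, of I g] unfolding ultrametric_on_def by blast
  also have "\<dots> \<le> b" using insert by auto
  finally show ?case using insert by simp
qed (simp add: zero assms)

text \<open>The cofactor \<open>y\<close> of the \<open>p\<close>-power in \<open>m\<close> has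
  absolute value 1: by Bezout, 1 is an integral combination of \<open>p\<close> and
  \<open>y\<close>, which cannot both be small.\<close>

lemma ultrametric_prime_power:
  assumes u: "ultrametric_on K v" and p: "prime p" "v (of_nat p) < 1" and m: "m \<noteq> 0"
  shows "v (of_nat m) = v (of_nat p) ^ multiplicity p m"
proof -
  note N = nf_of_nat[OF K] and Z = nf_of_int[OF K]
  obtain y where y: "m = p ^ multiplicity p m * y" "\<not> p dvd y"
    using multiplicity_decompose'[OF m, of p] prime_gt_1_nat[OF p(1)] by auto
  have "coprime p y" using p(1) y(2) by (simp add: prime_imp_coprime)
  then obtain a b where "a * int p + b * int y = 1"
    using bezout_int[of "int p" "int y"] by (metis coprime_imp_gcd_eq_1 coprime_int_iff)
  then have "(1::complex) = of_int a * of_nat p + of_int b * of_nat y"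
    by (metis of_int_1 of_int_add of_int_mult of_int_of_nat_eq)
  then have "v 1 \<le> max (v (of_int a * of_nat p)) (v (of_int b * of_nat y))"
    using u nf_mult[OF K Z N] unfolding ultrametric_on_def by metis
  moreover have "v (of_int a * of_nat p) < 1"
  proof -
    have "v (of_int a * of_nat p) = v (of_int a) * v (of_nat p)" using mult Z N by blast
    also have "\<dots> \<le> 1 * v (of_nat p)" using ultrametric_of_int[OF u] nonneg[OF N] by (intro mult_right_mono)
    finally show ?thesis using p by simp
  qed
  ultimately have "1 \<le> v (of_int b * of_nat y)" using one by simp
  also have "\<dots> = v (of_int b) * v (of_nat y)" using mult Z N by blast
  also have "\<dots> \<le> 1 * v (of_nat y)" using ultrametric_of_int[OF u] nonneg[OF N] by (intro mult_right_mono)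
  finally have vy: "v (of_nat y) = 1" using ultrametric_of_nat[OF u, of y] by simp
  have "v (of_nat m) = v (of_nat p ^ multiplicity p m * of_nat y)" by (metis y(1) of_nat_mult of_nat_power)
  also have "\<dots> = v (of_nat p) ^ multiplicity p m" using mult[OF nf_power[OF K N] N] power[OF N] vy by simp
  finally show ?thesis .
qed

lemma exists_prime_less_1:
  "n > 0 \<Longrightarrow> v (of_nat n) < 1 \<Longrightarrow> \<exists>p. prime p \<and> p dvd n \<and> v (of_nat p) < 1"
proof (induction n rule: less_induct)
  case (less n)
  note N = nf_of_nat[OF K]
  have "n \<noteq> 1" using less.prems one by auto
  then obtain p where p: "prime p" "p dvd n" using prime_factor_nat by blast
  then obtain q where q: "n = p * q" by blast
  show ?case
  proof (cases "v (of_nat p) < 1")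
    case False
    have "v (of_nat n) = v (of_nat p) * v (of_nat q)" using mult[OF N N, of p q] q by simp
    moreover have "1 * v (of_nat q) \<le> v (of_nat p) * v (of_nat q)"
      using False nonneg[OF N] by (intro mult_right_mono) auto
    ultimately have "v (of_nat q) < 1" using less.prems by simp
    moreover have "q > 0" "q < n" using q less.prems prime_gt_1_nat[OF p(1)] by (auto intro: Nat.gr0I)
    ultimately obtain p' where "prime p'" "p' dvd q" "v (of_nat p') < 1" using less.IH by blast
    then show ?thesis using q by auto
  qed (use p in blast)
qed

end

lemma comparable_archimedean: "comparable_on_nat {v. abs_field K v \<and> \<not> ultrametric_on K v}"
  unfolding comparable_on_nat_def using abs_field.archimedean_mono
  by (metis (mono_tags, lifting) mem_Collect_eq nat_le_linear)

lemma comparable_p_adic: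
  assumes p: "prime p"
  shows "comparable_on_nat {v. abs_field K v \<and> (ultrametric_on K v \<and> v (of_nat p) < 1)}" (is "comparable_on_nat ?A")
proof -
  have le: "v (of_nat m) \<le> v (of_nat n)"
    if v: "v \<in> ?A" and mn: "m = 0 \<or> n \<noteq> 0 \<and> multiplicity p n \<le> multiplicity p m" for v m n
  proof -
    interpret abs_field K v using v by blast
    show ?thesis
    proof (cases "m = 0")
      case True then show ?thesis using nonneg[OF nf_of_nat[OF K]] zero by simp
    next
      case False
      then show ?thesis using v mn ultrametric_prime_power[OF _ p] nonneg[OF nf_of_nat[OF K]]
        by (auto intro!: power_decreasing)
    qed
  qed
  show ?thesis unfolding comparable_on_nat_def
  proof (intro allI)
    fix m n :: nat
    consider "m = 0 \<or> n \<noteq> 0 \<and> multiplicity p n \<le> multiplicity p m"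
      | "n = 0 \<or> m \<noteq> 0 \<and> multiplicity p m \<le> multiplicity p n" by linarith
    then show "(\<forall>v\<in>?A. v (of_nat m) \<le> v (of_nat n)) \<or> (\<forall>v\<in>?A. v (of_nat n) \<le> v (of_nat m))"
      by cases (use le in blast)+
  qed
qed

lemma finite_archimedean_places:
  assumes "number_field K" shows "finite (archimedean_places K)"
  by (rule finite_places[OF assms, where R = "\<lambda>v. \<not> ultrametric_on K v"])
    (auto simp: archimedean_places_def comparable_archimedean)

text \<open>If \<open>v x > 1\<close> at a nonarchimedean place, the remaining terms of an integral
  relation can balance the top one only when \<open>v (a n) < 1\<close>. Then some prime divisor
  \<open>p\<close> of \<open>a n\<close> has \<open>v p < 1\<close>, and for each prime there are
  finitely many such places.\<close>

lemma finite_not_in_valuation_ring: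
  assumes K: "number_field K" and x: "x \<in> K"
  shows "finite {\<nu> \<in> places K - archimedean_places K. x \<notin> valuation_ring K \<nu>}" (is "finite ?P")
proof (cases "x = 0")
  case True
  have "?P = {}"
    using placesE(1)[OF K] abs_field.zero x unfolding True valuation_ring_def by force
  then show ?thesis by (metis finite.emptyI)
next
  case False
  obtain a :: "nat \<Rightarrow> int" and n where a: "a 0 \<noteq> 0" "a n \<noteq> 0" "(\<Sum>i\<le>n. of_int (a i) * x ^ i) = 0"
    using nf_integral_relation[OF K x False] by blast
  define N where "N = nat \<bar>a n\<bar>"
  have N: "N > 0" using a by (simp add: N_def)
  define Q where "Q p = {\<nu> \<in> places K. \<exists>v\<in>\<nu>. ultrametric_on K v \<and> v (of_nat p) < 1}" for p
  have finQ: "finite (Q p)" if "prime p" for p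
    by (rule finite_places[OF K, where R = "\<lambda>v. ultrametric_on K v \<and> v (of_nat p) < 1"])
      (use comparable_p_adic[OF that] in \<open>auto simp: Q_def\<close>)
  have "?P \<subseteq> (\<Union>p\<in>{p. prime p \<and> p dvd N}. Q p)"
  proof
    fix \<nu> assume "\<nu> \<in> ?P"
    then have nu: "\<nu> \<in> places K" "\<nu> \<notin> archimedean_places K" "x \<notin> valuation_ring K \<nu>" by auto
    obtain v where v: "v \<in> \<nu>" "v x > 1" using nu(3) x unfolding valuation_ring_def by force
    interpret abs_field K v using placesE(1)[OF K nu(1) v(1)] .
    have u: "ultrametric_on K v" using nu v unfolding archimedean_places_def by blast
    have n0: "n \<noteq> 0" using a by (cases n) auto
    then obtain m where m: "n = Suc m" using not0_implies_Suc by blast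
    have S: "of_int (a i) * x ^ i \<in> K" for i using x by (intro nf_mult[OF K] nf_of_int[OF K] nf_power[OF K])
    have vS: "v (of_int (a i) * x ^ i) = v (of_int (a i)) * v x ^ i" for i
      using mult[OF nf_of_int[OF K] nf_power[OF K x]] power[OF x] by simp
    have "of_int (a n) * x ^ n = - (\<Sum>i\<le>m. of_int (a i) * x ^ i)" using a(3) unfolding m by (simp add: add_eq_0_iff)
    then have "v (of_int (a n) * x ^ n) = v (\<Sum>i\<le>m. of_int (a i) * x ^ i)"
      using minus nf_sum[OF K, of "{..m}" "\<lambda>i. of_int (a i) * x ^ i"] S by metis
    also have "\<dots> \<le> v x ^ m"
    proof (rule ultrametric_sum[OF u])
      fix i assume i: "i \<in> {..m}"
      have "v (of_int (a i)) * v x ^ i \<le> 1 * v x ^ m"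
        using i v ultrametric_of_int[OF u] nonneg[OF nf_of_int[OF K]]
        by (intro mult_mono power_increasing) auto
      then show "v (of_int (a i) * x ^ i) \<le> v x ^ m" unfolding vS by simp
    qed (use S v in auto)
    finally have "v (of_int (a n)) * v x \<le> 1" unfolding vS m using v by (simp add: field_simps)
    moreover have "v (of_int (a n)) > 0" using a by (intro pos nf_of_int[OF K]) simp
    ultimately have "v (of_int (a n)) < 1" using v(2) mult_less_cancel_left_pos[of "v (of_int (a n))" 1 "v x"] by linarith
    moreover have "v (of_nat N) = v (of_int (a n))"
      unfolding N_def using minus[OF nf_of_int[OF K], of "a n"] by (cases "a n \<ge> 0") auto
    ultimately obtain p where "prime p" "p dvd N" "v (of_nat p) < 1"
      using exists_prime_less_1[OF N] by auto
    then show "\<nu> \<in> (\<Union>p\<in>{p. prime p \<and> p dvd N}. Q p)" unfolding Q_def using nu v u by blast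
  qed
  moreover have "finite (\<Union>p\<in>{p. prime p \<and> p dvd N}. Q p)"
    using finQ N by (intro finite_UN_I finite_subset[of "{p. prime p \<and> p dvd N}" "{..N}"]) (auto dest: dvd_imp_le)
  ultimately show ?thesis by (rule finite_subset)
qed

section \<open>Rings of S-integers\<close>

definition S_integers :: "complex set \<Rightarrow> (complex \<Rightarrow> real) set set \<Rightarrow> complex set" where
  "S_integers K S = {x \<in> K. \<forall>\<nu>\<in>places K - S. x \<in> valuation_ring K \<nu>}"

text \<open>Two powers of 2 have the same residue by the pigeonhole principle, and the smaller one
  can be cancelled because it is coprime to \<open>t\<close>.\<close>

lemma power_2_congruent_1:
  assumes "odd t" shows "\<exists>k>0. int t dvd 2 ^ k - 1"
proof -
  have "t > 0" using assms by (intro Nat.gr0I) auto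
  then have "range (\<lambda>i :: nat. 2 ^ i mod t) \<subseteq> {..<t}" by auto
  then have "finite (range (\<lambda>i :: nat. 2 ^ i mod t))" by (rule finite_subset) simp
  then have "\<not> inj (\<lambda>i :: nat. 2 ^ i mod t)" using range_inj_infinite by blast
  then have "\<exists>i j. 2 ^ i mod t = 2 ^ j mod t \<and> i \<noteq> j" unfolding inj_on_def by blast
  then obtain i j where ij: "2 ^ i mod t = 2 ^ j mod t" "i < j" by (metis linorder_neqE_nat)
  have "int (2 ^ j) mod int t = int (2 ^ i) mod int t" using ij(1) by (metis zmod_int)
  then have "int t dvd int (2 ^ j) - int (2 ^ i)" by (simp only: mod_eq_dvd_iff)
  moreover have "int (2 ^ j) - int (2 ^ i) = 2 ^ i * (2 ^ (j - i) - 1)"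
    using ij(2) by (simp add: algebra_simps flip: power_add)
  ultimately have "int t dvd 2 ^ i * (2 ^ (j - i) - 1)" by simp
  moreover have "coprime (int t) (2 ^ i)" using assms by simp
  ultimately have "int t dvd 2 ^ (j - i) - 1" by (simp add: coprime_dvd_mult_right_iff)
  then show ?thesis using ij(2) by (intro exI[of _ "j - i"]) simp
qed

locale S_arith =
  fixes K :: "complex set" and S :: "(complex \<Rightarrow> real) set set"
  assumes K: "number_field K" and arch: "archimedean_places K \<subseteq> S"
begin

abbreviation "O\<^sub>S \<equiv> S_integers K S"

lemma ultrametric:
  assumes "\<nu> \<in> places K - S" "v \<in> \<nu>"
  shows "abs_field K v" "ultrametric_on K v"
  using assms arch placesE(1)[OF K] unfolding archimedean_places_def by blast+

lemma memI: "x \<in> K \<Longrightarrow> (\<And>\<nu> v. \<nu> \<in> places K - S \<Longrightarrow> v \<in> \<nu> \<Longrightarrow> v x \<le> 1) \<Longrightarrow> x \<in> O\<^sub>S"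
  unfolding S_integers_def valuation_ring_def by blast

lemma memD: "x \<in> O\<^sub>S \<Longrightarrow> \<nu> \<in> places K - S \<Longrightarrow> v \<in> \<nu> \<Longrightarrow> v x \<le> 1"
  and in_field: "x \<in> O\<^sub>S \<Longrightarrow> x \<in> K"
  unfolding S_integers_def valuation_ring_def by blast+

lemma add: assumes "x \<in> O\<^sub>S" "y \<in> O\<^sub>S" shows "x + y \<in> O\<^sub>S"
proof (rule memI)
  show "x + y \<in> K" using assms in_field nf_add[OF K] by blast
  fix \<nu> v assume "\<nu> \<in> places K - S" "v \<in> \<nu>"
  then have "v (x + y) \<le> max (v x) (v y)" "v x \<le> 1" "v y \<le> 1"
    using ultrametric(2)[of \<nu> v] memD[of _ \<nu> v] in_field assms unfolding ultrametric_on_def by blast+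
  then show "v (x + y) \<le> 1" by linarith
qed

lemma mult: assumes "x \<in> O\<^sub>S" "y \<in> O\<^sub>S" shows "x * y \<in> O\<^sub>S"
proof (rule memI)
  show "x * y \<in> K" using assms in_field nf_mult[OF K] by blast
  fix \<nu> v assume nu: "\<nu> \<in> places K - S" "v \<in> \<nu>"
  interpret abs_field K v by (rule ultrametric[OF nu])
  show "v (x * y) \<le> 1"
    using assms memD[OF _ nu] in_field mult nonneg by (simp add: mult_le_one)
qed

lemma minus: assumes "x \<in> O\<^sub>S" shows "- x \<in> O\<^sub>S"
proof (rule memI)
  show "- x \<in> K" using assms in_field nf_minus[OF K] by blast
  fix \<nu> v assume nu: "\<nu> \<in> places K - S" "v \<in> \<nu>"
  interpret abs_field K v by (rule ultrametric[OF nu])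
  show "v (- x) \<le> 1" using assms memD[OF _ nu] in_field minus by simp
qed

lemma of_int: "of_int n \<in> O\<^sub>S"
proof (rule memI)
  fix \<nu> v assume nu: "\<nu> \<in> places K - S" "v \<in> \<nu>"
  show "v (of_int n) \<le> 1" by (rule abs_field.ultrametric_of_int[OF ultrametric[OF nu]])
qed (rule nf_of_int[OF K])

lemma zero: "0 \<in> O\<^sub>S" and one: "1 \<in> O\<^sub>S" and numeral: "numeral k \<in> O\<^sub>S"
  using of_int[of 0] of_int[of 1] of_int[of "numeral k"] by simp_all

lemma diff: "x \<in> O\<^sub>S \<Longrightarrow> y \<in> O\<^sub>S \<Longrightarrow> x - y \<in> O\<^sub>S"
  using add[of x "- y"] minus by simp

lemma power: "x \<in> O\<^sub>S \<Longrightarrow> x ^ n \<in> O\<^sub>S"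
  by (induction n) (auto intro: one mult)

lemma sum: "(\<And>i. i \<in> I \<Longrightarrow> g i \<in> O\<^sub>S) \<Longrightarrow> sum g I \<in> O\<^sub>S"
  by (induction I rule: infinite_finite_induct) (auto intro: zero add)

lemma unit_value:
  assumes "x \<in> O\<^sub>S" "inverse x \<in> O\<^sub>S" "x \<noteq> 0" "\<nu> \<in> places K - S" "v \<in> \<nu>"
  shows "v x = 1"
proof -
  interpret abs_field K v by (rule ultrametric[OF assms(4,5)])
  have "v x \<le> 1" "inverse (v x) \<le> 1"
    using memD[OF _ assms(4,5)] assms inverse in_field by metis+
  then show ?thesis using pos[OF in_field[OF assms(1)] assms(3)]
    by (smt (verit) inverse_le_1_iff)
qed

text \<open>The constant term of an integral relation for \<open>b\<close> is a nonzero integer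
  divisible by \<open>b\<close>. As 2 is a unit, only its odd part matters, and some power of 2 is
  congruent to 1 modulo that.\<close>

lemma two_power_congruent_1:
  assumes half: "inverse 2 \<in> O\<^sub>S" and b: "b \<in> O\<^sub>S" "b \<noteq> 0"
  shows "\<exists>k>0. (2 ^ k - 1) / b \<in> O\<^sub>S"
proof -
  obtain a :: "nat \<Rightarrow> int" and n where a: "a 0 \<noteq> 0" "a n \<noteq> 0" "(\<Sum>i\<le>n. of_int (a i) * b ^ i) = 0"
    using nf_integral_relation[OF K in_field[OF b(1)] b(2)] by blast
  have "n \<noteq> 0" using a by (cases n) auto
  then obtain m where m: "n = Suc m" using not0_implies_Suc by blast
  define y where "y = (\<Sum>i\<le>m. of_int (a (Suc i)) * b ^ i)"
  have y: "y \<in> O\<^sub>S" unfolding y_def by (intro sum mult of_int power b)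
  have "of_int (a 0) + b * y = 0" using a(3) unfolding m y_def sum.atMost_Suc_shift sum_distrib_left
    by (simp add: ac_simps)
  then have a0: "of_int (a 0) / b = - y" using b by (simp add: field_simps add_eq_0_iff)
  define N where "N = nat \<bar>a 0\<bar>"
  have N: "N \<noteq> 0" using a by (simp add: N_def)
  obtain t where t: "N = 2 ^ multiplicity 2 N * t" "\<not> 2 dvd t"
    using multiplicity_decompose'[OF N, of 2] by auto
  define r where "r = multiplicity 2 N"
  have "complex_of_nat N = 2 ^ r * of_nat t"
    unfolding r_def by (metis t(1) of_nat_mult of_nat_numeral of_nat_power)
  then have tN: "of_int (int t) = of_int (int N) * inverse (2 :: complex) ^ r"
    by (simp add: field_simps)
  obtain k q where k: "k > 0" and q: "2 ^ k - 1 = int t * q"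
    using power_2_congruent_1[of t] t(2) by (auto elim!: dvdE)
  have aN: "\<exists>e::int. int N = e * a 0" unfolding N_def by (cases "a 0 \<ge> 0") (auto intro: exI[of _ 1] exI[of _ "- 1"])
  then obtain e where e: "int N = e * a 0" by blast
  have "(2 ^ k - 1 :: complex) = of_int (int t * q)" unfolding q[symmetric] by simp
  also have "\<dots> = of_int (int N) * inverse 2 ^ r * of_int q"
    using tN by (simp add: field_simps)
  also have "\<dots> = of_int e * of_int (a 0) * inverse 2 ^ r * of_int q" by (simp only: e of_int_mult)
  finally have "(2 ^ k - 1) / b = of_int e * (of_int (a 0) / b) * inverse 2 ^ r * of_int q" by simp
  also have "\<dots> \<in> O\<^sub>S" unfolding a0 by (intro mult of_int minus y power half)
  finally show ?thesis using k by blast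
qed

end

lemma exists_places_integral:
  assumes K: "number_field K" and A: "finite A" "A \<subseteq> K"
  shows "\<exists>S. finite S \<and> archimedean_places K \<subseteq> S \<and> S \<subseteq> places K \<and> A \<subseteq> S_integers K S"
proof -
  define S where "S = archimedean_places K
    \<union> (\<Union>x\<in>A. {\<nu> \<in> places K - archimedean_places K. x \<notin> valuation_ring K \<nu>})"
  have "finite S" unfolding S_def
    using A finite_archimedean_places[OF K] finite_not_in_valuation_ring[OF K] by blast
  moreover have "S \<subseteq> places K" unfolding S_def archimedean_places_def by blast
  moreover have "A \<subseteq> S_integers K S" unfolding S_def S_integers_def using A by blast
  ultimately show ?thesis unfolding S_def by blast
qed

section \<open>Polynomial functions and the polar form of a cubic\<close>

definition monomial_at :: "('n::finite \<Rightarrow>\<^sub>0 nat) \<Rightarrow> complex ^ 'n \<Rightarrow> complex" where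
  "monomial_at m x = (\<Prod>i\<in>UNIV. (x $ i) ^ Poly_Mapping.lookup m i)"

lemma peval_superset:
  assumes "finite A" "Poly_Mapping.keys p \<subseteq> A"
  shows "peval p x = (\<Sum>m\<in>A. Poly_Mapping.lookup p m * monomial_at m x)"
  unfolding peval_def monomial_at_def
  by (rule sum.mono_neutral_left) (use assms in \<open>auto simp: in_keys_iff\<close>)

lemma peval_keys: "peval p x = (\<Sum>m\<in>Poly_Mapping.keys p. Poly_Mapping.lookup p m * monomial_at m x)"
  by (rule peval_superset) auto

lemma peval_0 [simp]: "peval 0 x = 0"
  by (simp add: peval_def)

lemma peval_add: "peval (p + q) x = peval p x + peval q x"
proof -
  let ?A = "Poly_Mapping.keys p \<union> Poly_Mapping.keys q"
  have "peval (p + q) x = (\<Sum>m\<in>?A. Poly_Mapping.lookup (p + q) m * monomial_at m x)"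
    by (rule peval_superset) (auto simp: Poly_Mapping.keys_add)
  also have "\<dots> = peval p x + peval q x"
    using peval_superset[of ?A p x] peval_superset[of ?A q x]
    by (simp add: lookup_add algebra_simps sum.distrib)
  finally show ?thesis .
qed

lemma peval_sum: "peval (sum g A) x = (\<Sum>a\<in>A. peval (g a) x)"
  by (induction A rule: infinite_finite_induct) (auto simp: peval_add)

lemma peval_single: "peval (Poly_Mapping.single m c) x = c * monomial_at m x"
  by (subst peval_superset[of "{m}"]) (auto simp: lookup_single)

lemma monomial_at_add: "monomial_at (m + n) x = monomial_at m x * monomial_at n x"
  by (simp add: monomial_at_def lookup_add power_add prod.distrib)

lemma monomial_at_single: "monomial_at (Poly_Mapping.single i 1) x = x $ i"
proof -
  have "monomial_at (Poly_Mapping.single i 1) x = (\<Prod>j\<in>UNIV. if j = i then x $ i else 1)"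
    unfolding monomial_at_def by (intro prod.cong) (auto simp: lookup_single when_def)
  then show ?thesis by simp
qed

lemma mpoly_as_sum: "p = (\<Sum>m\<in>Poly_Mapping.keys p. Poly_Mapping.single m (Poly_Mapping.lookup p m))"
proof (rule poly_mapping_eqI)
  fix k
  have "(\<Sum>m\<in>Poly_Mapping.keys p. Poly_Mapping.lookup (Poly_Mapping.single m (Poly_Mapping.lookup p m)) k)
      = (\<Sum>m\<in>Poly_Mapping.keys p. if m = k then Poly_Mapping.lookup p k else 0)"
    by (intro sum.cong) (auto simp: lookup_single when_def)
  also have "\<dots> = Poly_Mapping.lookup p k" by (simp add: in_keys_iff)
  finally show "Poly_Mapping.lookup p k
    = Poly_Mapping.lookup (\<Sum>m\<in>Poly_Mapping.keys p. Poly_Mapping.single m (Poly_Mapping.lookup p m)) k"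
    by (simp add: lookup_sum)
qed

lemma mpoly_mult_as_sum:
  "p * q = (\<Sum>m\<in>Poly_Mapping.keys p. \<Sum>n\<in>Poly_Mapping.keys q.
     Poly_Mapping.single (m + n) (Poly_Mapping.lookup p m * Poly_Mapping.lookup q n))"
  by (subst mpoly_as_sum[of p], subst mpoly_as_sum[of q])
    (simp add: sum_product Poly_Mapping.mult_single)

lemma peval_mult: "peval (p * q) x = peval p x * peval q x"
  unfolding mpoly_mult_as_sum[of p q] peval_sum peval_single monomial_at_add
    peval_keys[of p] peval_keys[of q] sum_product
  by (intro sum.cong) (auto simp: mult_ac)

lemma homogeneous_mult:
  assumes "homogeneous d p" "homogeneous e q" shows "homogeneous (d + e) (p * q)"
  unfolding homogeneous_def
proof
  fix k assume "k \<in> Poly_Mapping.keys (p * q)"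
  then obtain m n where "m \<in> Poly_Mapping.keys p" "n \<in> Poly_Mapping.keys q" "k = m + n"
    using keys_mult[of p q] by blast
  then show "(\<Sum>i\<in>UNIV. Poly_Mapping.lookup k i) = d + e"
    using assms unfolding homogeneous_def by (auto simp: lookup_add sum.distrib)
qed

lemma coeffs_in_mult:
  assumes A: "0 \<in> A" "\<And>x y. x \<in> A \<Longrightarrow> y \<in> A \<Longrightarrow> x + y \<in> A" "\<And>x y. x \<in> A \<Longrightarrow> y \<in> A \<Longrightarrow> x * y \<in> A"
    and pq: "coeffs_in A p" "coeffs_in A q"
  shows "coeffs_in A (p * q)"
proof -
  have sm: "sum g I \<in> A" if "\<And>i. i \<in> I \<Longrightarrow> g i \<in> A" for g :: "_ \<Rightarrow> complex" and I :: "('a \<Rightarrow>\<^sub>0 nat) set"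
    using that by (induction I rule: infinite_finite_induct) (auto intro: A)
  show ?thesis using pq A unfolding coeffs_in_def mpoly_mult_as_sum[of p q]
    by (auto simp: lookup_sum lookup_single when_def intro!: sm)
qed

lemma peval_scale:
  assumes "homogeneous d p" shows "peval p (c *s x) = c ^ d * peval p x"
proof -
  have "monomial_at m (c *s x) = c ^ d * monomial_at m x" if "m \<in> Poly_Mapping.keys p" for m
    using assms that unfolding homogeneous_def monomial_at_def
    by (auto simp: power_mult_distrib prod.distrib power_sum)
  then show ?thesis unfolding peval_keys by (simp add: sum_distrib_left mult_ac)
qed

lemma peval_on_line: "\<exists>q. \<forall>t. peval p (u + t *s w) = poly q t"
proof (intro exI allI)
  fix t
  show "peval p (u + t *s w) = poly (\<Sum>m\<in>Poly_Mapping.keys p.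
    smult (Poly_Mapping.lookup p m) (\<Prod>i\<in>UNIV. [:u $ i, w $ i:] ^ Poly_Mapping.lookup m i)) t"
    by (simp add: peval_keys monomial_at_def poly_sum poly_prod)
qed

lemma peval_eq_0_on_line:
  assumes "infinite T" "\<And>t. t \<in> T \<Longrightarrow> peval p (u + t *s w) = 0"
  shows "peval p (u + t *s w) = 0"
proof -
  obtain q where q: "\<And>t. peval p (u + t *s w) = poly q t" using peval_on_line by blast
  have "q = 0"
  proof (rule ccontr)
    assume "q \<noteq> 0"
    then have "finite {t. poly q t = 0}" by (rule poly_roots_finite)
    moreover have "T \<subseteq> {t. poly q t = 0}" using assms(2) q by auto
    ultimately show False using assms(1) finite_subset by blast
  qed
  then show ?thesis using q by simp
qed

definition symmetric_trilinear :: "(complex ^ 'n \<Rightarrow> complex ^ 'n \<Rightarrow> complex ^ 'n \<Rightarrow> complex) \<Rightarrow> bool" where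
  "symmetric_trilinear T \<longleftrightarrow>
     (\<forall>u v w. T u v w = T v u w \<and> T u v w = T u w v) \<and>
     (\<forall>a u u' v w. T (a *s u + u') v w = a * T u v w + T u' v w)"

definition vec_over :: "complex set \<Rightarrow> complex ^ 'n \<Rightarrow> bool" where
  "vec_over K x \<longleftrightarrow> (\<forall>i. x $ i \<in> K)"

lemma monomial_at_split:
  assumes "(\<Sum>i\<in>UNIV. Poly_Mapping.lookup m i) = Suc d"
  shows "\<exists>i m'. (\<Sum>i\<in>UNIV. Poly_Mapping.lookup m' i) = d \<and> (\<forall>x. monomial_at m x = x $ i * monomial_at m' x)
    \<and> m = m' + Poly_Mapping.single i 1"
proof -
  obtain i where i: "Poly_Mapping.lookup m i > 0"
    using assms by (metis Zero_not_Suc gr0I sum.neutral)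
  define m' where "m' = m - Poly_Mapping.single i 1"
  have m: "m = m' + Poly_Mapping.single i 1"
    using i by (intro poly_mapping_eqI) (auto simp: m'_def lookup_add lookup_minus lookup_single when_def)
  have "(\<Sum>j\<in>UNIV. Poly_Mapping.lookup (Poly_Mapping.single i (1::nat)) j) = 1"
    by (simp add: lookup_single when_def)
  then have "(\<Sum>i\<in>UNIV. Poly_Mapping.lookup m' i) = d"
    using assms unfolding m by (simp add: lookup_add sum.distrib)
  then show ?thesis using m monomial_at_add[of m' "Poly_Mapping.single i 1"] monomial_at_single[of i]
    by (metis mult.commute)
qed

text \<open>Each cubic monomial is a product of three coordinates and is averaged over their six
  permutations. The averaging uses rational numbers only, so \<open>T\<close> keeps the field of
  definition of \<open>f\<close>; smoothness, changes of basis and restrictions to lines are all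
  expressed through \<open>T\<close>.\<close>

lemma cubic_form_trilinear:
  fixes f :: "'n::finite mpoly"
  assumes f: "homogeneous 3 f"
  shows "\<exists>T. symmetric_trilinear T \<and> (\<forall>x. peval f x = T x x x) \<and>
    (\<forall>K u v w. number_field K \<longrightarrow> coeffs_in K f \<longrightarrow> vec_over K u \<longrightarrow> vec_over K v \<longrightarrow> vec_over K w \<longrightarrow> T u v w \<in> K)"
proof -
  have "\<forall>m\<in>Poly_Mapping.keys f. \<exists>i j k. \<forall>x. monomial_at m x = x $ i * x $ j * x $ k"
  proof
    fix m assume "m \<in> Poly_Mapping.keys f"
    then have "(\<Sum>i\<in>UNIV. Poly_Mapping.lookup m i) = Suc (Suc (Suc 0))"
      using f unfolding homogeneous_def by (simp add: numeral_3_eq_3)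
    then obtain i m1 where 1: "(\<Sum>i\<in>UNIV. Poly_Mapping.lookup m1 i) = Suc (Suc 0)"
      "\<And>x. monomial_at m x = x $ i * monomial_at m1 x" using monomial_at_split by blast
    then obtain j m2 where 2: "(\<Sum>i\<in>UNIV. Poly_Mapping.lookup m2 i) = Suc 0"
      "\<And>x. monomial_at m1 x = x $ j * monomial_at m2 x" using monomial_at_split by blast
    then obtain k m3 where 3: "(\<Sum>i\<in>UNIV. Poly_Mapping.lookup m3 i) = 0"
      "\<And>x. monomial_at m2 x = x $ k * monomial_at m3 x" using monomial_at_split by blast
    have "monomial_at m3 x = 1" for x using 3(1) by (simp add: monomial_at_def)
    then show "\<exists>i j k. \<forall>x. monomial_at m x = x $ i * x $ j * x $ k"
      using 1 2 3 by (metis mult.assoc mult.right_neutral)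
  qed
  then obtain a b c where abc: "\<And>m x. m \<in> Poly_Mapping.keys f \<Longrightarrow> monomial_at m x = x $ a m * x $ b m * x $ c m"
    by metis
  define M where "M i j k u v w = inverse 6 * (u $ i * v $ j * w $ k + u $ i * v $ k * w $ j
    + u $ j * v $ i * w $ k + u $ j * v $ k * w $ i + u $ k * v $ i * w $ j + u $ k * v $ j * w $ i)"
    for i j k and u v w :: "complex ^ 'n"
  define T where "T u v w = (\<Sum>m\<in>Poly_Mapping.keys f. Poly_Mapping.lookup f m * M (a m) (b m) (c m) u v w)" for u v w
  have "T u v w = T v u w" "T u v w = T u w v" for u v w
    unfolding T_def M_def by (simp_all add: algebra_simps)
  moreover have "T (r *s u + u') v w = r * T u v w + T u' v w" for r u u' v w
  proof -
    have "M i j k (r *s u + u') v w = r * M i j k u v w + M i j k u' v w" for i j k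
      unfolding M_def by (simp add: field_simps)
    then show ?thesis unfolding T_def by (simp add: sum_distrib_left sum.distrib[symmetric] algebra_simps)
  qed
  ultimately have "symmetric_trilinear T" unfolding symmetric_trilinear_def by blast
  moreover have "T u v w \<in> K"
    if K: "number_field K" and "coeffs_in K f" "vec_over K u" "vec_over K v" "vec_over K w" for K u v w
    unfolding T_def M_def using that unfolding coeffs_in_def vec_over_def
    by (intro nf_sum[OF K] nf_mult[OF K] nf_add[OF K] nf_inverse[OF K] nf_numeral[OF K]) auto
  moreover have "peval f x = T x x x" for x
    unfolding peval_keys T_def using abc by (intro sum.cong) (auto simp: M_def)
  ultimately show ?thesis by blast
qed

text \<open>Identifying the formal derivative with the analytic one lets uniqueness of derivatives
  compare it with the polar form.\<close>

lemma peval_partial_deriv: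
  "((\<lambda>t. peval f (x + t *s axis i 1)) has_field_derivative peval (partial_deriv i f) x) (at 0)"
proof -
  have mono: "((\<lambda>t. monomial_at m (x + t *s axis i 1)) has_field_derivative
    of_nat (Poly_Mapping.lookup m i) * monomial_at (m - Poly_Mapping.single i 1) x) (at 0)" for m
  proof -
    let ?l = "Poly_Mapping.lookup m"
    define R where "R = (\<Prod>j\<in>UNIV - {i}. (x $ j) ^ ?l j)"
    have "monomial_at m (x + t *s axis i 1) = (x $ i + t) ^ ?l i * R" for t
      unfolding monomial_at_def R_def
      by (subst prod.remove[of _ i]) (auto simp: axis_def intro!: prod.cong)
    moreover have "((\<lambda>t. (x $ i + t) ^ ?l i * R) has_field_derivative
      of_nat (?l i) * (x $ i) ^ (?l i - 1) * R) (at 0)"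
      by (auto intro!: derivative_eq_intros)
    moreover have "monomial_at (m - Poly_Mapping.single i 1) x = (x $ i) ^ (?l i - 1) * R"
      unfolding monomial_at_def R_def
      by (subst prod.remove[of _ i]) (auto simp: lookup_minus lookup_single when_def intro!: prod.cong)
    ultimately show ?thesis by (simp add: mult.assoc)
  qed
  have "peval (partial_deriv i f) x = (\<Sum>m\<in>Poly_Mapping.keys f. Poly_Mapping.lookup f m *
      (of_nat (Poly_Mapping.lookup m i) * monomial_at (m - Poly_Mapping.single i 1) x))"
    unfolding partial_deriv_def peval_sum peval_single by (simp add: mult_ac)
  then show ?thesis unfolding peval_keys[of f] by (auto intro!: DERIV_sum DERIV_cmult mono[unfolded One_nat_def])
qed

text \<open>The right-hand side is the coefficient of \<open>t\<close> in the expansion of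
  \<open>f\<close> along the coordinate axis. The Jacobian criterion thereby says that the linear
  form \<open>T x x\<close> is nonzero at every point of the surface.\<close>

lemma partial_deriv_trilinear:
  assumes T: "symmetric_trilinear T" and f: "\<And>x. peval f x = T x x x"
  shows "peval (partial_deriv i f) x = 3 * T x x (axis i 1)"
proof -
  let ?e = "axis i 1"
  have sym: "T u v w = T v u w" "T u v w = T u w v" and lin: "T (a *s u + u') v w = a * T u v w + T u' v w"
    for a u u' v w using T unfolding symmetric_trilinear_def by blast+
  have lin2: "T v (a *s u + u') w = a * T v u w + T v u' w" for a u u' v w using lin sym by metis
  have lin3: "T v w (a *s u + u') = a * T v w u + T v w u'" for a u u' v w using lin2 sym by metis
  have "peval f (x + t *s ?e) = T x x x + 3 * t * T x x ?e + 3 * t^2 * T x ?e ?e + t^3 * T ?e ?e ?e" for t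
  proof -
    have "T ?e x x = T x x ?e" "T x ?e x = T x x ?e" "T ?e ?e x = T x ?e ?e" "T ?e x ?e = T x ?e ?e"
      using sym by metis+
    then show ?thesis unfolding f add.commute[of x] lin lin2 lin3
      by (simp add: algebra_simps power2_eq_square power3_eq_cube)
  qed
  moreover have "((\<lambda>t. T x x x + 3 * t * T x x ?e + 3 * t^2 * T x ?e ?e + t^3 * T ?e ?e ?e)
    has_field_derivative 3 * T x x ?e) (at 0)"
    by (auto intro!: derivative_eq_intros)
  ultimately show ?thesis using peval_partial_deriv[of f x i] DERIV_unique by fastforce
qed

lemma linear_form:
  fixes h :: "'n::finite mpoly"
  assumes h: "h \<noteq> 0" "homogeneous 1 h" "coeffs_in K h" and K: "0 \<in> K"
  shows "\<exists>a. (\<forall>i. a i \<in> K) \<and> (\<exists>i. a i \<noteq> 0) \<and> (\<forall>x. peval h x = (\<Sum>i\<in>UNIV. a i * x $ i))"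
proof -
  define e where "e i = Poly_Mapping.single i (1::nat)" for i :: 'n
  have inj: "inj e" unfolding e_def by (intro injI) (metis lookup_single_eq lookup_single_not_eq zero_neq_one)
  have keys: "Poly_Mapping.keys h \<subseteq> range e"
  proof
    fix m assume "m \<in> Poly_Mapping.keys h"
    then have "(\<Sum>i\<in>UNIV. Poly_Mapping.lookup m i) = Suc 0" using h(2) unfolding homogeneous_def by simp
    then obtain i m' where m: "(\<Sum>i\<in>UNIV. Poly_Mapping.lookup m' i) = 0" "m = m' + e i"
      using monomial_at_split unfolding e_def by blast
    then have "m' = 0" by (intro poly_mapping_eqI) simp
    then show "m \<in> range e" using m by simp
  qed
  define a where "a i = Poly_Mapping.lookup h (e i)" for i
  have "a i \<in> K" for i using h(3) K unfolding a_def coeffs_in_def by (cases "e i \<in> Poly_Mapping.keys h") (auto simp: in_keys_iff)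
  moreover have "\<exists>i. a i \<noteq> 0"
  proof -
    obtain m where "m \<in> Poly_Mapping.keys h" using h(1) by fastforce
    then show ?thesis using keys unfolding a_def by (auto simp: in_keys_iff)
  qed
  moreover have "peval h x = (\<Sum>i\<in>UNIV. a i * x $ i)" for x
  proof -
    have "peval h x = (\<Sum>m\<in>range e. Poly_Mapping.lookup h m * monomial_at m x)"
      by (rule peval_superset) (use keys in auto)
    also have "\<dots> = (\<Sum>i\<in>UNIV. a i * x $ i)"
      by (subst sum.reindex[OF inj]) (simp add: a_def e_def monomial_at_single[unfolded One_nat_def])
    finally show ?thesis .
  qed
  ultimately show ?thesis by blast
qed

section \<open>Integral points from units and density\<close>

lemma (in S_arith) peval_in:
  assumes "coeffs_in O\<^sub>S p" "\<And>i. x $ i \<in> O\<^sub>S" shows "peval p x \<in> O\<^sub>S"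
proof -
  have pr: "prod g I \<in> O\<^sub>S" if "\<And>i. i \<in> I \<Longrightarrow> g i \<in> O\<^sub>S" for g :: "'a \<Rightarrow> complex" and I
    using that by (induction I rule: infinite_finite_induct) (auto intro: one mult)
  show ?thesis unfolding peval_def using assms unfolding coeffs_in_def by (intro sum mult pr power) auto
qed

text \<open>A primitive coordinate vector of the point is a multiple of \<open>x\<close> by a scalar of absolute value
  at least 1, so the form \<open>f * h\<close> does not vanish at it modulo any place outside \<open>S\<close>.\<close>

lemma (in S_arith) unit_values_imp_integral_point:
  fixes f h :: "'n::finite mpoly"
  assumes f: "homogeneous d f" "coeffs_in O\<^sub>S f" and h: "homogeneous e h" "coeffs_in O\<^sub>S h"
    and x: "x \<noteq> 0" "\<And>i. x $ i \<in> O\<^sub>S"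
    and fx: "peval f x \<noteq> 0" "inverse (peval f x) \<in> O\<^sub>S"
    and hx: "peval h x \<noteq> 0" "inverse (peval h x) \<in> O\<^sub>S"
  shows "proj_point x \<in> integral_points K S proj_space (zero_locus {f} \<union> zero_locus {h})"
proof -
  have self: "x \<in> proj_point x" unfolding proj_point_def by (auto intro!: exI[of _ 1])
  have "proj_point x \<in> rational_points K" unfolding rational_points_def using x in_field by blast
  moreover have "proj_point x \<in> proj_space" unfolding proj_space_def using x by blast
  moreover have "proj_point x \<notin> zero_locus {f} \<union> zero_locus {h}"
    using self fx hx unfolding zero_locus_def by blast
  moreover have "\<not> reduces_into K \<nu> (proj_point x) (zero_locus {f} \<union> zero_locus {h})" if nu: "\<nu> \<in> places K - S" for \<nu>
  proof
    assume "reduces_into K \<nu> (proj_point x) (zero_locus {f} \<union> zero_locus {h})"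
    then obtain y i where y: "y \<in> proj_point x" "y $ i \<in> valuation_ring K \<nu>" "y $ i \<notin> valuation_ideal K \<nu>"
      and g: "\<And>g d. homogeneous d g \<Longrightarrow> coeffs_in (valuation_ring K \<nu>) g \<Longrightarrow>
        zero_locus {f} \<union> zero_locus {h} \<subseteq> zero_locus {g} \<Longrightarrow> peval g y \<in> valuation_ideal K \<nu>"
      unfolding reduces_into_def by blast
    obtain l where l: "y = l *s x" "l \<noteq> 0" using y(1) unfolding proj_point_def by blast
    have yK: "y $ i \<in> K" using y(2) unfolding valuation_ring_def by blast
    obtain v where v: "v \<in> \<nu>" "v (y $ i) \<ge> 1"
      using y(3) yK unfolding valuation_ideal_def by force
    interpret v: abs_field K v using ultrametric(1)[OF nu v(1)] .
    have xK: "x $ i \<in> K" using x(2) in_field by blast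
    have "x $ i \<noteq> 0" using v(2) l v.zero by auto
    then have "l = y $ i / x $ i" using l by simp
    then have lK: "l \<in> K" using yK xK nf_divide[OF K] by simp
    have "1 \<le> v l * v (x $ i)" using v(2) l v.mult[OF lK xK] by simp
    also have "\<dots> \<le> v l * 1" using memD[OF x(2) nu v(1)] v.nonneg[OF lK] by (intro mult_left_mono)
    finally have vl: "1 \<le> v l" by simp
    have inO: "peval f x \<in> O\<^sub>S" "peval h x \<in> O\<^sub>S" using peval_in f h x by blast+
    have units: "v (peval f x) = 1" "v (peval h x) = 1"
      using unit_value[OF _ _ _ nu v(1)] inO fx hx by blast+
    have "coeffs_in O\<^sub>S (f * h)" using f h zero add mult by (intro coeffs_in_mult) auto
    then have "coeffs_in (valuation_ring K \<nu>) (f * h)"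
      using nu unfolding coeffs_in_def S_integers_def by blast
    moreover have "zero_locus {f} \<union> zero_locus {h} \<subseteq> zero_locus {f * h}"
      unfolding zero_locus_def by (auto simp: peval_mult)
    ultimately have "peval (f * h) y \<in> valuation_ideal K \<nu>" using g homogeneous_mult f(1) h(1) by blast
    then have "v (peval (f * h) y) < 1" using v(1) unfolding valuation_ideal_def by blast
    moreover have "peval (f * h) y = l ^ (d + e) * (peval f x * peval h x)"
      unfolding l(1) peval_mult peval_scale[OF f(1)] peval_scale[OF h(1)] by (simp add: power_add)
    then have "v (peval (f * h) y) = v l ^ (d + e)"
      using v.mult nf_mult[OF K] nf_power[OF K] lK inO in_field v.power units by simp
    moreover have "v l ^ (d + e) \<ge> 1" using vl by (rule one_le_power)
    ultimately show False by simp
  qed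
  ultimately show ?thesis unfolding integral_points_def by blast
qed

text \<open>On a line meeting the cubic in one point at finite distance, the values at integral
  parameters run through an arithmetic progression modulo \<open>\<beta>\<close>, which contains the infinitely many
  units \<open>u * 2 ^ (k * j)\<close> as soon as it contains the unit \<open>u\<close>.\<close>

lemma (in S_arith) infinite_unit_values:
  assumes half: "inverse 2 \<in> O\<^sub>S" and b: "b \<in> O\<^sub>S" and u: "u \<in> O\<^sub>S" "u \<noteq> 0" "inverse u \<in> O\<^sub>S"
  shows "infinite {t \<in> O\<^sub>S. u + t * b \<noteq> 0 \<and> inverse (u + t * b) \<in> O\<^sub>S}"
proof (cases "b = 0")
  \<comment> \<open>The value is constantly the unit \<open>u\<close>, so every natural number is a
    suitable parameter.\<close>
  case True
  have "infinite (range (of_nat :: nat \<Rightarrow> complex))" by (intro range_inj_infinite inj_of_nat)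
  moreover have "range of_nat \<subseteq> {t \<in> O\<^sub>S. u + t * b \<noteq> 0 \<and> inverse (u + t * b) \<in> O\<^sub>S}"
    using True u of_int[of "int n" for n] by auto
  ultimately show ?thesis using finite_subset by blast
next
  case False
  obtain k where k: "k > 0" "(2 ^ k - 1) / b \<in> O\<^sub>S" using two_power_congruent_1[OF half b False] by blast
  define t where "t j = u * ((2 ^ k) ^ j - 1) / b" for j :: nat
  have val: "u + t j * b = u * (2 ^ k) ^ j" for j using False by (simp add: t_def field_simps)
  have "t j \<in> O\<^sub>S" for j
  proof -
    have "t j = u * ((2 ^ k - 1) / b) * (\<Sum>i<j. (2 ^ k) ^ i)"
      unfolding t_def power_diff_1_eq by simp
    also have "\<dots> \<in> O\<^sub>S" using k u by (intro mult sum power numeral) auto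
    finally show ?thesis .
  qed
  moreover have "inverse (u + t j * b) \<in> O\<^sub>S" for j
  proof -
    have "inverse (u + t j * b) = inverse u * (inverse 2 ^ k) ^ j" unfolding val by (simp only: inverse_mult_distrib power_inverse)
    then show ?thesis using u half by (auto intro!: mult power)
  qed
  ultimately have sub: "range t \<subseteq> {t \<in> O\<^sub>S. u + t * b \<noteq> 0 \<and> inverse (u + t * b) \<in> O\<^sub>S}"
    using val u by auto
  have "inj t"
  proof (rule injI)
    fix i j assume "t i = t j"
    then have "((2::complex) ^ k) ^ i = (2 ^ k) ^ j" using False u by (simp add: t_def)
    then have "(of_nat (2 ^ (k * i)) :: complex) = of_nat (2 ^ (k * j))" by (simp add: power_mult)
    then have "(2::nat) ^ (k * i) = 2 ^ (k * j)" using of_nat_eq_iff by blast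
    then show "i = j" using k by simp
  qed
  then show ?thesis using sub range_inj_infinite finite_subset by blast
qed

text \<open>\<open>A\<close> holds the finitely many numbers whose integrality implies that of
  \<open>c n\<close> and of both directions for every \<open>n\<close>, so that a single
  \<open>S\<close> serves all planes.\<close>

lemma density_from_conic_fibration:
  fixes f h :: "4 mpoly" and X Y Z W :: "complex ^ 4" and c d1 d2 d1' d2' :: "nat \<Rightarrow> complex"
  assumes L: "number_field L" and KL: "K \<subseteq> L"
    and f: "homogeneous 3 f" "coeffs_in L f" and h: "homogeneous 1 h" "coeffs_in L h"
    and inL: "\<And>i. X $ i \<in> L \<and> Y $ i \<in> L \<and> Z $ i \<in> L \<and> W $ i \<in> L"
    and span: "\<And>v. \<exists>x y z w. v = x *s X + y *s Y + z *s Z + w *s W"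
    and hX: "\<And>x y z w. peval h (x *s X + y *s Y + z *s Z + w *s W) = w"
    and F: "\<And>x y z. F x y z = peval f (x *s X + y *s Y + z *s Z + W)"
    and base: "p1 \<in> L" "p2 \<in> L" "e1 \<in> L" "e2 \<in> L" "\<kappa> \<in> L" "\<kappa> \<noteq> 0"
      "\<And>y. F (e1 + y * p1) y (e2 + y * p2) = \<kappa>"
    and A: "finite A" "A \<subseteq> L"
    and int: "\<And>S n. S_arith L S \<Longrightarrow> inverse 2 \<in> S_integers L S \<Longrightarrow> A \<subseteq> S_integers L S \<Longrightarrow>
      {c n, d1 n, d2 n, d1' n, d2' n} \<subseteq> S_integers L S"
    and aff: "\<And>n x z t. F (x + t * d1 n) (c n) (z + t * d2 n)
        = F x (c n) z + t * (F (x + d1 n) (c n) (z + d2 n) - F x (c n) z)"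
    and aff': "\<And>n x z t. F (x + t * d1' n) (c n) (z + t * d2' n)
        = F x (c n) z + t * (F (x + d1' n) (c n) (z + d2' n) - F x (c n) z)"
    and inf: "infinite {c n | n. d1 n * d2' n - d2 n * d1' n \<noteq> 0}"
  shows "integral_points_potentially_dense K proj_space (zero_locus {f} \<union> zero_locus {h})"
proof -
  \<comment> \<open>With \<kappa> and its inverse integral, each point of the constant line with
    integral \<open>y\<close> is an integral point of the complement.\<close>
  define A' where "A' = A \<union> {inverse 2, p1, p2, e1, e2, \<kappa>, inverse \<kappa>}
    \<union> range (($) X) \<union> range (($) Y) \<union> range (($) Z) \<union> range (($) W)
    \<union> Poly_Mapping.lookup f ` Poly_Mapping.keys f \<union> Poly_Mapping.lookup h ` Poly_Mapping.keys h"
  have fin: "finite A'" unfolding A'_def using A by simp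
  have sub: "A' \<subseteq> L"
  proof -
    have inv: "inverse 2 \<in> L" "inverse \<kappa> \<in> L"
      by (rule nf_inverse[OF L nf_numeral[OF L]], rule nf_inverse[OF L base(5)])
    have r: "range (($) X) \<subseteq> L" "range (($) Y) \<subseteq> L" "range (($) Z) \<subseteq> L" "range (($) W) \<subseteq> L"
      using inL by auto
    have s: "{inverse 2, p1, p2, e1, e2, \<kappa>, inverse \<kappa>} \<subseteq> L"
      using base(1-5) inv by (simp only: insert_subset empty_subsetI simp_thms)
    have cf: "Poly_Mapping.lookup f ` Poly_Mapping.keys f \<subseteq> L" "Poly_Mapping.lookup h ` Poly_Mapping.keys h \<subseteq> L"
      using f(2) h(2) unfolding coeffs_in_def by blast+
    show ?thesis unfolding A'_def by (intro Un_least A(2) r s cf)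
  qed
  obtain S where S: "finite S" "archimedean_places L \<subseteq> S" "S \<subseteq> places L" "A' \<subseteq> S_integers L S"
    using exists_places_integral[OF L fin sub] by (elim exE conjE)
  interpret S_arith L S using L S by unfold_locales
  have mem: "A \<subseteq> O\<^sub>S" "inverse 2 \<in> O\<^sub>S" "p1 \<in> O\<^sub>S" "p2 \<in> O\<^sub>S" "e1 \<in> O\<^sub>S" "e2 \<in> O\<^sub>S" "\<kappa> \<in> O\<^sub>S" "inverse \<kappa> \<in> O\<^sub>S"
    using S(4) unfolding A'_def by auto
  have memX: "X $ i \<in> O\<^sub>S" "Y $ i \<in> O\<^sub>S" "Z $ i \<in> O\<^sub>S" "W $ i \<in> O\<^sub>S" for i
    using S(4) unfolding A'_def by auto
  have memf: "coeffs_in O\<^sub>S f" "coeffs_in O\<^sub>S h"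
    using S(4) unfolding A'_def coeffs_in_def by auto
  have memc: "c n \<in> O\<^sub>S" "d1 n \<in> O\<^sub>S" "d2 n \<in> O\<^sub>S" "d1' n \<in> O\<^sub>S" "d2' n \<in> O\<^sub>S" for n
    using int[OF S_arith_axioms mem(2,1), of n] by auto
  define pt where "pt x y z = x *s X + y *s Y + z *s Z + W" for x y z
  have pt_in: "pt x y z $ i \<in> O\<^sub>S" if "x \<in> O\<^sub>S" "y \<in> O\<^sub>S" "z \<in> O\<^sub>S" for x y z i
    unfolding pt_def using that memX by (simp add: add mult)
  have Fpt: "F x y z = peval f (pt x y z)" for x y z unfolding F pt_def ..
  have FO: "F x y z \<in> O\<^sub>S" if "x \<in> O\<^sub>S" "y \<in> O\<^sub>S" "z \<in> O\<^sub>S" for x y z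
    unfolding Fpt using peval_in[OF memf(1)] pt_in[OF that] by blast
  have hpt: "peval h (pt x y z) = 1" for x y z using hX[of x y z 1] unfolding pt_def by simp
  define \<Sigma> where "\<Sigma> = {(x, y, z). x \<in> O\<^sub>S \<and> y \<in> O\<^sub>S \<and> z \<in> O\<^sub>S \<and> F x y z \<noteq> 0 \<and> inverse (F x y z) \<in> O\<^sub>S}"
  have ip: "proj_point (pt x y z) \<in> integral_points L S proj_space (zero_locus {f} \<union> zero_locus {h})"
    if "(x, y, z) \<in> \<Sigma>" for x y z
  proof (rule unit_values_imp_integral_point[OF f(1) memf(1) h(1) memf(2)])
    show "pt x y z \<noteq> 0"
      using hpt[of x y z] peval_scale[OF h(1), of 0 "0::complex^4"] by auto
  qed (use that pt_in hpt one in \<open>auto simp: \<Sigma>_def Fpt\<close>)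
  have move: "infinite {t. (x + t * a, y, z + t * b) \<in> \<Sigma>}"
    if P: "(x, y, z) \<in> \<Sigma>" and ab: "a \<in> O\<^sub>S" "b \<in> O\<^sub>S"
      and aff: "\<And>t. F (x + t * a) y (z + t * b) = F x y z + t * (F (x + a) y (z + b) - F x y z)" for x y z a b
  proof -
    have PO: "x \<in> O\<^sub>S" "y \<in> O\<^sub>S" "z \<in> O\<^sub>S" "F x y z \<noteq> 0" "inverse (F x y z) \<in> O\<^sub>S" using P unfolding \<Sigma>_def by auto
    have "F (x + a) y (z + b) - F x y z \<in> O\<^sub>S" using PO ab by (intro diff FO add)
    from infinite_unit_values[OF mem(2) this FO[OF PO(1-3)] PO(4,5)]
    show ?thesis
      by (rule infinite_super[rotated]) (use PO ab aff in \<open>auto simp: \<Sigma>_def intro: add mult\<close>)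
  qed
  have "zariski_dense_in (integral_points L S proj_space (zero_locus {f} \<union> zero_locus {h}))
      (proj_space - (zero_locus {f} \<union> zero_locus {h}))"
    unfolding zariski_dense_in_def
  proof (intro conjI allI impI)
    show "integral_points L S proj_space (zero_locus {f} \<union> zero_locus {h}) \<subseteq> proj_space - (zero_locus {f} \<union> zero_locus {h})"
      unfolding integral_points_def by blast
    fix Q assume Q: "zariski_closed Q \<and> integral_points L S proj_space (zero_locus {f} \<union> zero_locus {h}) \<subseteq> Q"
    then obtain G where G: "\<And>g. g \<in> G \<Longrightarrow> \<exists>d. homogeneous d g" "Q = zero_locus G"
      unfolding zariski_closed_def by blast
    have g0: "peval g v = 0" if g: "g \<in> G" and v: "peval h v \<noteq> 0" for g v
    proof -
      obtain dg where dg: "homogeneous dg g" using G(1)[OF g] by blast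
      have z\<Sigma>: "peval g (pt x y z) = 0" if "(x, y, z) \<in> \<Sigma>" for x y z
      proof -
        have "proj_point (pt x y z) \<in> zero_locus G" using ip[OF that] Q G(2) by blast
        moreover have "pt x y z \<in> proj_point (pt x y z)" unfolding proj_point_def by (auto intro!: exI[of _ 1])
        ultimately show ?thesis using g unfolding zero_locus_def by blast
      qed
      have line: "pt (x + t * a) y (z + t * b) = pt x y z + t *s (a *s X + b *s Z)" for x y z t a b
        unfolding pt_def by (simp add: vec_eq_iff algebra_simps)
      have plane: "peval g (pt x (c n) z) = 0" if det: "d1 n * d2' n - d2 n * d1' n \<noteq> 0" for n x z
      proof -
        \<comment> \<open>The point where the constant line meets the plane
          \<open>y = c n\<close>.\<close>
        define x0 z0 where "x0 = e1 + c n * p1" and "z0 = e2 + c n * p2"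
        have P0: "(x0, c n, z0) \<in> \<Sigma>"
          unfolding \<Sigma>_def using base mem memc by (auto simp: x0_def z0_def intro!: add mult)
        define T1 where "T1 = {t. (x0 + t * d1 n, c n, z0 + t * d2 n) \<in> \<Sigma>}"
        have T1: "infinite T1" unfolding T1_def by (rule move[OF P0 memc(2,3) aff])
        \<comment> \<open>For each \<open>t\<close> in \<open>T1\<close> the form has infinitely
          many zeros on the line in the second direction, so it vanishes for all \<open>s\<close>.
          In \<open>2\<close> the parameter \<open>s\<close> is fixed and \<open>t\<close> is freed
          in the same way.\<close>
        have 1: "peval g (pt (x0 + t * d1 n + s * d1' n) (c n) (z0 + t * d2 n + s * d2' n)) = 0" if "t \<in> T1" for t s
          unfolding line[of "x0 + t * d1 n" s]
        proof (rule peval_eq_0_on_line)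
          have P1: "(x0 + t * d1 n, c n, z0 + t * d2 n) \<in> \<Sigma>" using that unfolding T1_def by blast
          show "infinite {s. (x0 + t * d1 n + s * d1' n, c n, z0 + t * d2 n + s * d2' n) \<in> \<Sigma>}"
            by (rule move[OF P1 memc(4,5) aff'])
          show "peval g (pt (x0 + t * d1 n) (c n) (z0 + t * d2 n) + s *s (d1' n *s X + d2' n *s Z)) = 0"
            if "s \<in> {s. (x0 + t * d1 n + s * d1' n, c n, z0 + t * d2 n + s * d2' n) \<in> \<Sigma>}" for s
            using z\<Sigma> that unfolding line[of "x0 + t * d1 n" s, symmetric] by blast
        qed
        have 2: "peval g (pt (x0 + s * d1' n + t * d1 n) (c n) (z0 + s * d2' n + t * d2 n)) = 0" for t s
          unfolding line[of "x0 + s * d1' n" t]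
        proof (rule peval_eq_0_on_line[OF T1])
          show "peval g (pt (x0 + s * d1' n) (c n) (z0 + s * d2' n) + t *s (d1 n *s X + d2 n *s Z)) = 0" if "t \<in> T1" for t
            using 1[OF that, of s] unfolding line[of "x0 + s * d1' n" t, symmetric] by (simp add: add_ac)
        qed
        define D where "D = d1 n * d2' n - d2 n * d1' n"
        \<comment> \<open>Cramer's rule for \<open>(x, z)\<close> in the coordinates given by the
          two directions.\<close>
        define t s where "t = ((x - x0) * d2' n - (z - z0) * d1' n) / D"
          and "s = ((z - z0) * d1 n - (x - x0) * d2 n) / D"
        have D: "D \<noteq> 0" using det by (simp add: D_def)
        have "D * (x0 + s * d1' n + t * d1 n) = D * x" "D * (z0 + s * d2' n + t * d2 n) = D * z"
          using D by (simp_all add: t_def s_def distrib_left) (simp_all add: D_def algebra_simps)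
        then have "x0 + s * d1' n + t * d1 n = x" "z0 + s * d2' n + t * d2 n = z" using D by simp_all
        then show ?thesis using 2[of s t] by simp
      qed
      have liney: "pt x y z = pt x 0 z + y *s Y" for x y z unfolding pt_def by (simp add: algebra_simps)
      have all: "peval g (pt x y z) = 0" for x y z
        unfolding liney[of x y z]
      proof (rule peval_eq_0_on_line[OF inf])
        fix t assume "t \<in> {c n | n. d1 n * d2' n - d2 n * d1' n \<noteq> 0}"
        then show "peval g (pt x 0 z + t *s Y) = 0" using plane unfolding liney[symmetric] by blast
      qed
      obtain x y z w where xyzw: "v = x *s X + y *s Y + z *s Z + w *s W" using span by blast
      have w: "w \<noteq> 0" using v hX unfolding xyzw by blast
      have "v = w *s pt (x / w) (y / w) (z / w)" unfolding xyzw pt_def using w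
        by (simp add: vec_eq_iff field_simps)
      then show ?thesis using peval_scale[OF dg] all by simp
    qed
    show "proj_space - (zero_locus {f} \<union> zero_locus {h}) \<subseteq> Q"
    proof
      fix P assume P: "P \<in> proj_space - (zero_locus {f} \<union> zero_locus {h})"
      then obtain x where x: "P = proj_point x" "x \<noteq> 0" unfolding proj_space_def by blast
      have "\<exists>y\<in>P. peval h y \<noteq> 0" using P unfolding zero_locus_def by auto
      then have hx: "peval h x \<noteq> 0" unfolding x proj_point_def using peval_scale[OF h(1)] by auto
      have "peval g y = 0" if gy: "g \<in> G" "y \<in> P" for g y
      proof -
        obtain l where "y = l *s x" "l \<noteq> 0" using gy(2) unfolding x proj_point_def by blast
        then show ?thesis using g0[OF gy(1)] hx peval_scale[OF h(1)] by auto
      qed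
      then show "P \<in> Q" unfolding G(2) zero_locus_def using P by blast
    qed
  qed
  then show ?thesis unfolding integral_points_potentially_dense_def using L KL S by blast
qed

section \<open>Affine lines in the complement\<close>

lemma adjoin_quadratic_root:
  assumes K: "number_field K" "a \<in> K" "b \<in> K" "c \<in> K" and nz: "a \<noteq> 0 \<or> b \<noteq> 0"
    and root: "a * x\<^sup>2 + b * x + c = 0"
  shows "\<exists>L. number_field L \<and> K \<subseteq> L \<and> x \<in> L"
proof -
  define co where "co i = (if i = 0 then c else if i = 1 then b else if i = 2 then a else 0)" for i :: nat
  have co: "co i \<in> K" for i using K nf_zero[OF K(1)] unfolding co_def by auto
  show ?thesis
  proof (cases "a = 0")
    case True
    show ?thesis by (rule adjoin_root[of K co 1, OF K(1) co]) (use root nz True in \<open>simp_all add: co_def algebra_simps\<close>)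
  next
    case False
    show ?thesis
      by (rule adjoin_root[of K co 2, OF K(1) co]) (use root False in \<open>simp_all add: co_def numeral_2_eq_2 algebra_simps\<close>)
  qed
qed

text \<open>The quadratic formula with rationalised numerator. In this form the root is continuous
  even where the leading coefficient \<open>a\<close> becomes 0, as happens in the limit of the
  split case. The principal square root has nonnegative real part, which keeps
  \<open>1 + csqrt z\<close> away from 0.\<close>

definition small_root :: "complex \<Rightarrow> complex \<Rightarrow> complex \<Rightarrow> complex" where
  "small_root a b c = - 2 * c / (b * (1 + csqrt (1 - 4 * a * c / b\<^sup>2)))"

lemma one_plus_csqrt_nonzero: "1 + csqrt z \<noteq> 0"
proof
  assume "1 + csqrt z = 0"
  then have "Re (csqrt z) = - 1" by (metis add_eq_0_iff minus_add_cancel one_complex.sel(1) uminus_complex.sel(1) add.commute)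
  moreover have "0 \<le> Re (csqrt z)" using csqrt_principal[of z] by linarith
  ultimately show False by linarith
qed

lemma small_root:
  assumes b: "b \<noteq> 0" shows "a * (small_root a b c)\<^sup>2 + b * small_root a b c + c = 0"
proof -
  define r where "r = csqrt (1 - 4 * a * c / b\<^sup>2)"
  have r: "1 + r \<noteq> 0" unfolding r_def by (rule one_plus_csqrt_nonzero)
  have "r\<^sup>2 = 1 - 4 * a * c / b\<^sup>2" unfolding r_def by simp
  then have r2: "4 * a * c = b\<^sup>2 * (1 - r\<^sup>2)" using b by simp
  have x: "small_root a b c = - 2 * c / (b * (1 + r))" unfolding small_root_def r_def ..
  have "a * (small_root a b c)\<^sup>2 = (4 * a * c) * c / (b\<^sup>2 * (1 + r)\<^sup>2)"
    unfolding x by (simp add: power_divide power_mult_distrib power2_eq_square mult_ac)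
  also have "\<dots> = (1 - r) * c / (1 + r)" unfolding r2 using b r
    by (simp add: power2_eq_square divide_simps) (simp add: algebra_simps)
  finally show ?thesis unfolding x using b r by (simp add: divide_simps) (simp add: algebra_simps)
qed

lemma isCont_small_root:
  assumes "isCont a t" "isCont b t" "isCont c t" "b t \<noteq> 0" "1 - 4 * a t * c t / (b t)\<^sup>2 \<notin> \<real>\<^sub>\<le>\<^sub>0"
  shows "isCont (\<lambda>t :: complex. small_root (a t) (b t) (c t)) t"
  unfolding small_root_def using assms one_plus_csqrt_nonzero
  by (intro continuous_intros continuous_at_compose[unfolded o_def, of t _ csqrt]) auto

text \<open>The limit is taken over the complex numbers, but the parameter has to lie in the number
  field; the rational numbers \<open>1 / n\<close> do.\<close>

lemma eventually_at_inverse_nat: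
  assumes "\<forall>\<^sub>F t in nhds (0::complex). P t"
  obtains n :: nat where "n > 0" "P (inverse (of_nat n))"
proof -
  have "\<forall>\<^sub>F n in sequentially. P (inverse (of_nat n))"
    using lim_inverse_n assms by (rule filterlim_iff[THEN iffD1, rule_format])
  then have "\<forall>\<^sub>F n in sequentially. P (inverse (of_nat n)) \<and> n > 0"
    by (intro eventually_conj eventually_gt_at_top)
  then show ?thesis using that by (auto simp: eventually_sequentially)
qed

lemma eventually_nonzero:
  fixes g :: "complex \<Rightarrow> complex"
  assumes "isCont g t" "g t \<noteq> 0" shows "\<forall>\<^sub>F u in nhds t. g u \<noteq> 0"
  using assms unfolding isCont_def tendsto_at_iff_tendsto_nhds by (rule tendsto_imp_eventually_ne)

text \<open>The cubic \<open>y a(x,z) + b(x,z) + y\<^sup>2 m(x,z) + y q(x,z) + r(x,z) + k(y)\<close>; the line \<open>l\<close> is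
  \<open>y = 0\<close> in the plane at infinity.\<close>

locale cubic_containing_line =
  fixes K :: "complex set" and a1 a2 a3 b1 b2 b3 m1 m2 q1 q2 r1 r2 k0 k1 k2 k3 :: complex
  assumes K: "number_field K"
    and coeffs: "{a1, a2, a3, b1, b2, b3, m1, m2, q1, q2, r1, r2, k0, k1, k2, k3} \<subseteq> K"
begin

definition F :: "complex \<Rightarrow> complex \<Rightarrow> complex \<Rightarrow> complex" where
  "F x y z = y * (a1 * x\<^sup>2 + a2 * x * z + a3 * z\<^sup>2) + (b1 * x\<^sup>2 + b2 * x * z + b3 * z\<^sup>2)
     + y\<^sup>2 * (m1 * x + m2 * z) + y * (q1 * x + q2 * z) + (r1 * x + r2 * z)
     + k0 * y ^ 3 + k1 * y\<^sup>2 + k2 * y + k3"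

text \<open>This is the line through \<open>(e1, 0, e2)\<close> with point at infinity
  \<open>p = (p1 : 1 : p2)\<close>. The three nonconstant coefficients vanish exactly if it lies on
  the surface or meets it at \<open>p\<close> alone, with multiplicity three. The coefficient of
  \<open>y ^ 3\<close> is free of \<open>e\<close> and says that \<open>p\<close> is on the residual
  conic; the next one is linear in \<open>e\<close>, and that of \<open>y\<close> is
  quadratic.\<close>

lemma F_on_line:
  "F (e1 + y * p1) y (e2 + y * p2) = F e1 0 e2
    + y * (a1 * e1\<^sup>2 + a2 * e1 * e2 + a3 * e2\<^sup>2 + 2 * b1 * e1 * p1 + b2 * (e1 * p2 + e2 * p1) + 2 * b3 * e2 * p2
        + q1 * e1 + q2 * e2 + r1 * p1 + r2 * p2 + k2)
    + y\<^sup>2 * (2 * a1 * e1 * p1 + a2 * (e1 * p2 + e2 * p1) + 2 * a3 * e2 * p2 + b1 * p1\<^sup>2 + b2 * p1 * p2 + b3 * p2\<^sup>2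
        + m1 * e1 + m2 * e2 + q1 * p1 + q2 * p2 + k1)
    + y ^ 3 * (a1 * p1\<^sup>2 + a2 * p1 * p2 + a3 * p2\<^sup>2 + m1 * p1 + m2 * p2 + k0)"
  unfolding F_def by (simp add: algebra_simps power2_eq_square power3_eq_cube)

text \<open>Since the line lies on the surface, \<open>F\<close> has degree 2 in \<open>x\<close>
  and \<open>z\<close> for fixed \<open>y\<close>. By hypothesis its quadratic part vanishes at
  \<open>(d1, d2)\<close>, which means that the residual conic passes through this point of
  \<open>l\<close>.\<close>

lemma F_along_direction:
  assumes "y * (a1 * d1\<^sup>2 + a2 * d1 * d2 + a3 * d2\<^sup>2) + b1 * d1\<^sup>2 + b2 * d1 * d2 + b3 * d2\<^sup>2 = 0"
  shows "F (x + t * d1) y (z + t * d2) = F x y z + t * (F (x + d1) y (z + d2) - F x y z)"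
proof -
  have "F (x + t * d1) y (z + t * d2) - (F x y z + t * (F (x + d1) y (z + d2) - F x y z))
    = (t\<^sup>2 - t) * (y * (a1 * d1\<^sup>2 + a2 * d1 * d2 + a3 * d2\<^sup>2) + b1 * d1\<^sup>2 + b2 * d1 * d2 + b3 * d2\<^sup>2)"
    unfolding F_def by (simp add: algebra_simps power2_eq_square)
  then show ?thesis using assms by simp
qed

definition has_constant_line :: bool where
  "has_constant_line \<longleftrightarrow> (\<exists>L p1 p2 e1 e2 \<kappa>. number_field L \<and> K \<subseteq> L \<and> p1 \<in> L \<and> p2 \<in> L \<and> e1 \<in> L \<and> e2 \<in> L \<and>
     \<kappa> \<in> L \<and> \<kappa> \<noteq> 0 \<and> (\<forall>y. F (e1 + y * p1) y (e2 + y * p2) = \<kappa>))"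

lemma F_in:
  assumes L: "number_field L" "K \<subseteq> L" and "x \<in> L" "y \<in> L" "z \<in> L"
  shows "F x y z \<in> L"
  unfolding F_def using assms(3-) coeffs L(2)
  by (intro nf_add[OF L(1)] nf_mult[OF L(1)] nf_power[OF L(1)]) auto

lemma has_constant_lineI:
  assumes "number_field L" "K \<subseteq> L" "p1 \<in> L" "p2 \<in> L" "e1 \<in> L" "e2 \<in> L" "F e1 0 e2 \<noteq> 0"
    and "a1 * p1\<^sup>2 + a2 * p1 * p2 + a3 * p2\<^sup>2 + m1 * p1 + m2 * p2 + k0 = 0"
    and "2 * a1 * e1 * p1 + a2 * (e1 * p2 + e2 * p1) + 2 * a3 * e2 * p2 + b1 * p1\<^sup>2 + b2 * p1 * p2 + b3 * p2\<^sup>2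
        + m1 * e1 + m2 * e2 + q1 * p1 + q2 * p2 + k1 = 0"
    and "a1 * e1\<^sup>2 + a2 * e1 * e2 + a3 * e2\<^sup>2 + 2 * b1 * e1 * p1 + b2 * (e1 * p2 + e2 * p1) + 2 * b3 * e2 * p2
        + q1 * e1 + q2 * e2 + r1 * p1 + r2 * p2 + k2 = 0"
  shows "has_constant_line"
  unfolding has_constant_line_def using assms F_on_line[of e1 _ p1 e2 p2] F_in[OF assms(1,2,5) nf_zero[OF assms(1)] assms(6)]
  by (intro exI[of _ L] exI[of _ p1] exI[of _ p2] exI[of _ e1] exI[of _ e2] exI[of _ "F e1 0 e2"]) simp

text \<open>In the three constructions below the point at infinity \<open>p\<close> tends to \<open>l\<close> as \<open>s = 1 / \<sigma>\<close>
  tends to infinity. The Greek letters are the coordinates of \<open>p\<close> and of the point \<open>e\<close> of the tangent in the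
  plane \<open>y = 0\<close>, divided by their orders of growth, so that they and the value \<open>V\<close> of the cubic become
  continuous at \<open>\<sigma> = 0\<close>. First the case that \<open>l\<close> meets the residual conic at infinity twice.\<close>

lemma constant_line_split:
  assumes a: "a1 = 0" "a2 = 1" "a3 = 0" and b: "b1 \<noteq> 0" "b3 \<noteq> 0"
  shows "has_constant_line"
proof -
  \<comment> \<open>The residual conic at infinity is \<open>(p1 + m2) * (p2 + m1) = k\<close>. It
    is parametrised by \<open>p1 = s - m2\<close>, \<open>p2 = k / s - m1\<close>, and for large
    \<open>s\<close> the point tends to the direction \<open>x\<close> on \<open>l\<close>.\<close>
  define k where "k = m1 * m2 - k0"
  define \<pi>1 where "\<pi>1 \<sigma> = 1 - m2 * \<sigma>" for \<sigma>
  define \<pi>2 where "\<pi>2 \<sigma> = k * \<sigma> - m1" for \<sigma>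
  \<comment> \<open>\<beta> is the part of the \<open>y\<close>-square coefficient free of
    \<open>e\<close>, divided by \<open>s^2\<close>. The condition linear in \<open>e\<close>
    becomes \<eta> = - k \<sigma>^2 \<xi> - \<beta>; substituted into the quadratic one, it gives
    the equation for \<xi> with coefficients \<open>A\<close>, \<open>B\<close>, \<open>C\<close>,
    which is linear at \<sigma> = 0.\<close>
  define \<beta> where "\<beta> \<sigma> = b1 * (\<pi>1 \<sigma>)\<^sup>2 + b2 * \<pi>1 \<sigma> * \<pi>2 \<sigma> * \<sigma> + b3 * (\<pi>2 \<sigma>)\<^sup>2 * \<sigma>\<^sup>2 + q1 * \<pi>1 \<sigma> * \<sigma> + q2 * \<pi>2 \<sigma> * \<sigma>\<^sup>2 + k1 * \<sigma>\<^sup>2" for \<sigma>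
  define G where "G \<sigma> = b2 * \<pi>1 \<sigma> + 2 * b3 * \<pi>2 \<sigma> * \<sigma> + q2 * \<sigma>" for \<sigma>
  define A where "A \<sigma> = - k * \<sigma>\<^sup>2" for \<sigma>
  define B where "B \<sigma> = - \<beta> \<sigma> + 2 * b1 * \<pi>1 \<sigma> + b2 * \<pi>2 \<sigma> * \<sigma> - k * \<sigma>\<^sup>2 * G \<sigma> + q1 * \<sigma>" for \<sigma>
  define C where "C \<sigma> = - \<beta> \<sigma> * G \<sigma> + r1 * \<pi>1 \<sigma> * \<sigma> + r2 * \<pi>2 \<sigma> * \<sigma>\<^sup>2 + k2 * \<sigma>\<^sup>2" for \<sigma>
  define \<xi> where "\<xi> \<sigma> = small_root (A \<sigma>) (B \<sigma>) (C \<sigma>)" for \<sigma>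
  define \<eta> where "\<eta> \<sigma> = - k * \<sigma>\<^sup>2 * \<xi> \<sigma> - \<beta> \<sigma>" for \<sigma>
  define V where "V \<sigma> = b1 * (\<xi> \<sigma>)\<^sup>2 + b2 * \<xi> \<sigma> * \<eta> \<sigma> + b3 * (\<eta> \<sigma>)\<^sup>2 + \<sigma> * (r1 * \<xi> \<sigma> + r2 * \<eta> \<sigma>) + k3 * \<sigma>\<^sup>2" for \<sigma>
  have c1: "isCont \<pi>1 0" "isCont \<pi>2 0" unfolding \<pi>1_def \<pi>2_def by (intro continuous_intros)+
  have c2: "isCont \<beta> 0" "isCont G 0" "isCont A 0" unfolding \<beta>_def G_def A_def by (intro continuous_intros c1)+
  have c3: "isCont B 0" "isCont C 0" unfolding B_def C_def by (intro continuous_intros c1 c2)+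
  have at0: "\<pi>1 0 = 1" "\<pi>2 0 = - m1" "\<beta> 0 = b1" "G 0 = b2" "A 0 = 0" "B 0 = b1" "C 0 = - b1 * b2"
    by (simp_all add: \<pi>1_def \<pi>2_def \<beta>_def G_def A_def B_def C_def)
  have \<xi>: "isCont \<xi> 0" unfolding \<xi>_def by (intro isCont_small_root c2 c3) (use at0 b in auto)
  have "isCont V 0" unfolding V_def \<eta>_def by (intro continuous_intros \<xi> c2)
  moreover have "\<xi> 0 = b2" "\<eta> 0 = - b1" unfolding \<eta>_def \<xi>_def small_root_def at0 using b by simp_all
  \<comment> \<open>The terms with \<open>b2\<close> cancel. What remains are the values
    \<open>b1\<close> and \<open>b3\<close> of \<open>b\<close> at the two zeros of
    \<open>a = x z\<close>.\<close>
  then have "V 0 = b1\<^sup>2 * b3" unfolding V_def by (simp add: power2_eq_square)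
  then have "V 0 \<noteq> 0" using b by simp
  ultimately have ev: "\<forall>\<^sub>F \<sigma> in nhds 0. V \<sigma> \<noteq> 0" by (rule eventually_nonzero)
  have "\<forall>\<^sub>F \<sigma> in nhds 0. B \<sigma> \<noteq> 0" using c3(1) at0 b by (intro eventually_nonzero) auto
  from eventually_at_inverse_nat[OF eventually_conj[OF ev this]]
  obtain n :: nat where n: "n > 0" "V (inverse (of_nat n)) \<noteq> 0" "B (inverse (of_nat n)) \<noteq> 0" by blast
  define s \<sigma> where "s = (of_nat n :: complex)" and "\<sigma> = inverse s"
  have s: "s \<noteq> 0" "s * \<sigma> = 1" using n by (auto simp: s_def \<sigma>_def)
  have nz: "V \<sigma> \<noteq> 0" "B \<sigma> \<noteq> 0" using n by (simp_all add: s_def \<sigma>_def)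
  note memK = nf_add[OF K] nf_mult[OF K] nf_power[OF K] nf_diff[OF K] nf_minus[OF K] nf_one[OF K] nf_numeral[OF K]
  have cf: "b1 \<in> K" "b2 \<in> K" "b3 \<in> K" "m1 \<in> K" "m2 \<in> K" "q1 \<in> K" "q2 \<in> K" "r1 \<in> K" "r2 \<in> K" "k0 \<in> K" "k1 \<in> K" "k2 \<in> K"
    using coeffs by auto
  have "s \<in> K" "\<sigma> \<in> K" unfolding \<sigma>_def s_def by (intro nf_inverse[OF K] nf_of_nat[OF K])+
  then have "k \<in> K" "\<pi>1 \<sigma> \<in> K" "\<pi>2 \<sigma> \<in> K" using cf by (auto simp: k_def \<pi>1_def \<pi>2_def intro!: memK)
  note cf = cf this \<open>s \<in> K\<close> \<open>\<sigma> \<in> K\<close>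
  have "\<beta> \<sigma> \<in> K" "G \<sigma> \<in> K" "A \<sigma> \<in> K" unfolding \<beta>_def G_def A_def by (intro memK cf)+
  note cf = cf this
  have "B \<sigma> \<in> K" "C \<sigma> \<in> K" unfolding B_def C_def by (intro memK cf)+
  have root: "A \<sigma> * (\<xi> \<sigma>)\<^sup>2 + B \<sigma> * \<xi> \<sigma> + C \<sigma> = 0" unfolding \<xi>_def by (rule small_root[OF nz(2)])
  obtain L where L: "number_field L" "K \<subseteq> L" "\<xi> \<sigma> \<in> L"
    using adjoin_quadratic_root[OF K \<open>A \<sigma> \<in> K\<close> \<open>B \<sigma> \<in> K\<close> \<open>C \<sigma> \<in> K\<close> _ root] nz by blast
  note memL = nf_add[OF L(1)] nf_mult[OF L(1)] nf_power[OF L(1)] nf_diff[OF L(1)] nf_minus[OF L(1)]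
  note cfL = cf[THEN subsetD[OF L(2)]]
  have "\<eta> \<sigma> \<in> L" unfolding \<eta>_def by (intro memL cfL L)
  have s2: "\<sigma>\<^sup>2 * s\<^sup>2 = 1" using s by (simp add: power_mult_distrib[symmetric] mult.commute)
  show ?thesis
  proof (rule has_constant_lineI[of L "s * \<pi>1 \<sigma>" "\<pi>2 \<sigma>" "s * \<xi> \<sigma>" "s * \<eta> \<sigma>"])
    show "number_field L" "K \<subseteq> L" by fact+
    show "s * \<pi>1 \<sigma> \<in> L" "\<pi>2 \<sigma> \<in> L" "s * \<xi> \<sigma> \<in> L" "s * \<eta> \<sigma> \<in> L"
      using cfL L \<open>\<eta> \<sigma> \<in> L\<close> by (auto intro: memL)
    have "F (s * \<xi> \<sigma>) 0 (s * \<eta> \<sigma>) = s\<^sup>2 * V \<sigma>"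
      unfolding F_def V_def \<sigma>_def using s(1) by (simp add: field_simps power2_eq_square)
    then show "F (s * \<xi> \<sigma>) 0 (s * \<eta> \<sigma>) \<noteq> 0" using nz s by simp
    show "a1 * (s * \<pi>1 \<sigma>)\<^sup>2 + a2 * (s * \<pi>1 \<sigma>) * \<pi>2 \<sigma> + a3 * (\<pi>2 \<sigma>)\<^sup>2 + m1 * (s * \<pi>1 \<sigma>) + m2 * \<pi>2 \<sigma> + k0 = 0"
      unfolding a \<pi>1_def \<pi>2_def \<sigma>_def k_def using s(1) by (simp add: field_simps power2_eq_square)
    have \<pi>: "s * \<pi>1 \<sigma> = s - m2" "\<pi>2 \<sigma> = k * \<sigma> - m1"
      unfolding \<pi>1_def \<pi>2_def \<sigma>_def using s(1) by (simp_all add: field_simps)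
    have "s\<^sup>2 * \<beta> \<sigma> = b1 * (s * \<pi>1 \<sigma>)\<^sup>2 + b2 * (s * \<pi>1 \<sigma>) * \<pi>2 \<sigma> + b3 * (\<pi>2 \<sigma>)\<^sup>2 + q1 * (s * \<pi>1 \<sigma>) + q2 * \<pi>2 \<sigma> + k1"
      unfolding \<beta>_def \<sigma>_def using s(1) by (simp add: field_simps power2_eq_square)
    moreover have "(s * \<xi> \<sigma>) * \<pi>2 \<sigma> + (s * \<eta> \<sigma>) * (s * \<pi>1 \<sigma>) + m1 * (s * \<xi> \<sigma>) + m2 * (s * \<eta> \<sigma>)
        = - (s\<^sup>2 * \<beta> \<sigma>)"
    proof -
      have "(s * \<xi> \<sigma>) * \<pi>2 \<sigma> + (s * \<eta> \<sigma>) * (s * \<pi>1 \<sigma>) + m1 * (s * \<xi> \<sigma>) + m2 * (s * \<eta> \<sigma>)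
        = (s * \<sigma>) * k * \<xi> \<sigma> + s\<^sup>2 * \<eta> \<sigma>"
        unfolding \<pi> by (simp add: algebra_simps power2_eq_square)
      also have "s\<^sup>2 * \<eta> \<sigma> = - (\<sigma>\<^sup>2 * s\<^sup>2) * k * \<xi> \<sigma> - s\<^sup>2 * \<beta> \<sigma>"
        unfolding \<eta>_def by (simp add: algebra_simps)
      finally show ?thesis unfolding s(2) s2 by simp
    qed
    ultimately show "2 * a1 * (s * \<xi> \<sigma>) * (s * \<pi>1 \<sigma>) + a2 * (s * \<xi> \<sigma> * \<pi>2 \<sigma> + s * \<eta> \<sigma> * (s * \<pi>1 \<sigma>)) + 2 * a3 * (s * \<eta> \<sigma>) * \<pi>2 \<sigma>
        + b1 * (s * \<pi>1 \<sigma>)\<^sup>2 + b2 * (s * \<pi>1 \<sigma>) * \<pi>2 \<sigma> + b3 * (\<pi>2 \<sigma>)\<^sup>2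
        + m1 * (s * \<xi> \<sigma>) + m2 * (s * \<eta> \<sigma>) + q1 * (s * \<pi>1 \<sigma>) + q2 * \<pi>2 \<sigma> + k1 = 0"
      unfolding a by (simp only: mult_zero_left mult_zero_right mult_1_left add_0_left add_0_right) algebra
    have "a1 * (s * \<xi> \<sigma>)\<^sup>2 + a2 * (s * \<xi> \<sigma>) * (s * \<eta> \<sigma>) + a3 * (s * \<eta> \<sigma>)\<^sup>2 + 2 * b1 * (s * \<xi> \<sigma>) * (s * \<pi>1 \<sigma>)
        + b2 * (s * \<xi> \<sigma> * \<pi>2 \<sigma> + s * \<eta> \<sigma> * (s * \<pi>1 \<sigma>)) + 2 * b3 * (s * \<eta> \<sigma>) * \<pi>2 \<sigma>
        + q1 * (s * \<xi> \<sigma>) + q2 * (s * \<eta> \<sigma>) + r1 * (s * \<pi>1 \<sigma>) + r2 * \<pi>2 \<sigma> + k2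
      = s\<^sup>2 * (\<xi> \<sigma> * \<eta> \<sigma> + 2 * b1 * \<xi> \<sigma> * \<pi>1 \<sigma> + b2 * \<xi> \<sigma> * \<pi>2 \<sigma> * \<sigma> + \<eta> \<sigma> * G \<sigma>
          + q1 * \<xi> \<sigma> * \<sigma> + r1 * \<pi>1 \<sigma> * \<sigma> + r2 * \<pi>2 \<sigma> * \<sigma>\<^sup>2 + k2 * \<sigma>\<^sup>2)"
      unfolding a G_def \<sigma>_def using s(1) by (simp add: field_simps power2_eq_square)
    also have "\<dots> = s\<^sup>2 * (A \<sigma> * (\<xi> \<sigma>)\<^sup>2 + B \<sigma> * \<xi> \<sigma> + C \<sigma>)"
      unfolding A_def B_def C_def \<eta>_def by (simp add: algebra_simps power2_eq_square)
    finally show "a1 * (s * \<xi> \<sigma>)\<^sup>2 + a2 * (s * \<xi> \<sigma>) * (s * \<eta> \<sigma>) + a3 * (s * \<eta> \<sigma>)\<^sup>2 + 2 * b1 * (s * \<xi> \<sigma>) * (s * \<pi>1 \<sigma>)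
        + b2 * (s * \<xi> \<sigma> * \<pi>2 \<sigma> + s * \<eta> \<sigma> * (s * \<pi>1 \<sigma>)) + 2 * b3 * (s * \<eta> \<sigma>) * \<pi>2 \<sigma>
        + q1 * (s * \<xi> \<sigma>) + q2 * (s * \<eta> \<sigma>) + r1 * (s * \<pi>1 \<sigma>) + r2 * \<pi>2 \<sigma> + k2 = 0"
      using root by simp
  qed
qed

end

context cubic_containing_line begin

text \<open>The residual conic at infinity touches \<open>l\<close>.\<close>

lemma constant_line_tangent:
  assumes a: "a1 = 1" "a2 = 0" "a3 = 0" and b: "b3 \<noteq> 0" and m: "m2 \<noteq> 0"
  shows "has_constant_line"
proof -
  \<comment> \<open>The conic \<open>x^2 + m1 x + m2 z + k0 = 0\<close> is solved for
    \<open>z\<close> at \<open>x = s\<close>, so \<open>p2\<close> has order \<open>s^2\<close>. The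
    conditions on \<open>e\<close> balance when its coordinates have orders \<open>s^3\<close> and
    \<open>s^4\<close>.\<close>
  define \<pi> where "\<pi> \<sigma> = - (1 + m1 * \<sigma> + k0 * \<sigma>\<^sup>2) / m2" for \<sigma>
  define u where "u \<sigma> = - (2 + m1 * \<sigma>) / m2" for \<sigma>
  define \<beta> where "\<beta> \<sigma> = b1 * \<sigma>\<^sup>2 + b2 * \<pi> \<sigma> * \<sigma> + b3 * (\<pi> \<sigma>)\<^sup>2 + q1 * \<sigma> ^ 3 + q2 * \<pi> \<sigma> * \<sigma>\<^sup>2 + k1 * \<sigma> ^ 4" for \<sigma>
  define w where "w \<sigma> = - \<beta> \<sigma> / m2" for \<sigma>
  define G where "G \<sigma> = b2 * \<sigma> + 2 * b3 * \<pi> \<sigma> + q2 * \<sigma>\<^sup>2" for \<sigma>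
  define B where "B \<sigma> = 2 * b1 * \<sigma>\<^sup>2 + b2 * \<pi> \<sigma> * \<sigma> + u \<sigma> * G \<sigma> + q1 * \<sigma> ^ 3" for \<sigma>
  define C where "C \<sigma> = w \<sigma> * G \<sigma> + r1 * \<sigma> ^ 5 + r2 * \<pi> \<sigma> * \<sigma> ^ 4 + k2 * \<sigma> ^ 6" for \<sigma>
  define \<xi> where "\<xi> \<sigma> = small_root 1 (B \<sigma>) (C \<sigma>)" for \<sigma>
  define \<eta> where "\<eta> \<sigma> = u \<sigma> * \<xi> \<sigma> + w \<sigma>" for \<sigma>
  define V where "V \<sigma> = b1 * (\<xi> \<sigma>)\<^sup>2 * \<sigma>\<^sup>2 + b2 * \<xi> \<sigma> * \<eta> \<sigma> * \<sigma> + b3 * (\<eta> \<sigma>)\<^sup>2 + r1 * \<xi> \<sigma> * \<sigma> ^ 5 + r2 * \<eta> \<sigma> * \<sigma> ^ 4 + k3 * \<sigma> ^ 8" for \<sigma>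
  have c1: "isCont \<pi> 0" "isCont u 0" unfolding \<pi>_def u_def using m by (intro continuous_intros; simp)+
  have c2: "isCont \<beta> 0" "isCont G 0" unfolding \<beta>_def G_def by (intro continuous_intros c1)+
  have c3: "isCont w 0" unfolding w_def using m by (intro continuous_intros c2) simp
  have c4: "isCont B 0" "isCont C 0" unfolding B_def C_def by (intro continuous_intros c1 c2 c3)+
  have at0: "\<pi> 0 = - 1 / m2" "u 0 = - 2 / m2" "\<beta> 0 = b3 / m2\<^sup>2" "w 0 = - b3 / m2 ^ 3" "G 0 = - 2 * b3 / m2"
    by (simp_all add: \<pi>_def u_def \<beta>_def w_def G_def power2_eq_square power3_eq_cube)
  have B0: "B 0 = 4 * b3 / m2\<^sup>2" and C0: "C 0 = 2 * b3\<^sup>2 / m2 ^ 4"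
    by (simp_all add: B_def C_def at0 power2_eq_square power3_eq_cube power4_eq_xxxx)
  \<comment> \<open>The value 1/2 is off the branch cut of the square root. It also gives
    \<open>r^2 = 1/2\<close>, hence \<open>1 - r\<close> is nonzero, and with it the limit of
    \<eta>.\<close>
  have \<delta>: "1 - 4 * 1 * C 0 / (B 0)\<^sup>2 = 1 / 2"
    unfolding B0 C0 using b m by (simp add: field_simps power2_eq_square power4_eq_xxxx)
  define r where "r = csqrt (1 / 2)"
  have r: "r\<^sup>2 = 1 / 2" "1 + r \<noteq> 0" unfolding r_def by (rule power2_csqrt, rule one_plus_csqrt_nonzero)
  then have r1: "1 - r \<noteq> 0" by (auto simp: power2_eq_square)
  have \<xi>: "isCont \<xi> 0" unfolding \<xi>_def
  proof (rule isCont_small_root[OF continuous_const c4])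
    show "1 - 4 * 1 * C 0 / (B 0)\<^sup>2 \<notin> \<real>\<^sub>\<le>\<^sub>0" unfolding \<delta> by (simp add: complex_nonpos_Reals_iff)
  qed (use B0 b m in simp)
  have "isCont V 0" unfolding V_def \<eta>_def by (intro continuous_intros \<xi> c1 c2 c3)
  moreover have "V 0 \<noteq> 0"
  proof -
    have \<xi>0: "\<xi> 0 = - b3 / (m2\<^sup>2 * (1 + r))"
      unfolding \<xi>_def small_root_def \<delta> r_def[symmetric] unfolding B0 C0 using b m r(2)
      by (simp add: divide_simps) (simp add: power2_eq_square power4_eq_xxxx)
    have "\<eta> 0 = b3 * (1 - r) / (m2 ^ 3 * (1 + r))"
      unfolding \<eta>_def at0 \<xi>0 using m r(2) by (simp add: divide_simps) (simp add: algebra_simps power2_eq_square power3_eq_cube)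
    then show ?thesis unfolding V_def using b m r(2) r1 by simp
  qed
  ultimately have ev: "\<forall>\<^sub>F \<sigma> in nhds 0. V \<sigma> \<noteq> 0" by (rule eventually_nonzero)
  have "\<forall>\<^sub>F \<sigma> in nhds 0. B \<sigma> \<noteq> 0" using c4(1) B0 b m by (intro eventually_nonzero) auto
  from eventually_at_inverse_nat[OF eventually_conj[OF ev this]]
  obtain n :: nat where n: "n > 0" "V (inverse (of_nat n)) \<noteq> 0" "B (inverse (of_nat n)) \<noteq> 0" by blast
  define s \<sigma> where "s = (of_nat n :: complex)" and "\<sigma> = inverse s"
  have s: "s \<noteq> 0" "s * \<sigma> = 1" using n by (auto simp: s_def \<sigma>_def)
  have nz: "V \<sigma> \<noteq> 0" "B \<sigma> \<noteq> 0" using n by (simp_all add: s_def \<sigma>_def)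
  note memK = nf_add[OF K] nf_mult[OF K] nf_power[OF K] nf_diff[OF K] nf_minus[OF K] nf_one[OF K] nf_numeral[OF K] nf_divide[OF K]
  have cf: "b1 \<in> K" "b2 \<in> K" "b3 \<in> K" "m1 \<in> K" "m2 \<in> K" "q1 \<in> K" "q2 \<in> K" "r1 \<in> K" "r2 \<in> K" "k0 \<in> K" "k1 \<in> K" "k2 \<in> K"
    using coeffs by auto
  have "s \<in> K" "\<sigma> \<in> K" unfolding \<sigma>_def s_def by (intro nf_inverse[OF K] nf_of_nat[OF K])+
  note cf = cf this
  have "\<pi> \<sigma> \<in> K" "u \<sigma> \<in> K" unfolding \<pi>_def u_def by (intro memK cf)+
  note cf = cf this
  have "\<beta> \<sigma> \<in> K" "G \<sigma> \<in> K" unfolding \<beta>_def G_def by (intro memK cf)+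
  note cf = cf this
  have "w \<sigma> \<in> K" unfolding w_def by (intro memK cf)
  note cf = cf this
  have "B \<sigma> \<in> K" "C \<sigma> \<in> K" unfolding B_def C_def by (intro memK cf)+
  have root: "1 * (\<xi> \<sigma>)\<^sup>2 + B \<sigma> * \<xi> \<sigma> + C \<sigma> = 0" unfolding \<xi>_def by (rule small_root[OF nz(2)])
  obtain L where L: "number_field L" "K \<subseteq> L" "\<xi> \<sigma> \<in> L"
    using adjoin_quadratic_root[OF K nf_one[OF K] \<open>B \<sigma> \<in> K\<close> \<open>C \<sigma> \<in> K\<close> disjI2[OF nz(2)] root] by blast
  note memL = nf_add[OF L(1)] nf_mult[OF L(1)] nf_power[OF L(1)]
  note cfL = cf[THEN subsetD[OF L(2)]]
  have \<eta>L: "\<eta> \<sigma> \<in> L" unfolding \<eta>_def by (intro memL cfL L)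
  show ?thesis
  proof (rule has_constant_lineI[of L s "s\<^sup>2 * \<pi> \<sigma>" "s ^ 3 * \<xi> \<sigma>" "s ^ 4 * \<eta> \<sigma>"])
    show "number_field L" "K \<subseteq> L" by fact+
    show "s \<in> L" "s\<^sup>2 * \<pi> \<sigma> \<in> L" "s ^ 3 * \<xi> \<sigma> \<in> L" "s ^ 4 * \<eta> \<sigma> \<in> L" by (intro memL cfL L \<eta>L)+
    have "F (s ^ 3 * \<xi> \<sigma>) 0 (s ^ 4 * \<eta> \<sigma>) = s ^ 8 * V \<sigma>"
      unfolding F_def V_def \<sigma>_def using s(1) by (simp add: field_simps eval_nat_numeral)
    then show "F (s ^ 3 * \<xi> \<sigma>) 0 (s ^ 4 * \<eta> \<sigma>) \<noteq> 0" using nz s by simp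
    show "a1 * s\<^sup>2 + a2 * s * (s\<^sup>2 * \<pi> \<sigma>) + a3 * (s\<^sup>2 * \<pi> \<sigma>)\<^sup>2 + m1 * s + m2 * (s\<^sup>2 * \<pi> \<sigma>) + k0 = 0"
      unfolding a \<pi>_def \<sigma>_def using s(1) m by (simp add: field_simps power2_eq_square)
    have be: "s ^ 4 * \<beta> \<sigma> = b1 * s\<^sup>2 + b2 * s * (s\<^sup>2 * \<pi> \<sigma>) + b3 * (s\<^sup>2 * \<pi> \<sigma>)\<^sup>2 + q1 * s + q2 * (s\<^sup>2 * \<pi> \<sigma>) + k1"
      unfolding \<beta>_def \<sigma>_def using s(1) by (simp add: field_simps power2_eq_square power3_eq_cube power4_eq_xxxx)
    have lin: "2 * (s ^ 3 * \<xi> \<sigma>) * s + m1 * (s ^ 3 * \<xi> \<sigma>) + m2 * (s ^ 4 * \<eta> \<sigma>) = - (s ^ 4 * \<beta> \<sigma>)"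
    proof -
      have "m2 * \<eta> \<sigma> = - 2 * \<xi> \<sigma> - m1 * \<sigma> * \<xi> \<sigma> - \<beta> \<sigma>"
        unfolding \<eta>_def u_def w_def using m by (simp add: field_simps)
      then have "m2 * (s ^ 4 * \<eta> \<sigma>) = s ^ 4 * (- 2 * \<xi> \<sigma> - m1 * \<sigma> * \<xi> \<sigma> - \<beta> \<sigma>)" by (simp add: mult.left_commute)
      also have "\<dots> = - 2 * s ^ 4 * \<xi> \<sigma> - m1 * s ^ 3 * (s * \<sigma>) * \<xi> \<sigma> - s ^ 4 * \<beta> \<sigma>"
        by (simp add: algebra_simps power3_eq_cube power4_eq_xxxx)
      finally have "m2 * (s ^ 4 * \<eta> \<sigma>) = - 2 * s ^ 4 * \<xi> \<sigma> - m1 * s ^ 3 * \<xi> \<sigma> - s ^ 4 * \<beta> \<sigma>"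
        unfolding s(2) by simp
      moreover have "2 * (s ^ 3 * \<xi> \<sigma>) * s = 2 * s ^ 4 * \<xi> \<sigma>"
        by (simp add: power3_eq_cube power4_eq_xxxx)
      ultimately show ?thesis by simp
    qed
    show "2 * a1 * (s ^ 3 * \<xi> \<sigma>) * s + a2 * (s ^ 3 * \<xi> \<sigma> * (s\<^sup>2 * \<pi> \<sigma>) + s ^ 4 * \<eta> \<sigma> * s) + 2 * a3 * (s ^ 4 * \<eta> \<sigma>) * (s\<^sup>2 * \<pi> \<sigma>)
        + b1 * s\<^sup>2 + b2 * s * (s\<^sup>2 * \<pi> \<sigma>) + b3 * (s\<^sup>2 * \<pi> \<sigma>)\<^sup>2
        + m1 * (s ^ 3 * \<xi> \<sigma>) + m2 * (s ^ 4 * \<eta> \<sigma>) + q1 * s + q2 * (s\<^sup>2 * \<pi> \<sigma>) + k1 = 0"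
      using lin unfolding a be by (simp add: eq_neg_iff_add_eq_0 algebra_simps)
    have "a1 * (s ^ 3 * \<xi> \<sigma>)\<^sup>2 + a2 * (s ^ 3 * \<xi> \<sigma>) * (s ^ 4 * \<eta> \<sigma>) + a3 * (s ^ 4 * \<eta> \<sigma>)\<^sup>2 + 2 * b1 * (s ^ 3 * \<xi> \<sigma>) * s
        + b2 * (s ^ 3 * \<xi> \<sigma> * (s\<^sup>2 * \<pi> \<sigma>) + s ^ 4 * \<eta> \<sigma> * s) + 2 * b3 * (s ^ 4 * \<eta> \<sigma>) * (s\<^sup>2 * \<pi> \<sigma>)
        + q1 * (s ^ 3 * \<xi> \<sigma>) + q2 * (s ^ 4 * \<eta> \<sigma>) + r1 * s + r2 * (s\<^sup>2 * \<pi> \<sigma>) + k2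
      = s ^ 6 * ((\<xi> \<sigma>)\<^sup>2 + 2 * b1 * \<xi> \<sigma> * \<sigma>\<^sup>2 + b2 * \<xi> \<sigma> * \<pi> \<sigma> * \<sigma> + \<eta> \<sigma> * G \<sigma>
          + q1 * \<xi> \<sigma> * \<sigma> ^ 3 + r1 * \<sigma> ^ 5 + r2 * \<pi> \<sigma> * \<sigma> ^ 4 + k2 * \<sigma> ^ 6)"
      unfolding a G_def \<sigma>_def using s(1) by (simp add: field_simps eval_nat_numeral)
    also have "\<dots> = s ^ 6 * (1 * (\<xi> \<sigma>)\<^sup>2 + B \<sigma> * \<xi> \<sigma> + C \<sigma>)"
      unfolding B_def C_def \<eta>_def by (simp add: algebra_simps)
    finally show "a1 * (s ^ 3 * \<xi> \<sigma>)\<^sup>2 + a2 * (s ^ 3 * \<xi> \<sigma>) * (s ^ 4 * \<eta> \<sigma>) + a3 * (s ^ 4 * \<eta> \<sigma>)\<^sup>2 + 2 * b1 * (s ^ 3 * \<xi> \<sigma>) * s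
        + b2 * (s ^ 3 * \<xi> \<sigma> * (s\<^sup>2 * \<pi> \<sigma>) + s ^ 4 * \<eta> \<sigma> * s) + 2 * b3 * (s ^ 4 * \<eta> \<sigma>) * (s\<^sup>2 * \<pi> \<sigma>)
        + q1 * (s ^ 3 * \<xi> \<sigma>) + q2 * (s ^ 4 * \<eta> \<sigma>) + r1 * s + r2 * (s\<^sup>2 * \<pi> \<sigma>) + k2 = 0"
      using root by simp
  qed
qed

text \<open>The plane at infinity meets the surface in three concurrent lines, one of them \<open>x = \<rho> y\<close>.\<close>

lemma constant_line_concurrent:
  assumes a: "a1 = 1" "a2 = 0" "a3 = 0" and b: "b3 \<noteq> 0" and m: "m2 = 0"
    and \<rho>: "\<rho>\<^sup>2 + m1 * \<rho> + k0 = 0" "2 * \<rho> + m1 \<noteq> 0"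
  shows "has_constant_line"
proof -
  have cfK: "b1 \<in> K" "b2 \<in> K" "b3 \<in> K" "m1 \<in> K" "q1 \<in> K" "q2 \<in> K" "r1 \<in> K" "r2 \<in> K" "k0 \<in> K" "k1 \<in> K" "k2 \<in> K"
    using coeffs by auto
  have "1 * \<rho>\<^sup>2 + m1 * \<rho> + k0 = 0" using \<rho> by simp
  then obtain L where L: "number_field L" "K \<subseteq> L" "\<rho> \<in> L"
    using adjoin_quadratic_root[OF K nf_one[OF K] cfK(4) cfK(9), of \<rho>] by auto
  \<comment> \<open>Here \<open>p\<close> moves along the line \<open>x = \<rho> y\<close> with
    \<open>p2 = s\<close>, and \<tau> is the derivative of \<open>x^2 + m1 x + k0\<close> at \<rho>.
    As it is nonzero, the condition linear in \<open>e\<close> determines \<open>e1\<close>, and the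
    last condition is then linear in \<open>e2\<close>, with solution \<eta> = - N / D.\<close>
  define \<tau> where "\<tau> = 2 * \<rho> + m1"
  have \<tau>: "\<tau> \<noteq> 0" using \<rho> by (simp add: \<tau>_def)
  define \<beta> where "\<beta> \<sigma> = b3 + (b2 * \<rho> + q2) * \<sigma> + (b1 * \<rho>\<^sup>2 + q1 * \<rho> + k1) * \<sigma>\<^sup>2" for \<sigma>
  define \<xi> where "\<xi> \<sigma> = - \<beta> \<sigma> / \<tau>" for \<sigma>
  define N where "N \<sigma> = (\<xi> \<sigma>)\<^sup>2 + 2 * b1 * \<rho> * \<xi> \<sigma> * \<sigma>\<^sup>2 + b2 * \<xi> \<sigma> * \<sigma> + q1 * \<xi> \<sigma> * \<sigma>\<^sup>2 + r2 * \<sigma> ^ 3 + (r1 * \<rho> + k2) * \<sigma> ^ 4" for \<sigma>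
  define D where "D \<sigma> = 2 * b3 + (b2 * \<rho> + q2) * \<sigma>" for \<sigma>
  define \<eta> where "\<eta> \<sigma> = - N \<sigma> / D \<sigma>" for \<sigma>
  define V where "V \<sigma> = b1 * (\<xi> \<sigma>)\<^sup>2 * \<sigma>\<^sup>2 + b2 * \<xi> \<sigma> * \<eta> \<sigma> * \<sigma> + b3 * (\<eta> \<sigma>)\<^sup>2 + r1 * \<xi> \<sigma> * \<sigma> ^ 4 + r2 * \<eta> \<sigma> * \<sigma> ^ 3 + k3 * \<sigma> ^ 6" for \<sigma>
  have \<xi>: "isCont \<xi> 0" unfolding \<xi>_def \<beta>_def using \<tau> by (intro continuous_intros) simp
  have D: "isCont D 0" "D 0 \<noteq> 0" unfolding D_def using b by (intro continuous_intros, simp)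
  have \<eta>: "isCont \<eta> 0" unfolding \<eta>_def N_def using D by (intro continuous_intros \<xi>)
  have "isCont V 0" unfolding V_def by (intro continuous_intros \<xi> \<eta>)
  moreover have "V 0 \<noteq> 0" unfolding V_def \<eta>_def N_def \<xi>_def \<beta>_def using b \<tau> D by simp
  ultimately have ev: "\<forall>\<^sub>F \<sigma> in nhds 0. V \<sigma> \<noteq> 0" by (rule eventually_nonzero)
  from eventually_at_inverse_nat[OF eventually_conj[OF ev eventually_nonzero[OF D]]]
  obtain n :: nat where n: "n > 0" "V (inverse (of_nat n)) \<noteq> 0" "D (inverse (of_nat n)) \<noteq> 0" by blast
  define s \<sigma> where "s = (of_nat n :: complex)" and "\<sigma> = inverse s"
  have s: "s \<noteq> 0" "s * \<sigma> = 1" using n by (auto simp: s_def \<sigma>_def)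
  have nz: "V \<sigma> \<noteq> 0" "D \<sigma> \<noteq> 0" using n by (simp_all add: s_def \<sigma>_def)
  note memL = nf_add[OF L(1)] nf_mult[OF L(1)] nf_power[OF L(1)] nf_minus[OF L(1)] nf_numeral[OF L(1)] nf_divide[OF L(1)]
  have "s \<in> L" "\<sigma> \<in> L" unfolding \<sigma>_def s_def by (intro nf_inverse[OF L(1)] nf_of_nat[OF L(1)])+
  note cfL = cfK[THEN subsetD[OF L(2)]] L(3) this
  have \<xi>L: "\<xi> \<sigma> \<in> L" unfolding \<xi>_def \<beta>_def \<tau>_def by (intro memL cfL)
  have \<eta>L: "\<eta> \<sigma> \<in> L" unfolding \<eta>_def N_def D_def by (intro memL cfL \<xi>L)
  show ?thesis
  proof (rule has_constant_lineI[of L \<rho> s "s\<^sup>2 * \<xi> \<sigma>" "s ^ 3 * \<eta> \<sigma>"])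
    show "number_field L" "K \<subseteq> L" by fact+
    show "\<rho> \<in> L" "s \<in> L" "s\<^sup>2 * \<xi> \<sigma> \<in> L" "s ^ 3 * \<eta> \<sigma> \<in> L" by (intro memL cfL \<xi>L \<eta>L)+
    have "F (s\<^sup>2 * \<xi> \<sigma>) 0 (s ^ 3 * \<eta> \<sigma>) = s ^ 6 * V \<sigma>"
      unfolding F_def V_def \<sigma>_def using s(1) by (simp add: field_simps eval_nat_numeral)
    then show "F (s\<^sup>2 * \<xi> \<sigma>) 0 (s ^ 3 * \<eta> \<sigma>) \<noteq> 0" using nz s by simp
    show "a1 * \<rho>\<^sup>2 + a2 * \<rho> * s + a3 * s\<^sup>2 + m1 * \<rho> + m2 * s + k0 = 0" unfolding a m using \<rho> by simp
    have eq: "s\<^sup>2 * (\<tau> * \<xi> \<sigma>) = - (b1 * \<rho>\<^sup>2 + b2 * \<rho> * s + b3 * s\<^sup>2 + q1 * \<rho> + q2 * s + k1)"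
      unfolding \<xi>_def \<beta>_def \<sigma>_def using s(1) \<tau> by (simp add: field_simps power2_eq_square)
    have "2 * (s\<^sup>2 * \<xi> \<sigma>) * \<rho> + m1 * (s\<^sup>2 * \<xi> \<sigma>) = s\<^sup>2 * (\<tau> * \<xi> \<sigma>)"
      unfolding \<tau>_def by (simp add: algebra_simps)
    then show "2 * a1 * (s\<^sup>2 * \<xi> \<sigma>) * \<rho> + a2 * (s\<^sup>2 * \<xi> \<sigma> * s + s ^ 3 * \<eta> \<sigma> * \<rho>) + 2 * a3 * (s ^ 3 * \<eta> \<sigma>) * s
        + b1 * \<rho>\<^sup>2 + b2 * \<rho> * s + b3 * s\<^sup>2 + m1 * (s\<^sup>2 * \<xi> \<sigma>) + m2 * (s ^ 3 * \<eta> \<sigma>) + q1 * \<rho> + q2 * s + k1 = 0"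
      unfolding eq a m by (simp add: eq_neg_iff_add_eq_0 algebra_simps)
    have "D \<sigma> * \<eta> \<sigma> = - N \<sigma>" unfolding \<eta>_def using nz by simp
    then have "s ^ 4 * (D \<sigma> * \<eta> \<sigma> + N \<sigma>) = 0" by simp
    moreover have "a1 * (s\<^sup>2 * \<xi> \<sigma>)\<^sup>2 + a2 * (s\<^sup>2 * \<xi> \<sigma>) * (s ^ 3 * \<eta> \<sigma>) + a3 * (s ^ 3 * \<eta> \<sigma>)\<^sup>2 + 2 * b1 * (s\<^sup>2 * \<xi> \<sigma>) * \<rho>
        + b2 * (s\<^sup>2 * \<xi> \<sigma> * s + s ^ 3 * \<eta> \<sigma> * \<rho>) + 2 * b3 * (s ^ 3 * \<eta> \<sigma>) * s
        + q1 * (s\<^sup>2 * \<xi> \<sigma>) + q2 * (s ^ 3 * \<eta> \<sigma>) + r1 * \<rho> + r2 * s + k2 = s ^ 4 * (D \<sigma> * \<eta> \<sigma> + N \<sigma>)"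
      unfolding a D_def N_def \<sigma>_def using s(1) by (simp add: field_simps eval_nat_numeral)
    ultimately show "a1 * (s\<^sup>2 * \<xi> \<sigma>)\<^sup>2 + a2 * (s\<^sup>2 * \<xi> \<sigma>) * (s ^ 3 * \<eta> \<sigma>) + a3 * (s ^ 3 * \<eta> \<sigma>)\<^sup>2 + 2 * b1 * (s\<^sup>2 * \<xi> \<sigma>) * \<rho>
        + b2 * (s\<^sup>2 * \<xi> \<sigma> * s + s ^ 3 * \<eta> \<sigma> * \<rho>) + 2 * b3 * (s ^ 3 * \<eta> \<sigma>) * s
        + q1 * (s\<^sup>2 * \<xi> \<sigma>) + q2 * (s ^ 3 * \<eta> \<sigma>) + r1 * \<rho> + r2 * s + k2 = 0" by simp
  qed
qed

end

section \<open>Integral planes through the line whose residual conic meets it in rational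
  points\<close>

lemma finite_poly_root_power_2:
  assumes "(q :: complex poly) \<noteq> 0" shows "finite {n :: nat. poly q (2 ^ n) = 0}"
proof -
  have inj: "inj (\<lambda>n :: nat. (2 :: complex) ^ n)"
  proof (rule injI)
    fix i j :: nat assume "(2 :: complex) ^ i = 2 ^ j"
    then have "(of_nat (2 ^ i) :: complex) = of_nat (2 ^ j)" by simp
    then have "(2::nat) ^ i = 2 ^ j" using of_nat_eq_iff by blast
    then show "i = j" by simp
  qed
  have "finite ((\<lambda>n :: nat. (2 :: complex) ^ n) -` {x. poly q x = 0})"
    using poly_roots_finite[OF assms] inj by (intro finite_vimageI)
  then show ?thesis by (simp add: vimage_def)
qed

lemma infinite_values:
  assumes "\<And>y. finite {n :: nat. c n = y}" "finite {n. \<not> P n}"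
  shows "infinite {c n | n. P n}"
proof
  assume fin: "finite {c n | n. P n}"
  have "UNIV \<subseteq> {n. \<not> P n} \<union> (\<Union>y\<in>{c n | n. P n}. {n. c n = y})" by blast
  then have "finite (UNIV :: nat set)" using fin assms by (meson finite_UN_I finite_Un finite_subset)
  then show False by simp
qed

context cubic_containing_line begin

text \<open>The final field and \<open>S\<close> are known only once the constant line has been
  found. The integrality clause therefore quantifies over all \<open>L\<close> and \<open>S\<close>,
  given that 1/2 and the coefficients of \<open>b\<close> are integral.\<close>

definition split_planes :: "(nat \<Rightarrow> complex) \<Rightarrow> (nat \<Rightarrow> complex) \<Rightarrow> (nat \<Rightarrow> complex) \<Rightarrow>
    (nat \<Rightarrow> complex) \<Rightarrow> (nat \<Rightarrow> complex) \<Rightarrow> bool" where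
  "split_planes c d1 d2 d1' d2' \<longleftrightarrow>
     (\<forall>L S n. S_arith L S \<longrightarrow> inverse 2 \<in> S_integers L S \<longrightarrow> {b1, b2, b3} \<subseteq> S_integers L S \<longrightarrow>
        {c n, d1 n, d2 n, d1' n, d2' n} \<subseteq> S_integers L S) \<and>
     (\<forall>n x z t. F (x + t * d1 n) (c n) (z + t * d2 n)
        = F x (c n) z + t * (F (x + d1 n) (c n) (z + d2 n) - F x (c n) z)) \<and>
     (\<forall>n x z t. F (x + t * d1' n) (c n) (z + t * d2' n)
        = F x (c n) z + t * (F (x + d1' n) (c n) (z + d2' n) - F x (c n) z)) \<and>
     infinite {c n | n. d1 n * d2' n - d2 n * d1' n \<noteq> 0}"

text \<open>With \<open>\<omega> = 2 ^ n\<close>, the quadratic part in the plane \<open>y = c n\<close> is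
  \<open>(z - \<omega> x) (b3 z - (b1 / \<omega>) x)\<close>, and \<open>(z - \<omega> x) (b3 z + (b2 + b3 \<omega>) x)\<close> in the tangent case.\<close>

lemma split_planes_split:
  assumes a: "a1 = 0" "a2 = 1" "a3 = 0" and b: "b1 \<noteq> 0" "b3 \<noteq> 0"
  shows "\<exists>c d1 d2 d1' d2'. split_planes c d1 d2 d1' d2'"
proof -
  \<comment> \<open>This is \<open>- b / a\<close> at the point \<open>(1 : 2 ^ n)\<close> of
    \<open>l\<close>, where \<open>a = x z\<close> takes the unit value
    \<open>2 ^ n\<close>.\<close>
  define c where "c n = - (b1 * inverse 2 ^ n + b2 + b3 * 2 ^ n)" for n :: nat
  define d1 d2 d1' d2' where "d1 n = (1 :: complex)" and "d2 n = (2 :: complex) ^ n"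
    and "d1' n = b3" and "d2' n = b1 * inverse 2 ^ n" for n :: nat
  have inv: "inverse 2 ^ n = inverse ((2::complex) ^ n)" for n :: nat by (simp only: power_inverse)
  have ints: "{c n, d1 n, d2 n, d1' n, d2' n} \<subseteq> S_integers L S"
    if "S_arith L S" "inverse 2 \<in> S_integers L S" "{b1, b2, b3} \<subseteq> S_integers L S" for L S n
  proof -
    interpret S_arith L S by fact
    show ?thesis unfolding c_def d1_def d2_def d1'_def d2'_def insert_subset
      using that by (intro conjI empty_subsetI minus add mult power numeral one) auto
  qed
  have af: "F (x + t * d1 n) (c n) (z + t * d2 n)
        = F x (c n) z + t * (F (x + d1 n) (c n) (z + d2 n) - F x (c n) z)" for n x z t
    by (rule F_along_direction) (simp add: a c_def d1_def d2_def inv field_simps power2_eq_square)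
  have af': "F (x + t * d1' n) (c n) (z + t * d2' n)
        = F x (c n) z + t * (F (x + d1' n) (c n) (z + d2' n) - F x (c n) z)" for n x z t
    by (rule F_along_direction) (simp add: a c_def d1'_def d2'_def inv field_simps power2_eq_square)
  have inf: "infinite {c n | n. d1 n * d2' n - d2 n * d1' n \<noteq> 0}"
  proof (rule infinite_values)
    fix y
    \<comment> \<open>A plane is tangent at no more than two points of \<open>l\<close>, so each
      value of \<open>c\<close> occurs only finitely often.\<close>
    have "poly [:b1, b2 + c n, b3:] (2 ^ n) = 0" for n by (simp add: c_def inv field_simps)
    then have "{n. c n = y} \<subseteq> {n. poly [:b1, b2 + y, b3:] (2 ^ n) = 0}" by blast
    then show "finite {n. c n = y}"
      by (rule finite_subset[OF _ finite_poly_root_power_2]) (use b in simp)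
  next
    \<comment> \<open>The two directions coincide only at a ramification point of the degree 2 map,
      where \<open>b1 = b3 * 4 ^ n\<close>.\<close>
    have "{n. \<not> d1 n * d2' n - d2 n * d1' n \<noteq> 0} \<subseteq> {n. poly [:b1, 0, - b3:] (2 ^ n) = 0}"
      by (auto simp: d1_def d2_def d1'_def d2'_def inv field_simps)
    then show "finite {n. \<not> d1 n * d2' n - d2 n * d1' n \<noteq> 0}"
      by (rule finite_subset[OF _ finite_poly_root_power_2]) (use b in simp)
  qed
  show ?thesis unfolding split_planes_def
    by (intro exI[of _ c] exI[of _ d1] exI[of _ d2] exI[of _ d1'] exI[of _ d2'] conjI allI impI ints af af' inf)
qed

lemma split_planes_tangent:
  assumes a: "a1 = 1" "a2 = 0" "a3 = 0" and b: "b3 \<noteq> 0"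
  shows "\<exists>c d1 d2 d1' d2'. split_planes c d1 d2 d1' d2'"
proof -
  \<comment> \<open>Again \<open>- b / a\<close> at \<open>(1 : 2 ^ n)\<close>; here
    \<open>a = x^2\<close> has the value 1.\<close>
  define c where "c n = - (b1 + b2 * 2 ^ n + b3 * (2 ^ n)\<^sup>2)" for n :: nat
  define d1 d2 d1' d2' where "d1 n = (1 :: complex)" and "d2 n = (2 :: complex) ^ n"
    and "d1' n = b3" and "d2' n = - (b2 + b3 * 2 ^ n)" for n :: nat
  have ints: "{c n, d1 n, d2 n, d1' n, d2' n} \<subseteq> S_integers L S"
    if "S_arith L S" "{b1, b2, b3} \<subseteq> S_integers L S" for L S n
  proof -
    interpret S_arith L S by fact
    show ?thesis unfolding c_def d1_def d2_def d1'_def d2'_def insert_subset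
      using that by (intro conjI empty_subsetI minus add mult power numeral one) auto
  qed
  have af: "F (x + t * d1 n) (c n) (z + t * d2 n)
        = F x (c n) z + t * (F (x + d1 n) (c n) (z + d2 n) - F x (c n) z)" for n x z t
    by (rule F_along_direction) (simp add: a c_def d1_def d2_def algebra_simps power2_eq_square)
  have af': "F (x + t * d1' n) (c n) (z + t * d2' n)
        = F x (c n) z + t * (F (x + d1' n) (c n) (z + d2' n) - F x (c n) z)" for n x z t
    by (rule F_along_direction) (simp add: a c_def d1'_def d2'_def algebra_simps power2_eq_square)
  have inf: "infinite {c n | n. d1 n * d2' n - d2 n * d1' n \<noteq> 0}"
  proof (rule infinite_values)
    fix y
    have "poly [:b1 + c n, b2, b3:] (2 ^ n) = 0" for n by (simp add: c_def algebra_simps power2_eq_square)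
    then have "{n. c n = y} \<subseteq> {n. poly [:b1 + y, b2, b3:] (2 ^ n) = 0}" by blast
    then show "finite {n. c n = y}"
      by (rule finite_subset[OF _ finite_poly_root_power_2]) (use b in simp)
  next
    have det: "d1 n * d2' n - d2 n * d1' n = - poly [:b2, 2 * b3:] (2 ^ n)" for n
      by (simp add: d1_def d2_def d1'_def d2'_def algebra_simps)
    have "{n. \<not> d1 n * d2' n - d2 n * d1' n \<noteq> 0} \<subseteq> {n. poly [:b2, 2 * b3:] (2 ^ n) = 0}"
      unfolding det by (simp only: neg_equal_0_iff_equal not_not order_refl)
    then show "finite {n. \<not> d1 n * d2' n - d2 n * d1' n \<noteq> 0}"
      by (rule finite_subset[OF _ finite_poly_root_power_2]) (use b in simp)
  qed
  show ?thesis unfolding split_planes_def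
    by (intro exI[of _ c] exI[of _ d1] exI[of _ d2] exI[of _ d1'] exI[of _ d2'] conjI allI impI ints af af' inf)
qed

end

section \<open>Coordinates adapted to the line\<close>

lemma complex_quadratic_root:
  fixes a b c :: complex
  assumes "a \<noteq> 0" shows "\<exists>x. a * x\<^sup>2 + b * x + c = 0"
proof -
  obtain r where r: "r\<^sup>2 = b\<^sup>2 - 4 * a * c" using power2_csqrt by blast
  have "4 * a * (a * ((r - b) / (2 * a))\<^sup>2 + b * ((r - b) / (2 * a)) + c) = r\<^sup>2 - (b\<^sup>2 - 4 * a * c)"
    using assms by (simp add: field_simps power2_eq_square)
  then have "a * ((r - b) / (2 * a))\<^sup>2 + b * ((r - b) / (2 * a)) + c = 0" using r assms by simp
  then show ?thesis by blast
qed

locale cubic_and_plane =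
  fixes f h :: "4 mpoly" and T :: "complex ^ 4 \<Rightarrow> complex ^ 4 \<Rightarrow> complex ^ 4 \<Rightarrow> complex"
  assumes f: "homogeneous 3 f" and h: "homogeneous 1 h"
    and T: "symmetric_trilinear T" and fT: "\<And>x. peval f x = T x x x"
    and T_in: "\<And>K u v w. number_field K \<Longrightarrow> coeffs_in K f \<Longrightarrow> vec_over K u \<Longrightarrow> vec_over K v \<Longrightarrow> vec_over K w \<Longrightarrow> T u v w \<in> K"
    and smooth: "\<And>x. x \<noteq> 0 \<Longrightarrow> T x x x = 0 \<Longrightarrow> \<exists>u. T x x u \<noteq> 0"
begin

lemma T_sym: "T u v w = T v u w" "T u v w = T u w v"
  using T unfolding symmetric_trilinear_def by blast+

lemma T_lin: "T (a *s u + u') v w = a * T u v w + T u' v w"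
  using T unfolding symmetric_trilinear_def by blast

lemma T_add: "T (u + u') v w = T u v w + T u' v w" "T v (u + u') w = T v u w + T v u' w"
  "T v w (u + u') = T v w u + T v w u'"
proof -
  show 1: "T (u + u') v w = T u v w + T u' v w" for u u' v w using T_lin[of 1 u u'] by simp
  then show 2: "T v (u + u') w = T v u w + T v u' w" for u u' v w using T_sym by metis
  then show "T v w (u + u') = T v w u + T v w u'" using T_sym by metis
qed

lemma T_scale: "T (a *s u) v w = a * T u v w" "T v (a *s u) w = a * T v u w" "T v w (a *s u) = a * T v w u"
proof -
  have "T 0 v w = 0" for v w using T_add(1)[of 0 0] by simp
  then show 1: "T (a *s u) v w = a * T u v w" for u v w using T_lin[of a u 0] by simp
  then show 2: "T v (a *s u) w = a * T v u w" for u v w using T_sym by metis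
  then show "T v w (a *s u) = a * T v w u" using T_sym by metis
qed

text \<open>The line through \<open>X\<close> and \<open>Z\<close> lies on the cubic, and \<open>h\<close> is the coordinate along \<open>W\<close>.\<close>

definition frame :: "complex set \<Rightarrow> complex ^ 4 \<Rightarrow> complex ^ 4 \<Rightarrow> complex ^ 4 \<Rightarrow> complex ^ 4 \<Rightarrow> bool" where
  "frame L X Y Z W \<longleftrightarrow> number_field L \<and> coeffs_in L f \<and> coeffs_in L h \<and>
     vec_over L X \<and> vec_over L Y \<and> vec_over L Z \<and> vec_over L W \<and>
     (\<forall>v. \<exists>x y z w. v = x *s X + y *s Y + z *s Z + w *s W) \<and>
     (\<forall>x y z w. x *s X + y *s Y + z *s Z + w *s W = 0 \<longrightarrow> x = 0 \<and> y = 0 \<and> z = 0 \<and> w = 0) \<and>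
     (\<forall>x y z w. peval h (x *s X + y *s Y + z *s Z + w *s W) = w) \<and>
     T X X X = 0 \<and> T X X Z = 0 \<and> T X Z Z = 0 \<and> T Z Z Z = 0"

lemma frameD:
  assumes "frame L X Y Z W"
  shows "number_field L" "coeffs_in L f" "coeffs_in L h" "vec_over L X" "vec_over L Y" "vec_over L Z" "vec_over L W"
    "\<exists>x y z w. v = x *s X + y *s Y + z *s Z + w *s W"
    "x *s X + y *s Y + z *s Z + w *s W = 0 \<Longrightarrow> x = 0 \<and> y = 0 \<and> z = 0 \<and> w = 0"
    "peval h (x *s X + y *s Y + z *s Z + w *s W) = w"
    "T X X X = 0" "T X X Z = 0" "T X Z Z = 0" "T Z Z Z = 0"
  using assms unfolding frame_def by blast+

lemma frame_mono: "frame L X Y Z W \<Longrightarrow> number_field L' \<Longrightarrow> L \<subseteq> L' \<Longrightarrow> frame L' X Y Z W"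
  unfolding frame_def coeffs_in_def vec_over_def by blast

lemma frame_change:
  assumes fr: "frame L X Y Z W" and L: "\<alpha> \<in> L" "\<beta> \<in> L" "\<gamma> \<in> L" "\<delta> \<in> L" and det: "\<alpha> * \<delta> - \<beta> * \<gamma> \<noteq> 0"
  shows "frame L (\<alpha> *s X + \<beta> *s Z) Y (\<gamma> *s X + \<delta> *s Z) W"
proof -
  note D = frameD[OF fr]
  let ?X = "\<alpha> *s X + \<beta> *s Z" and ?Z = "\<gamma> *s X + \<delta> *s Z"
  have comb: "x *s ?X + y *s Y + z *s ?Z + w *s W = (x * \<alpha> + z * \<gamma>) *s X + y *s Y + (x * \<beta> + z * \<delta>) *s Z + w *s W" for x y z w
    by (simp add: vec_eq_iff algebra_simps)
  have ov: "vec_over L ?X" "vec_over L ?Z"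
    using D(4,6) L unfolding vec_over_def by (auto intro!: nf_add[OF D(1)] nf_mult[OF D(1)])
  have sp: "\<exists>x y z w. v = x *s ?X + y *s Y + z *s ?Z + w *s W" for v
  proof -
    obtain x y z w where v: "v = x *s X + y *s Y + z *s Z + w *s W" using D(8) by blast
    let ?d = "\<alpha> * \<delta> - \<beta> * \<gamma>"
    let ?x = "(x * \<delta> - z * \<gamma>) / ?d" and ?z = "(z * \<alpha> - x * \<beta>) / ?d"
    have "?d * (?x * \<alpha> + ?z * \<gamma>) = ?d * x" "?d * (?x * \<beta> + ?z * \<delta>) = ?d * z"
      using det by (simp_all add: distrib_left) (simp_all add: algebra_simps)
    then have "?x * \<alpha> + ?z * \<gamma> = x" "?x * \<beta> + ?z * \<delta> = z" using det by simp_all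
    then have "v = ?x *s ?X + y *s Y + ?z *s ?Z + w *s W" unfolding comb v by simp
    then show ?thesis by blast
  qed
  have ind: "x = 0 \<and> y = 0 \<and> z = 0 \<and> w = 0" if "x *s ?X + y *s Y + z *s ?Z + w *s W = 0" for x y z w
  proof -
    have 1: "x * \<alpha> + z * \<gamma> = 0" "y = 0" "x * \<beta> + z * \<delta> = 0" "w = 0" using D(9) that unfolding comb by blast+
    have "x * (\<alpha> * \<delta> - \<beta> * \<gamma>) = (x * \<alpha> + z * \<gamma>) * \<delta> - (x * \<beta> + z * \<delta>) * \<gamma>"
      "z * (\<alpha> * \<delta> - \<beta> * \<gamma>) = (x * \<beta> + z * \<delta>) * \<alpha> - (x * \<alpha> + z * \<gamma>) * \<beta>"
      by (simp_all add: algebra_simps)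
    then show ?thesis using 1 det by simp
  qed
  have hv: "peval h (x *s ?X + y *s Y + z *s ?Z + w *s W) = w" for x y z w unfolding comb by (rule D(10))
  have "T Z X X = 0" "T Z X Z = 0" "T X Z X = 0" "T Z Z X = 0" using D(12,13) T_sym by metis+
  then have line: "T ?X ?X ?X = 0" "T ?X ?X ?Z = 0" "T ?X ?Z ?Z = 0" "T ?Z ?Z ?Z = 0"
    using D(11-14) by (simp_all add: T_add T_scale)
  show ?thesis unfolding frame_def by (intro conjI allI impI D(1-3,5,7) ov hv line sp) (use ind in blast)+
qed

lemma frame_scale:
  assumes fr: "frame L X Y Z W" and c: "c \<in> L" "c \<noteq> 0"
  shows "frame L X (c *s Y) Z W"
proof -
  note D = frameD[OF fr]
  have comb: "x *s X + y *s (c *s Y) + z *s Z + w *s W = x *s X + (y * c) *s Y + z *s Z + w *s W" for x y z w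
    by (simp add: vec_eq_iff algebra_simps)
  have ov: "vec_over L (c *s Y)" using D(5) c unfolding vec_over_def by (auto intro!: nf_mult[OF D(1)])
  have sp: "\<exists>x y z w. v = x *s X + y *s (c *s Y) + z *s Z + w *s W" for v
  proof -
    obtain x y z w where v: "v = x *s X + y *s Y + z *s Z + w *s W" using D(8) by blast
    then have "v = x *s X + (y / c) *s (c *s Y) + z *s Z + w *s W" unfolding comb using c by simp
    then show ?thesis by blast
  qed
  have ind: "x = 0 \<and> y = 0 \<and> z = 0 \<and> w = 0" if "x *s X + y *s (c *s Y) + z *s Z + w *s W = 0" for x y z w
    using D(9)[of x "y * c" z w] that c unfolding comb by simp
  have hv: "peval h (x *s X + y *s (c *s Y) + z *s Z + w *s W) = w" for x y z w unfolding comb by (rule D(10))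
  show ?thesis unfolding frame_def by (intro conjI allI impI D(1-4,6,7) D(11-14) ov hv sp) (use ind in blast)+
qed

lemma frame_swap: "frame L X Y Z W \<Longrightarrow> frame L Z Y X W"
  using frame_change[of L X Y Z W 0 1 1 0] frameD(1) nf_zero nf_one by fastforce

lemma smooth_in_frame:
  assumes fr: "frame L X Y Z W" and v: "v = x *s X + y *s Y + z *s Z" "x \<noteq> 0 \<or> y \<noteq> 0 \<or> z \<noteq> 0" and "T v v v = 0"
  shows "T v v X \<noteq> 0 \<or> T v v Y \<noteq> 0 \<or> T v v Z \<noteq> 0 \<or> T v v W \<noteq> 0"
proof -
  have "v \<noteq> 0"
  proof
    assume "v = 0"
    then have "x *s X + y *s Y + z *s Z + 0 *s W = 0" using v by simp
    then show False using frameD(9)[OF fr] v(2) by blast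
  qed
  then obtain u where u: "T v v u \<noteq> 0" using smooth assms(4) by blast
  obtain a b c d where "u = a *s X + b *s Y + c *s Z + d *s W" using frameD(8)[OF fr] by blast
  then show ?thesis using u by (auto simp: T_add T_scale)
qed

text \<open>Up to constant factors these are the coefficients of \<open>a\<close>. If all vanished,
  the plane would be tangent to the surface along the whole line; the derivative in direction
  \<open>W\<close> is a binary quadratic form on the line, and its zero would be a singular
  point.\<close>

lemma frame_contact_form_nonzero:
  assumes fr: "frame L X Y Z W" shows "T X X Y \<noteq> 0 \<or> T X Y Z \<noteq> 0 \<or> T Y Z Z \<noteq> 0"
proof (rule ccontr)
  assume "\<not> ?thesis"
  then have a: "T X X Y = 0" "T X Y Z = 0" "T Y Z Z = 0" by auto
  note D = frameD[OF fr]
  have "\<exists>x z. (x \<noteq> 0 \<or> z \<noteq> 0) \<and> T X X W * x\<^sup>2 + 2 * T X Z W * x * z + T Z Z W * z\<^sup>2 = 0"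
  proof (cases "T X X W = 0")
    case True then show ?thesis by (intro exI[of _ 1] exI[of _ 0]) simp
  next
    case False
    then obtain x where "T X X W * x\<^sup>2 + (2 * T X Z W) * x + T Z Z W = 0" using complex_quadratic_root by blast
    then show ?thesis by (intro exI[of _ x] exI[of _ 1]) simp
  qed
  then obtain x z where xz: "x \<noteq> 0 \<or> z \<noteq> 0" "T X X W * x\<^sup>2 + 2 * T X Z W * x * z + T Z Z W * z\<^sup>2 = 0" by blast
  define v where "v = x *s X + 0 *s Y + z *s Z"
  have s: "T Z X X = 0" "T Z X Z = 0" "T X Z X = 0" "T Z Z X = 0" "T Z X Y = 0" "T X Z Y = 0" "T Z Z Y = 0" "T Z X W = T X Z W"
    using D(12,13) a T_sym by metis+
  have "T v v v = 0" "T v v X = 0" "T v v Y = 0" "T v v Z = 0"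
    using D(11-14) s a by (simp_all add: v_def T_add T_scale)
  moreover have "T v v W = 0" using xz(2) s by (simp add: v_def T_add T_scale algebra_simps power2_eq_square)
  ultimately show False using smooth_in_frame[OF fr v_def] xz(1) by blast
qed

text \<open>The zeros of the binary form \<open>a\<close> are adjoined and serve as coordinate
  vectors: two distinct ones lead to \<open>x z\<close>, a double one to \<open>x^2\<close>, and
  \<open>Z'\<close> is a zero in either case. The factors 6 and 3 are the multiplicities with which
  \<open>T X Y Z\<close> and \<open>T X X Y\<close> occur in the expanded cubic.\<close>

lemma frame_normal_form:
  assumes fr: "frame L X Y Z W"
  shows "\<exists>L' X' Y' Z'. L \<subseteq> L' \<and> frame L' X' Y' Z' W \<and> T Y' Z' Z' = 0 \<and>
    (T X' X' Y' = 0 \<and> 6 * T X' Y' Z' = 1 \<or> 3 * T X' X' Y' = 1 \<and> T X' Y' Z' = 0)"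
proof -
  have main: "\<exists>L' X' Z'. L \<subseteq> L' \<and> frame L' X' Y Z' W \<and> T Y Z' Z' = 0 \<and>
    (T X' X' Y = 0 \<and> T X' Y Z' \<noteq> 0 \<or> T X' X' Y \<noteq> 0 \<and> T X' Y Z' = 0)"
    if fr: "frame L X Y Z W" and A: "T X X Y \<noteq> 0" for X Z
  proof -
    note D = frameD[OF fr]
    obtain \<rho> where \<rho>: "T X X Y * \<rho>\<^sup>2 + (2 * T X Y Z) * \<rho> + T Y Z Z = 0" using complex_quadratic_root[OF A] by blast
    have "2 * T X Y Z \<in> L" using T_in[OF D(1,2,4,5,6)] nf_mult[OF D(1) nf_numeral[OF D(1)]] by blast
    then obtain L' where L': "number_field L'" "L \<subseteq> L'" "\<rho> \<in> L'"
      using adjoin_quadratic_root[OF D(1) T_in[OF D(1,2,4,4,5)] _ T_in[OF D(1,2,5,6,6)] disjI1[OF A] \<rho>] by blast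
    have fr': "frame L' X Y Z W" using frame_mono[OF fr] L' by blast
    note D' = frameD[OF fr']
    note I = nf_zero[OF L'(1)] nf_one[OF L'(1)]
    \<comment> \<open>The other root by Vieta, which shows that it lies in the same field.\<close>
    define \<rho>' where "\<rho>' = - (2 * T X Y Z) / T X X Y - \<rho>"
    have \<rho>'L: "\<rho>' \<in> L'" unfolding \<rho>'_def
      using T_in[OF D'(1,2,4,5,6)] T_in[OF D'(1,2,4,4,5)] L'(3)
      by (intro nf_diff[OF L'(1)] nf_divide[OF L'(1)] nf_minus[OF L'(1)] nf_mult[OF L'(1)] nf_numeral[OF L'(1)])
    have B: "2 * T X Y Z = - T X X Y * (\<rho> + \<rho>')" unfolding \<rho>'_def using A by (simp add: field_simps)
    have C: "T Y Z Z = T X X Y * (\<rho> * \<rho>')"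
    proof -
      have "T Y Z Z = (T X X Y * \<rho>\<^sup>2 + (2 * T X Y Z) * \<rho> + T Y Z Z) - T X X Y * \<rho>\<^sup>2 - (2 * T X Y Z) * \<rho>"
        by simp
      also have "\<dots> = - T X X Y * \<rho>\<^sup>2 - (2 * T X Y Z) * \<rho>" unfolding \<rho> by simp
      finally show ?thesis unfolding B by (simp add: algebra_simps power2_eq_square)
    qed
    have s: "T X Y X = T X X Y" "T Z Y X = T X Y Z" "T Z Y Z = T Y Z Z" "T X Z Y = T X Y Z" "T Z X Y = T X Y Z"
      "T Y X X = T X X Y" "T Y X Z = T X Y Z" "T Y Z X = T X Y Z" "T Z Z Y = T Y Z Z" using T_sym by metis+
    have root: "T X X Y * t\<^sup>2 + (2 * T X Y Z) * t + T Y Z Z = T X X Y * (t - \<rho>) * (t - \<rho>')" for t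
      unfolding B C by (simp add: algebra_simps power2_eq_square)
    show ?thesis
    proof (cases "\<rho> = \<rho>'")
      case False
      let ?X = "\<rho> *s X + 1 *s Z" and ?Z = "\<rho>' *s X + 1 *s Z"
      have "frame L' ?X Y ?Z W" using False by (intro frame_change[OF fr'] I L' \<rho>'L) simp
      moreover have "T Y ?Z ?Z = T X X Y * \<rho>'\<^sup>2 + (2 * T X Y Z) * \<rho>' + T Y Z Z"
        by (simp add: T_add T_scale s algebra_simps power2_eq_square)
      then have "T Y ?Z ?Z = 0" unfolding root by simp
      moreover have "T ?X ?X Y = T X X Y * \<rho>\<^sup>2 + (2 * T X Y Z) * \<rho> + T Y Z Z"
        by (simp add: T_add T_scale s algebra_simps power2_eq_square)
      then have "T ?X ?X Y = 0" unfolding root by simp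
      moreover have "2 * T ?X Y ?Z = 2 * T X X Y * \<rho> * \<rho>' + (2 * T X Y Z) * (\<rho> + \<rho>') + 2 * T Y Z Z"
        by (simp add: T_add T_scale s algebra_simps power2_eq_square)
      then have "2 * T ?X Y ?Z = - T X X Y * (\<rho> - \<rho>')\<^sup>2" unfolding B C by (simp add: algebra_simps power2_eq_square)
      then have "T ?X Y ?Z \<noteq> 0" using A False by auto
      ultimately show ?thesis using L'(2) by blast
    next
      case True
      let ?X = "1 *s X + 0 *s Z" and ?Z = "\<rho> *s X + 1 *s Z"
      have "frame L' ?X Y ?Z W" by (intro frame_change[OF fr'] I L') simp
      moreover have "T Y ?Z ?Z = T X X Y * \<rho>\<^sup>2 + (2 * T X Y Z) * \<rho> + T Y Z Z"
        by (simp add: T_add T_scale s algebra_simps power2_eq_square)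
      then have "T Y ?Z ?Z = 0" unfolding root by simp
      moreover have "T ?X ?X Y \<noteq> 0" using A by simp
      moreover have "2 * T ?X Y ?Z = 2 * T X X Y * \<rho> + 2 * T X Y Z"
        by (simp add: T_add T_scale s algebra_simps)
      then have "T ?X Y ?Z = 0" unfolding B using True by (simp add: algebra_simps)
      ultimately show ?thesis using L'(2) by blast
    qed
  qed
  have "\<exists>L' X' Z'. L \<subseteq> L' \<and> frame L' X' Y Z' W \<and> T Y Z' Z' = 0 \<and>
    (T X' X' Y = 0 \<and> T X' Y Z' \<noteq> 0 \<or> T X' X' Y \<noteq> 0 \<and> T X' Y Z' = 0)"
  proof -
    have "T Z Z Y = T Y Z Z" using T_sym by metis
    then consider "T X X Y \<noteq> 0" | "T Z Z Y \<noteq> 0" | "T X X Y = 0" "T Y Z Z = 0" "T X Y Z \<noteq> 0"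
      using frame_contact_form_nonzero[OF fr] by metis
    then show ?thesis
      using main[OF fr] main[OF frame_swap[OF fr]] fr by cases blast+
  qed
  then obtain L' X' Z' where 1: "L \<subseteq> L'" "frame L' X' Y Z' W" "T Y Z' Z' = 0"
    "T X' X' Y = 0 \<and> T X' Y Z' \<noteq> 0 \<or> T X' X' Y \<noteq> 0 \<and> T X' Y Z' = 0" by blast
  note D = frameD[OF 1(2)]
  define c where "c = (if T X' X' Y = 0 then inverse (6 * T X' Y Z') else inverse (3 * T X' X' Y))"
  have c0: "c \<noteq> 0" using 1(4) by (auto simp: c_def)
  have cL: "c \<in> L'" unfolding c_def using T_in[OF D(1,2,4,5,6)] T_in[OF D(1,2,4,4,5)]
    by (auto intro!: nf_inverse[OF D(1)] nf_mult[OF D(1)] nf_numeral[OF D(1)] simp del: inverse_mult_distrib)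
  have "frame L' X' (c *s Y) Z' W" by (rule frame_scale[OF 1(2) cL c0])
  moreover have "T (c *s Y) Z' Z' = 0" using 1(3) by (simp add: T_scale)
  moreover have "T X' X' (c *s Y) = 0 \<and> 6 * T X' (c *s Y) Z' = 1 \<or> 3 * T X' X' (c *s Y) = 1 \<and> T X' (c *s Y) Z' = 0"
    using 1(4) by (auto simp: T_scale c_def)
  ultimately show ?thesis using 1(1) by blast
qed

end

section \<open>From adapted coordinates to potential density\<close>

context cubic_and_plane begin

text \<open>In a normalised frame the cubic has the shape of \<open>cubic_containing_line\<close>,
  with values of \<open>T\<close> on basis vectors times multinomial coefficients as parameters.
  Smoothness supplies the nonvanishing conditions: \<open>b\<close> is nonzero at the zeros of
  \<open>a\<close>, and the residual conic at infinity is no double line.\<close>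

lemma potentially_dense_of_frame:
  assumes K: "K \<subseteq> K'" and fr0: "frame K' X0 Y0 Z0 W"
  shows "integral_points_potentially_dense K proj_space (zero_locus {f} \<union> zero_locus {h})"
proof -
  obtain L X Y Z where L: "K' \<subseteq> L" "frame L X Y Z W" "T Y Z Z = 0"
    "T X X Y = 0 \<and> 6 * T X Y Z = 1 \<or> 3 * T X X Y = 1 \<and> T X Y Z = 0"
    using frame_normal_form[OF fr0] by blast
  note D = frameD[OF L(2)]
  have n: "3 \<in> L" "6 \<in> L" by (intro nf_numeral[OF D(1)])+
  have TL: "T u v w \<in> L" if "u \<in> {X, Y, Z, W}" "v \<in> {X, Y, Z, W}" "w \<in> {X, Y, Z, W}" for u v w
    using that D(4-7) by (intro T_in[OF D(1,2)]) auto
  have "{3 * T X X Y, 6 * T X Y Z, 3 * T Y Z Z, 3 * T X X W, 6 * T X Z W, 3 * T Z Z W, 3 * T X Y Y, 3 * T Y Y Z,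
      6 * T X Y W, 6 * T Y Z W, 3 * T X W W, 3 * T Z W W, T Y Y Y, 3 * T Y Y W, 3 * T Y W W, T W W W} \<subseteq> L"
    unfolding insert_subset by (intro conjI empty_subsetI nf_mult[OF D(1)] n TL) simp_all
  then interpret C: cubic_containing_line L "3 * T X X Y" "6 * T X Y Z" "3 * T Y Z Z" "3 * T X X W" "6 * T X Z W"
    "3 * T Z Z W" "3 * T X Y Y" "3 * T Y Y Z" "6 * T X Y W" "6 * T Y Z W" "3 * T X W W" "3 * T Z W W"
    "T Y Y Y" "3 * T Y Y W" "3 * T Y W W" "T W W W"
    using D(1) by unfold_locales
  have sym: "T Y X X = T X X Y" "T X Y X = T X X Y" "T Z X X = 0" "T X Z X = 0" "T W X X = T X X W" "T X W X = T X X W"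
    "T X Z Y = T X Y Z" "T Y X Z = T X Y Z" "T Y Z X = T X Y Z" "T Z X Y = T X Y Z" "T Z Y X = T X Y Z"
    "T Z Y Z = T Y Z Z" "T Z Z Y = T Y Z Z" "T Z X Z = 0" "T Z Z X = 0"
    "T X W Z = T X Z W" "T Z X W = T X Z W" "T Z W X = T X Z W" "T W X Z = T X Z W" "T W Z X = T X Z W"
    "T Z W Z = T Z Z W" "T W Z Z = T Z Z W" "T Y X Y = T X Y Y" "T Y Y X = T X Y Y" "T Y Z Y = T Y Y Z" "T Z Y Y = T Y Y Z"
    "T X W Y = T X Y W" "T Y X W = T X Y W" "T Y W X = T X Y W" "T W X Y = T X Y W" "T W Y X = T X Y W"
    "T Y W Z = T Y Z W" "T Z Y W = T Y Z W" "T Z W Y = T Y Z W" "T W Y Z = T Y Z W" "T W Z Y = T Y Z W"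
    "T W X W = T X W W" "T W W X = T X W W" "T W Z W = T Z W W" "T W W Z = T Z W W"
    "T Y W Y = T Y Y W" "T W Y Y = T Y Y W" "T W Y W = T Y W W" "T W W Y = T Y W W"
    using T_sym D(12,13) by metis+
  have F: "C.F x y z = peval f (x *s X + y *s Y + z *s Z + W)" for x y z
  proof -
    have "T (x *s X + y *s Y + z *s Z + W) (x *s X + y *s Y + z *s Z + W) (x *s X + y *s Y + z *s Z + W) = C.F x y z"
      unfolding C.F_def by (simp add: T_add T_scale sym D(11-14) algebra_simps power2_eq_square power3_eq_cube)
    then show ?thesis unfolding fT ..
  qed
  \<comment> \<open>\<open>Z\<close> is a zero of \<open>a\<close>, so all derivatives along the
    plane vanish there and smoothness leaves the one along \<open>W\<close>.\<close>
  have bZ: "T Z Z W \<noteq> 0"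
    using smooth_in_frame[OF L(2), of Z 0 0 1] D(14) sym L(3) by simp
  have main: "C.has_constant_line \<and> (\<exists>c d1 d2 d1' d2'. C.split_planes c d1 d2 d1' d2')"
  proof (cases "T X X Y = 0")
    case True
    then have a: "3 * T X X Y = 0" "6 * T X Y Z = 1" "3 * T Y Z Z = 0" using L by auto
    have "T X X W \<noteq> 0" using smooth_in_frame[OF L(2), of X 1 0 0] D(11,12) True by simp
    then have b: "3 * T X X W \<noteq> 0" "3 * T Z Z W \<noteq> 0" using bZ by auto
    show ?thesis using C.constant_line_split[OF a b] C.split_planes_split[OF a b] by blast
  next
    case False
    then have a: "3 * T X X Y = 1" "6 * T X Y Z = 0" "3 * T Y Z Z = 0" using L by auto
    have b: "3 * T Z Z W \<noteq> 0" using bZ by simp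
    have "C.has_constant_line"
    proof (cases "3 * T Y Y Z = 0")
      case m: True
      obtain \<rho> where \<rho>: "1 * \<rho>\<^sup>2 + 3 * T X Y Y * \<rho> + T Y Y Y = 0"
        using complex_quadratic_root[of 1] by auto
      have "2 * \<rho> + 3 * T X Y Y \<noteq> 0"
      proof
        \<comment> \<open>For a double root, \<open>x = \<rho> y\<close> is a double line of the
          plane section. All derivatives along the plane vanish on it, and the one along
          \<open>W\<close> is a polynomial in \<open>z\<close> of degree 2, by \<open>bZ\<close>;
          its zero is a singular point.\<close>
        assume d: "2 * \<rho> + 3 * T X Y Y = 0"
        obtain z where z: "3 * T Z Z W * z\<^sup>2 + (6 * T X Z W * \<rho> + 6 * T Y Z W) * z
            + (3 * T X X W * \<rho>\<^sup>2 + 6 * T X Y W * \<rho> + 3 * T Y Y W) = 0"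
          using complex_quadratic_root[OF b] by blast
        define v where "v = \<rho> *s X + 1 *s Y + z *s Z"
        have m0: "T Y Y Z = 0" "T X Y Z = 0" using m a by auto
        have "T v v v = (3 * T X X Y) * \<rho>\<^sup>2 + 3 * T X Y Y * \<rho> + T Y Y Y"
          by (simp add: v_def T_add T_scale sym D(11-14) m0 L(3) algebra_simps power2_eq_square)
        then have v0: "T v v v = 0" using \<rho> unfolding a by simp
        have "3 * T v v X = (3 * T X X Y) * 2 * \<rho> + 3 * T X Y Y"
          by (simp add: v_def T_add T_scale sym D(11-14) m0 L(3) algebra_simps)
        then have vX: "T v v X = 0" using d unfolding a by simp
        have "3 * T v v Y = (3 * T X X Y) * \<rho>\<^sup>2 + 2 * (3 * T X Y Y) * \<rho> + 3 * T Y Y Y"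
          by (simp add: v_def T_add T_scale sym D(11-14) m0 L(3) algebra_simps power2_eq_square)
        also have "\<dots> = 3 * (1 * \<rho>\<^sup>2 + 3 * T X Y Y * \<rho> + T Y Y Y) - \<rho> * (2 * \<rho> + 3 * T X Y Y)"
          unfolding a by (simp add: algebra_simps power2_eq_square)
        finally have vY: "T v v Y = 0" unfolding \<rho> d by simp
        have vZ: "T v v Z = 0"
          by (simp add: v_def T_add T_scale sym D(11-14) m0 L(3))
        have "3 * T v v W = 3 * T Z Z W * z\<^sup>2 + (6 * T X Z W * \<rho> + 6 * T Y Z W) * z
            + (3 * T X X W * \<rho>\<^sup>2 + 6 * T X Y W * \<rho> + 3 * T Y Y W)"
          by (simp add: v_def T_add T_scale sym algebra_simps power2_eq_square)
        then have "T v v W = 0" unfolding z by simp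
        then show False using smooth_in_frame[OF L(2) v_def _ v0] vX vY vZ by simp
      qed
      then show ?thesis using C.constant_line_concurrent[OF a b m, of \<rho>] \<rho> by simp
    qed (rule C.constant_line_tangent[OF a b])
    then show ?thesis using C.split_planes_tangent[OF a b] by blast
  qed
  from main obtain L' p1 p2 e1 e2 \<kappa> where L': "number_field L'" "L \<subseteq> L'" and base: "p1 \<in> L'" "p2 \<in> L'" "e1 \<in> L'" "e2 \<in> L'"
      "\<kappa> \<in> L'" "\<kappa> \<noteq> 0" "\<And>y. C.F (e1 + y * p1) y (e2 + y * p2) = \<kappa>"
    unfolding C.has_constant_line_def by blast
  note D' = frameD[OF frame_mono[OF L(2) L']]
  let ?A = "{3 * T X X W, 6 * T X Z W, 3 * T Z Z W}"
  have A: "finite ?A" "?A \<subseteq> L'"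
    using L'(2) nf_mult[OF D(1)] n TL by auto
  obtain c d1 d2 d1' d2' where "C.split_planes c d1 d2 d1' d2'" using main by blast
  note split = this[unfolded C.split_planes_def]
  show ?thesis
  proof (rule density_from_conic_fibration[OF L'(1) _ f D'(2) h D'(3) _ D'(8) D'(10) F base A split[THEN conjunct1, rule_format]
      split[THEN conjunct2, THEN conjunct1, rule_format] split[THEN conjunct2, THEN conjunct2, THEN conjunct1, rule_format]
      split[THEN conjunct2, THEN conjunct2, THEN conjunct2]])
    show "K \<subseteq> L'" using K L(1) L'(2) by blast
    show "X $ i \<in> L' \<and> Y $ i \<in> L' \<and> Z $ i \<in> L' \<and> W $ i \<in> L'" for i
      using D'(4-7) unfolding vec_over_def by blast
  qed
qed

definition plane_basis :: "complex set \<Rightarrow> complex ^ 4 \<Rightarrow> complex ^ 4 \<Rightarrow> complex ^ 4 \<Rightarrow> complex ^ 4 \<Rightarrow> bool" where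
  "plane_basis K E1 E2 E3 W \<longleftrightarrow> vec_over K E1 \<and> vec_over K E2 \<and> vec_over K E3 \<and> vec_over K W \<and>
     (\<forall>v. \<exists>x y z w. v = x *s E1 + y *s E2 + z *s E3 + w *s W) \<and>
     (\<forall>x y z w. x *s E1 + y *s E2 + z *s E3 + w *s W = 0 \<longrightarrow> x = 0 \<and> y = 0 \<and> z = 0 \<and> w = 0) \<and>
     (\<forall>x y z w. peval h (x *s E1 + y *s E2 + z *s E3 + w *s W) = w)"

lemma plane_basis_rotate:
  assumes "plane_basis K E1 E2 E3 W" shows "plane_basis K E2 E3 E1 W"
proof -
  have c: "x *s E2 + y *s E3 + z *s E1 + w *s W = z *s E1 + x *s E2 + y *s E3 + w *s W" for x y z w
    by (simp add: add_ac)
  show ?thesis using assms unfolding plane_basis_def c by metis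
qed

lemma plane_basis_exists:
  assumes K: "number_field K" and hK: "coeffs_in K h" "h \<noteq> 0"
  shows "\<exists>E1 E2 E3 W. plane_basis K E1 E2 E3 W"
proof -
  obtain a i0 where a: "\<And>i. a i \<in> K" "a i0 \<noteq> 0" "\<And>x. peval h x = (\<Sum>i\<in>UNIV. a i * x $ i)"
    using linear_form[OF hK(2) h hK(1) nf_zero[OF K]] by blast
  have "card (UNIV - {i0}) = 3" by (simp add: card_Diff_singleton)
  then obtain i1 i2 i3 where i: "UNIV - {i0} = {i1, i2, i3}" "i1 \<noteq> i2" "i1 \<noteq> i3" "i2 \<noteq> i3"
    unfolding card_3_iff by blast
  have U: "UNIV = {i0, i1, i2, i3}" using i(1) by blast
  have ne: "i0 \<noteq> i1" "i0 \<noteq> i2" "i0 \<noteq> i3" using i(1) by blast+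
  have hv: "peval h x = a i0 * x $ i0 + a i1 * x $ i1 + a i2 * x $ i2 + a i3 * x $ i3" for x
    unfolding a(3) U using i ne by (simp add: add_ac)
  define E where "E i = axis i 1 - (a i / a i0) *s axis i0 (1::complex)" for i
  define W where "W = (1 / a i0) *s axis i0 (1::complex)"
  have cases4: "P j" if "P i0" "P i1" "P i2" "P i3" for P and j :: 4
    using that UNIV_I[of j] unfolding U by blast
  let ?v = "\<lambda>x y z w. x *s E i1 + y *s E i2 + z *s E i3 + w *s W"
  have comp: "?v x y z w $ i1 = x" "?v x y z w $ i2 = y" "?v x y z w $ i3 = z"
    "?v x y z w $ i0 = (w - a i1 * x - a i2 * y - a i3 * z) / a i0" for x y z w
    using i ne a(2) unfolding E_def W_def by (auto simp: axis_def field_simps)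
  have hval: "peval h (?v x y z w) = w" for x y z w
    unfolding hv comp using a(2) by (simp add: field_simps)
  have "vec_over K (E i)" for i
    unfolding vec_over_def E_def axis_def
    by (auto intro!: nf_diff[OF K] nf_divide[OF K] nf_mult[OF K] nf_zero[OF K] nf_one[OF K] nf_minus[OF K] a)
  moreover have "vec_over K W"
    unfolding vec_over_def W_def axis_def
    by (auto intro!: nf_divide[OF K] nf_zero[OF K] nf_one[OF K] a)
  moreover have "\<exists>x y z w. v = ?v x y z w" for v
  proof -
    have cj: "v $ j = ?v (v $ i1) (v $ i2) (v $ i3) (peval h v) $ j" for j
      by (rule cases4) (simp_all only: comp hv, use a(2) in \<open>simp add: field_simps\<close>)
    have "v = ?v (v $ i1) (v $ i2) (v $ i3) (peval h v)" by (rule iffD2[OF vec_eq_iff], rule allI, rule cj)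
    then show ?thesis by blast
  qed
  moreover have "x = 0 \<and> y = 0 \<and> z = 0 \<and> w = 0" if 0: "?v x y z w = 0" for x y z w
  proof -
    have "peval h (0 :: complex ^ 4) = 0" unfolding hv by simp
    then show ?thesis using comp[of x y z w] hval[of x y z w] unfolding 0 by simp
  qed
  ultimately have "plane_basis K (E i1) (E i2) (E i3) W" unfolding plane_basis_def using hval by blast
  then show ?thesis by blast
qed

end

section \<open>The line over a number field\<close>

lemma adjoin_root_of_nontrivial_relation:
  assumes K: "number_field K" and c: "\<And>i. c i \<in> K"
  shows "\<exists>i\<le>n. c i \<noteq> 0 \<Longrightarrow> (\<Sum>i\<le>n. c i * \<alpha> ^ i) = 0 \<Longrightarrow> \<exists>L. number_field L \<and> K \<subseteq> L \<and> \<alpha> \<in> L"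
proof (induction n)
  case 0
  then show ?case by simp
next
  case (Suc n)
  show ?case
  proof (cases "c (Suc n) = 0")
    case True
    then have "\<exists>i\<le>n. c i \<noteq> 0" using Suc.prems(1) le_Suc_eq by metis
    then show ?thesis using Suc.IH Suc.prems(2) True by simp
  qed (rule adjoin_root[OF K c _ Suc.prems(2)])
qed

context cubic_and_plane begin

lemma T_on_line: "T (A + t *s B) (A + t *s B) (A + t *s B) = T A A A + 3 * T A A B * t + 3 * T A B B * t\<^sup>2 + T B B B * t ^ 3"
proof -
  have "T A B A = T A A B" "T B A A = T A A B" "T B A B = T A B B" "T B B A = T A B B" using T_sym by metis+
  then show ?thesis by (simp add: T_add T_scale algebra_simps power2_eq_square power3_eq_cube)
qed

text \<open>The coefficients of a cubic polynomial are recovered from its values at 0, 1, -1 and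
  2.\<close>

lemma T_vanish_on_line:
  assumes "\<And>t. T (A + t *s B) (A + t *s B) (A + t *s B) = 0"
  shows "T A A A = 0" "T A A B = 0" "T A B B = 0" "T B B B = 0"
proof -
  note e = assms[unfolded T_on_line]
  show A: "T A A A = 0" using e[of 0] by simp
  have 1: "3 * T A A B + 3 * T A B B + T B B B = 0" using e[of 1] A by simp
  have 2: "- 3 * T A A B + 3 * T A B B - T B B B = 0" using e[of "- 1"] A by simp
  have 3: "6 * T A A B + 12 * T A B B + 8 * T B B B = 0" using e[of 2] A by (simp add: algebra_simps)
  have "6 * T A B B = (3 * T A A B + 3 * T A B B + T B B B) + (- 3 * T A A B + 3 * T A B B - T B B B)" by simp
  then show AB: "T A B B = 0" unfolding 1 2 by simp
  have "6 * T B B B = (6 * T A A B + 12 * T A B B + 8 * T B B B) - 2 * (3 * T A A B + 3 * T A B B + T B B B) - 6 * T A B B" by simp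
  then have "6 * T B B B = 0 - 2 * 0 - 6 * T A B B" by (simp only: 1 3)
  then show B: "T B B B = 0" by (simp add: AB)
  show "T A A B = 0" using 1 AB B by simp
qed

lemma frame_of_plane_basis:
  assumes K: "number_field K" "coeffs_in K f" "coeffs_in K h" and pb: "plane_basis K E1 E2 E3 W"
    and f0: "\<And>t. T (E1 + t *s E3) (E1 + t *s E3) (E1 + t *s E3) = 0"
  shows "frame K E1 E2 E3 W"
  using pb K T_vanish_on_line[OF f0] unfolding frame_def plane_basis_def by blast

lemma algebraic_slope:
  assumes K: "number_field K" "coeffs_in K f" "vec_over K A" "vec_over K B"
    and root: "T (A + t *s B) (A + t *s B) (A + t *s B) = 0"
    and nz: "\<exists>t. T (A + t *s B) (A + t *s B) (A + t *s B) \<noteq> 0"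
  shows "\<exists>L. number_field L \<and> K \<subseteq> L \<and> t \<in> L"
proof -
  define c where "c i = (if i = 0 then T A A A else if i = 1 then 3 * T A A B
    else if i = 2 then 3 * T A B B else if i = 3 then T B B B else 0)" for i :: nat
  have c: "c i \<in> K" for i unfolding c_def using K T_in nf_mult[OF K(1) nf_numeral[OF K(1)]] nf_zero[OF K(1)] by simp
  have val: "(\<Sum>i\<le>3. c i * t ^ i) = T (A + t *s B) (A + t *s B) (A + t *s B)" for t
    unfolding T_on_line by (simp add: c_def numeral_3_eq_3 numeral_2_eq_2 power3_eq_cube)
  have "\<exists>i\<le>3. c i \<noteq> 0"
  proof (rule ccontr)
    assume "\<not> ?thesis"
    then have "(\<Sum>i\<le>3. c i * t ^ i) = 0" for t by (intro sum.neutral) auto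
    then show False using nz unfolding val by blast
  qed
  then show ?thesis by (rule adjoin_root_of_nontrivial_relation[OF K(1) c]) (simp only: val root)
qed

text \<open>A line on the surface in the plane meets the coordinate lines \<open>E1 E3\<close> and \<open>E2 E3\<close> in points
  of the surface, hence in algebraic points unless one of these lines lies on the surface itself.\<close>

lemma frame_exists_of_minor:
  assumes K: "number_field K" "coeffs_in K f" "coeffs_in K h" and pb: "plane_basis K E1 E2 E3 W"
    and U: "vec.subspace U" "\<And>x. x \<in> U \<Longrightarrow> T x x x = 0"
    and u: "u1 *s E1 + u2 *s E2 + u3 *s E3 \<in> U" and v: "v1 *s E1 + v2 *s E2 + v3 *s E3 \<in> U"
    and n: "u1 * v2 - u2 * v1 \<noteq> 0"
  shows "\<exists>L X Y Z. K \<subseteq> L \<and> frame L X Y Z W"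
proof (cases "\<forall>t. T (E1 + t *s E3) (E1 + t *s E3) (E1 + t *s E3) = 0")
  case True
  then show ?thesis using frame_of_plane_basis[OF K pb] by blast
next
  case nz1: False
  show ?thesis
  proof (cases "\<forall>t. T (E2 + t *s E3) (E2 + t *s E3) (E2 + t *s E3) = 0")
    case True
    have "plane_basis K E2 E1 E3 W"
    proof -
      have c: "x *s E2 + y *s E1 + z *s E3 + w *s W = y *s E1 + x *s E2 + z *s E3 + w *s W" for x y z w
        by (simp add: add_ac)
      show ?thesis using pb unfolding plane_basis_def c by metis
    qed
    then show ?thesis using frame_of_plane_basis[OF K] True by blast
  next
    case nz2: False
    let ?n = "u1 * v2 - u2 * v1"
    \<comment> \<open>Cramer's rule: \<open>A\<close> and \<open>B\<close> are the vectors in the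
      span of the two given ones whose coordinates along \<open>E1\<close>, \<open>E2\<close> are
      \<open>(1, 0)\<close> and \<open>(0, 1)\<close>, so they lie on the lines \<open>E1 E3\<close>
      and \<open>E2 E3\<close>.\<close>
    define \<alpha> \<beta> where "\<alpha> = (v2 * u3 - u2 * v3) / ?n" and "\<beta> = (u1 * v3 - v1 * u3) / ?n"
    define A B where "A = E1 + \<alpha> *s E3" and "B = E2 + \<beta> *s E3"
    have comb: "x *s A + y *s B = ((x * v2 - y * v1) / ?n) *s (u1 *s E1 + u2 *s E2 + u3 *s E3)
        + ((y * u1 - x * u2) / ?n) *s (v1 *s E1 + v2 *s E2 + v3 *s E3)" for x y
    proof -
      have "?n *s (x *s A + y *s B) = (x * v2 - y * v1) *s (u1 *s E1 + u2 *s E2 + u3 *s E3)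
        + (y * u1 - x * u2) *s (v1 *s E1 + v2 *s E2 + v3 *s E3)"
      proof -
        have ab: "?n * \<alpha> = v2 * u3 - u2 * v3" "?n * \<beta> = u1 * v3 - v1 * u3"
          using n by (simp_all add: \<alpha>_def \<beta>_def)
        have "N *s (x *s A + y *s B) = (N * x) *s E1 + (N * y) *s E2 + (x * (N * \<alpha>) + y * (N * \<beta>)) *s E3" for N
          unfolding A_def B_def by (simp add: vec_eq_iff algebra_simps)
        from this[of ?n] show ?thesis unfolding ab by (simp add: vec_eq_iff algebra_simps)
      qed
      then have "(1 / ?n) *s (?n *s (x *s A + y *s B)) = (1 / ?n) *s ((x * v2 - y * v1) *s (u1 *s E1 + u2 *s E2 + u3 *s E3)
        + (y * u1 - x * u2) *s (v1 *s E1 + v2 *s E2 + v3 *s E3))" by simp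
      then show ?thesis using n by (simp add: vec.scale_right_distrib)
    qed
    have inU: "x *s A + y *s B \<in> U" for x y
      unfolding comb by (intro vec.subspace_add vec.subspace_scale U u v)
    have lineAB: "T (A + t *s B) (A + t *s B) (A + t *s B) = 0" for t using U(2)[OF inU[of 1 t]] by simp
    have TA: "T A A A = 0" "T B B B = 0" using U(2)[OF inU[of 1 0]] U(2)[OF inU[of 0 1]] by simp_all
    have ov: "vec_over K E1" "vec_over K E2" "vec_over K E3" "vec_over K W" using pb unfolding plane_basis_def by blast+
    obtain L1 where L1: "number_field L1" "K \<subseteq> L1" "\<alpha> \<in> L1"
      using algebraic_slope[OF K(1,2) ov(1,3) TA(1)[unfolded A_def]] nz1 by blast
    have "coeffs_in L1 f" "vec_over L1 E2" "vec_over L1 E3"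
      using K(2) ov L1(2) unfolding coeffs_in_def vec_over_def by blast+
    then obtain L where L: "number_field L" "L1 \<subseteq> L" "\<beta> \<in> L"
      using algebraic_slope[OF L1(1) _ _ _ TA(2)[unfolded B_def]] nz2 by blast
    have KL: "K \<subseteq> L" "\<alpha> \<in> L" using L1 L by blast+
    have cf: "coeffs_in L f" "coeffs_in L h" using K KL unfolding coeffs_in_def by blast+
    have ovL: "vec_over L A" "vec_over L E3" "vec_over L B" "vec_over L W"
      using ov KL L unfolding vec_over_def A_def B_def by (auto intro!: nf_add[OF L(1)] nf_mult[OF L(1)])
    have cmb: "x *s A + y *s E3 + z *s B + w *s W = x *s E1 + z *s E2 + (y + x * \<alpha> + z * \<beta>) *s E3 + w *s W" for x y z w
      unfolding A_def B_def by (simp add: vec_eq_iff algebra_simps)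
    have P: "\<exists>x y z w. v = x *s E1 + y *s E2 + z *s E3 + w *s W"
      "x *s E1 + y *s E2 + z *s E3 + w *s W = 0 \<Longrightarrow> x = 0 \<and> y = 0 \<and> z = 0 \<and> w = 0"
      "peval h (x *s E1 + y *s E2 + z *s E3 + w *s W) = w" for v x y z w
      using pb unfolding plane_basis_def by blast+
    have sp: "\<exists>x y z w. v = x *s A + y *s E3 + z *s B + w *s W" for v
    proof -
      obtain x y z w where v: "v = x *s E1 + y *s E2 + z *s E3 + w *s W" using P(1) by blast
      have "v = x *s A + (z - x * \<alpha> - y * \<beta>) *s E3 + y *s B + w *s W" unfolding cmb v by simp
      then show ?thesis by blast
    qed
    have ind: "x = 0 \<and> y = 0 \<and> z = 0 \<and> w = 0" if "x *s A + y *s E3 + z *s B + w *s W = 0" for x y z w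
      using P(2)[of x z "y + x * \<alpha> + z * \<beta>" w] that unfolding cmb by auto
    have hv: "peval h (x *s A + y *s E3 + z *s B + w *s W) = w" for x y z w unfolding cmb by (rule P(3))
    have "frame L A E3 B W" unfolding frame_def
      by (intro conjI allI impI L cf ovL sp hv T_vanish_on_line[OF lineAB]) (use ind in blast)+
    then show ?thesis using KL by blast
  qed
qed

text \<open>The line is known only as a complex subspace \<open>U\<close>. Two independent vectors
  of it have a nonzero minor in the coordinates \<open>E1\<close>, \<open>E2\<close>,
  \<open>E3\<close>, and rotating the basis brings that minor to the first two.\<close>

lemma frame_exists:
  assumes K: "number_field K" "coeffs_in K f" "coeffs_in K h" "h \<noteq> 0"
    and U: "vec.subspace U" "vec.dim U = 2" "\<And>x. x \<in> U \<Longrightarrow> T x x x = 0 \<and> peval h x = 0"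
  shows "\<exists>L X Y Z W. K \<subseteq> L \<and> frame L X Y Z W"
proof -
  obtain E1 E2 E3 W where pb: "plane_basis K E1 E2 E3 W" using plane_basis_exists[OF K(1,3,4)] by blast
  have P: "\<exists>x y z w. v = x *s E1 + y *s E2 + z *s E3 + w *s W"
      "peval h (x *s E1 + y *s E2 + z *s E3 + w *s W) = w" for v x y z w
      using pb unfolding plane_basis_def by blast+
  have coord: "\<exists>x y z. v = x *s E1 + y *s E2 + z *s E3" if "v \<in> U" for v
  proof -
    obtain x y z w where v: "v = x *s E1 + y *s E2 + z *s E3 + w *s W" using P(1) by blast
    have "w = 0" using U(3)[OF that] P(2)[of x y z w] unfolding v by simp
    then show ?thesis using v by auto
  qed
  obtain Bs where Bs: "Bs \<subseteq> U" "vec.independent Bs" "card Bs = 2"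
    using vec.basis_exists[of U] U(2) by metis
  obtain u v where uv: "Bs = {u, v}" "u \<noteq> v" using Bs(3) unfolding card_2_iff by blast
  have indep: "a = 0 \<and> b = 0" if ab: "a *s u + b *s v = 0" for a b
  proof (rule ccontr)
    assume "\<not> ?thesis"
    then have nz: "a \<noteq> 0 \<or> b \<noteq> 0" by blast
    define c where "c x = (if x = u then a else b)" for x
    have "(\<Sum>x\<in>Bs. c x *s x) = 0" using ab uv(2) unfolding uv(1) by (simp add: c_def)
    moreover have "\<exists>x\<in>Bs. c x \<noteq> 0"
    proof (cases "a = 0")
      case True
      then show ?thesis using nz uv by (intro bexI[of _ v]) (simp_all add: c_def)
    next
      case False
      then show ?thesis using uv by (intro bexI[of _ u]) (simp_all add: c_def)
    qed
    ultimately have "\<exists>c. (\<exists>x\<in>Bs. c x \<noteq> 0) \<and> (\<Sum>x\<in>Bs. c x *s x) = 0" by (intro exI[of _ c] conjI)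
    moreover have "finite Bs" using uv by simp
    ultimately have "vec.dependent Bs" using vec.dependent_finite[of Bs] by simp
    then show False using Bs(2) by contradiction
  qed
  have uU: "u \<in> U" "v \<in> U" using Bs uv by auto
  obtain u1 u2 u3 where u: "u = u1 *s E1 + u2 *s E2 + u3 *s E3" using coord[OF uU(1)] by blast
  obtain v1 v2 v3 where v: "v = v1 *s E1 + v2 *s E2 + v3 *s E3" using coord[OF uU(2)] by blast
  have U': "\<And>x. x \<in> U \<Longrightarrow> T x x x = 0" using U(3) by blast
  consider "u1 * v2 - u2 * v1 \<noteq> 0" | "u2 * v3 - u3 * v2 \<noteq> 0" | "u3 * v1 - u1 * v3 \<noteq> 0"
    | "u1 * v2 = u2 * v1" "u2 * v3 = u3 * v2" "u3 * v1 = u1 * v3" by force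
  then show ?thesis
  proof cases
    case 1
    show ?thesis using frame_exists_of_minor[OF K(1-3) pb U(1) U' uU[unfolded u v] 1] by blast
  next
    case 2
    have "u2 *s E2 + u3 *s E3 + u1 *s E1 \<in> U" "v2 *s E2 + v3 *s E3 + v1 *s E1 \<in> U"
      using uU unfolding u v by (simp_all add: add_ac)
    from frame_exists_of_minor[OF K(1-3) plane_basis_rotate[OF pb] U(1) U' this 2] show ?thesis by blast
  next
    case 3
    have "u3 *s E3 + u1 *s E1 + u2 *s E2 \<in> U" "v3 *s E3 + v1 *s E1 + v2 *s E2 \<in> U"
      using uU unfolding u v by (simp_all add: add_ac)
    from frame_exists_of_minor[OF K(1-3) plane_basis_rotate[OF plane_basis_rotate[OF pb]] U(1) U' this 3] show ?thesis by blast
  next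
    case 4
    \<comment> \<open>With all minors zero, \<open>u\<close> and \<open>v\<close> satisfy these
      three relations, and independence then forces \<open>u = 0\<close>.\<close>
    have "v1 *s u + (- u1) *s v = 0" "v2 *s u + (- u2) *s v = 0" "v3 *s u + (- u3) *s v = 0"
      unfolding u v using 4 by (simp_all add: vec_eq_iff algebra_simps)
    then have "u1 = 0" "u2 = 0" "u3 = 0" using indep by fastforce+
    then have "1 *s u + 0 *s v = 0" unfolding u by simp
    then show ?thesis using indep by fastforce
  qed
qed

end

theorem mainTheorem3:
  fixes K :: "complex set" and V E :: "(complex ^ 4) set set"
  assumes "number_field K"
    and "smooth_cubic_surface_over K V"
    and "plane_over K E"
    and "\<exists>l. proj_line l \<and> l \<subseteq> V \<inter> E"
  shows "integral_points_potentially_dense K proj_space (V \<union> E)"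
proof -
  obtain f where ff: "homogeneous 3 f" "coeffs_in K f" "V = zero_locus {f}"
    and sm: "\<And>P x. P \<in> V \<Longrightarrow> x \<in> P \<Longrightarrow> \<exists>i. peval (partial_deriv i f) x \<noteq> 0"
    using assms(2) unfolding smooth_cubic_surface_over_def by blast
  obtain h where hh: "h \<noteq> 0" "homogeneous 1 h" "coeffs_in K h" "E = zero_locus {h}"
    using assms(3) unfolding plane_over_def by blast
  obtain U where U: "vec.subspace U" "vec.dim U = 2" "{proj_point x | x. x \<in> U \<and> x \<noteq> 0} \<subseteq> V \<inter> E"
    using assms(4) unfolding proj_line_def by blast
  obtain T where Tf: "symmetric_trilinear T" "\<And>x. peval f x = T x x x"
    "\<And>K u v w. number_field K \<Longrightarrow> coeffs_in K f \<Longrightarrow> vec_over K u \<Longrightarrow> vec_over K v \<Longrightarrow> vec_over K w \<Longrightarrow> T u v w \<in> K"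
    using cubic_form_trilinear[OF ff(1)] by blast
  have self: "x \<in> proj_point x" for x :: "complex ^ 4" unfolding proj_point_def by (auto intro!: exI[of _ 1])
  interpret cubic_and_plane f h T
  proof
    fix x :: "complex ^ 4" assume x: "x \<noteq> 0" "T x x x = 0"
    have "peval f y = 0" if "y \<in> proj_point x" for y
      using that peval_scale[OF ff(1)] x Tf(2) unfolding proj_point_def by auto
    then have "proj_point x \<in> V" unfolding ff(3) zero_locus_def proj_space_def using x by blast
    then obtain i where "peval (partial_deriv i f) x \<noteq> 0" using sm self by blast
    then show "\<exists>u. T x x u \<noteq> 0" using partial_deriv_trilinear[OF Tf(1,2)] by auto
  qed (use ff hh Tf in auto)
  have vanish: "T x x x = 0 \<and> peval h x = 0" if "x \<in> U" for x
  proof (cases "x = 0")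
    case True
    then show ?thesis using peval_scale[OF ff(1), of 0 x] peval_scale[OF hh(2), of 0 x] Tf(2) by simp
  next
    case False
    then have "proj_point x \<in> zero_locus {f} \<inter> zero_locus {h}" using that U(3) ff(3) hh(4) by blast
    then show ?thesis using self Tf(2) unfolding zero_locus_def by auto
  qed
  obtain L X Y Z W where L: "K \<subseteq> L" "frame L X Y Z W"
    using frame_exists[OF assms(1) ff(2) hh(3,1) U(1,2) vanish] by blast
  show ?thesis unfolding ff(3) hh(4) by (rule potentially_dense_of_frame[OF L])
qed

end
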